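(* Let $\sigma\in(0,1)$, $\beta>0$, $c>0$, $r>0$, let $\Theta\sim\mathrm{SBSP}(\beta,\sigma,c)$, and let $Z_1,Z_2,\dots\mid\Theta$ be i.i.d. $\mathrm{NBP}(\Theta,r)$. Let $D_0,D_1\ge1$ be integers, let $0<N_{D_0}<\infty$ be the number of distinct units observed in $Z_{1:D_0}=(Z_1,\dots,Z_{D_0})$, and let $$U_{D_0}^{(D_1)}=\sum_{n\ge1}\mathbf 1\left(\sum_{d=1}^{D_0}A_{d,n}=0\right)\mathbf 1\left(\sum_{d=1}^{D_1}A_{D_0+d,n}>0\right)$$ be the number of units first observed in days $D_0+1,\dots,D_0+D_1$. Then $$U_{D_0}^{(D_1)}\mid Z_{1:D_0}\sim\mathrm{NegBin}\left(N_{D_0}+c+1,\ p_{D_0}^{(D_1)}\right),\qquad p_{D_0}^{(D_1)}=\frac{\psi_{D_0}^{(D_1)}}{\beta+\psi_0^{(D_0+D_1)}},$$ and the posterior expectation $\hat U_{D_0}^{(D_1)}$ of $U_{D_0}^{(D_1)}$ given $Z_{1:D_0}$ is $$\hat U_{D_0}^{(D_1)}=(N_{D_0}+c+1)\,\frac{p_{D_0}^{(D_1)}}{1-p_{D_0}^{(D_1)}}.$$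
   Context: Conventions. $\mathrm{NegBin}(a,p)$, for $a>0$ and $p\in(0,1)$, has mass function $x\mapsto\binom{x+a-1}{x}p^x(1-p)^a$ on $\{0,1,2,\dots\}$. $B(a,b)=\Gamma(a)\Gamma(b)/\Gamma(a+b)$, also for negative non-integer $b$. For $x,y\ge 0$, $\psi_x^{(y)}=\sigma\left[B(rx+1,-\sigma)-B(r(x+y)+1,-\sigma)\right]$. The prior $\mathrm{SBSP}(\beta,\sigma,c)$ (stable-beta scaled process). Let $\rho(s)=\sigma s^{-1-\sigma}\mathbf 1(s>0)$ and let $\Delta_0>\Delta_1>\cdots$ be the points, in decreasing order, of a Poisson point process on $\mathbb R_+$ with intensity $\rho(s)\,ds$. The density of $\Delta_0$ is $f_{\Delta_0}(s)=\sigma s^{-1-\sigma}e^{-s^{-\sigma}}\mathbf 1(s>0)$. Let $G_t$ be the conditional joint law of $(\Delta_n/\Delta_0)_{n\ge1}$ given $\Delta_0=t$. Let $h_{c,\beta}(s)=\frac{\beta^{c+1}}{\Gamma(c+1)}s^{-c\sigma}\exp\{-(\beta-1)s^{-\sigma}\}$. Let $\Delta_{0,h}$ have density $h_{c,\beta}(s)f_{\Delta_0}(s)$ and, given $\Delta_{0,h}=t$, let $(\theta_n)_{n\ge1}\sim G_t$. Let $\omega_1,\omega_2,\dots$ be i.i.d. from the uniform distribution $P_0$ on $\Omega=[0,1]$, independent of $(\Delta_{0,h},(\theta_n))$. Then $\Theta=\sum_{n\ge1}\theta_n\delta_{\omega_n}\sim\mathrm{SBSP}(\beta,\sigma,c)$.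 The likelihood. Given $\Theta=\sum_n\theta_n\delta_{\omega_n}$, $Z_d\sim\mathrm{NBP}(\Theta,r)$ means $Z_d=\sum_{n\ge1}A_{d,n}\delta_{\omega_n}$ with $A_{d,n}\sim\mathrm{NegBin}(r,\theta_n)$ independently across $n$. A unit is observed in $Z_{1:D_0}$ if it has a positive count on at least one of the days $1,\dots,D_0$. *)

theory Defs
  imports "HOL-Probability.Probability"
begin

definition neg_bin :: "real \<Rightarrow> real \<Rightarrow> nat \<Rightarrow> real" where
  "neg_bin a p x = ((real x + a - 1) gchoose x) * p ^ x * (1 - p) powr a"

definition psi :: "real \<Rightarrow> real \<Rightarrow> real \<Rightarrow> real \<Rightarrow> real" where
  "psi \<sigma> r x y = \<sigma> * (Beta (r * x + 1) (- \<sigma>) - Beta (r * (x + y) + 1) (- \<sigma>))"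

abbreviation seq_space :: "(nat \<Rightarrow> real) measure" where
  "seq_space \<equiv> PiM UNIV (\<lambda>_. borel)"

text \<open>
  The kernel \<open>K\<close> is a regular conditional law of \<open>Y\<close> given \<open>X\<close>.
\<close>
definition cond_law ::
  "'a measure \<Rightarrow> 'b measure \<Rightarrow> ('a \<Rightarrow> 'b) \<Rightarrow> 'c measure \<Rightarrow> ('a \<Rightarrow> 'c) \<Rightarrow> ('b \<Rightarrow> 'c measure) \<Rightarrow> bool"
where
  "cond_law M S X T Y K \<longleftrightarrow>
     X \<in> M \<rightarrow>\<^sub>M S \<and> Y \<in> M \<rightarrow>\<^sub>M T \<and> K \<in> S \<rightarrow>\<^sub>M prob_algebra T \<and>
     (\<forall>A\<in>sets S. \<forall>B\<in>sets T.
        emeasure M {w \<in> space M. X w \<in> A \<and> Y w \<in> B} =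
        (\<integral>\<^sup>+t\<in>A. emeasure (K t) B \<partial>distr M S X))"

definition stable_intensity :: "real \<Rightarrow> real measure" where
  "stable_intensity \<sigma> =
     density lborel (\<lambda>s. ennreal (if s > 0 then \<sigma> * s powr (- 1 - \<sigma>) else 0))"

definition point_count :: "(nat \<Rightarrow> 'a \<Rightarrow> real) \<Rightarrow> real set \<Rightarrow> 'a \<Rightarrow> ennreal" where
  "point_count X B w = (\<Sum>n. indicator B (X n w))"

text \<open>
  \<open>X 0 > X 1 > \<dots>\<close> are the points, in decreasing order, of a Poisson point process
  with intensity measure \<open>\<mu>\<close>.
\<close>
definition ordered_poisson_points ::
  "real measure \<Rightarrow> 'a measure \<Rightarrow> (nat \<Rightarrow> 'a \<Rightarrow> real) \<Rightarrow> bool"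
where
  "ordered_poisson_points \<mu> M X \<longleftrightarrow>
     (\<forall>n. X n \<in> borel_measurable M) \<and>
     (AE w in M. \<forall>n. X (Suc n) w < X n w) \<and>
     (\<forall>B\<in>sets borel. emeasure \<mu> B < \<infinity> \<longrightarrow>
        (\<forall>k. measure M {w \<in> space M. point_count X B w = of_nat k} =
             measure \<mu> B ^ k / fact k * exp (- measure \<mu> B))) \<and>
     (\<forall>B\<in>sets borel. emeasure \<mu> B = \<infinity> \<longrightarrow> (AE w in M. point_count X B w = \<infinity>)) \<and>
     (\<forall>m (B :: nat \<Rightarrow> real set). (\<forall>i<m. B i \<in> sets borel) \<and> disjoint_family_on B {..<m} \<longrightarrow>
        prob_space.indep_vars M (\<lambda>_. borel) (\<lambda>i. point_count X (B i)) {..<m})"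

definition max_density :: "real \<Rightarrow> real \<Rightarrow> real" where
  "max_density \<sigma> s = (if s > 0 then \<sigma> * s powr (- 1 - \<sigma>) * exp (- (s powr (- \<sigma>))) else 0)"

definition tilt :: "real \<Rightarrow> real \<Rightarrow> real \<Rightarrow> real \<Rightarrow> real" where
  "tilt \<beta> \<sigma> c s =
     \<beta> powr (c + 1) / Gamma (c + 1) * s powr (- c * \<sigma>) * exp (- (\<beta> - 1) * s powr (- \<sigma>))"

text \<open>
  \<open>G t\<close> is the conditional joint law of the ratios \<open>\<Delta>\<^sub>n / \<Delta>\<^sub>0\<close>, \<open>n \<ge> 1\<close>, given \<open>\<Delta>\<^sub>0 = t\<close>.
  Sequences indexed by \<open>n \<ge> 1\<close> are shifted here and below: entry \<open>n\<close> is the one of index \<open>n + 1\<close>.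
  The kernel is determined up to a Lebesgue-null set of \<open>t > 0\<close>.
\<close>
definition ratio_law :: "'a measure \<Rightarrow> (nat \<Rightarrow> 'a \<Rightarrow> real) \<Rightarrow> (real \<Rightarrow> (nat \<Rightarrow> real) measure) \<Rightarrow> bool"
where
  "ratio_law P \<Delta> G \<longleftrightarrow>
     cond_law P borel (\<Delta> 0) seq_space (\<lambda>w n. \<Delta> (Suc n) w / \<Delta> 0 w) G"

text \<open>
  The sequences of weights \<open>\<theta>\<close> and atoms \<open>\<omega>\<close> of a stable-beta scaled process
  \<open>\<Theta> = (\<Sum>n. \<theta>\<^sub>n \<delta>(\<omega>\<^sub>n))\<close>; \<open>T\<close> is the tilted largest point (written \<open>\<Delta>\<^sub>0\<^sub>,\<^sub>h\<close>).
\<close>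
definition SBSP ::
  "real \<Rightarrow> real \<Rightarrow> real \<Rightarrow> (real \<Rightarrow> (nat \<Rightarrow> real) measure) \<Rightarrow> 'a measure \<Rightarrow>
   ('a \<Rightarrow> real) \<Rightarrow> (nat \<Rightarrow> 'a \<Rightarrow> real) \<Rightarrow> (nat \<Rightarrow> 'a \<Rightarrow> real) \<Rightarrow> bool"
where
  "SBSP \<beta> \<sigma> c G M T \<theta> \<omega> \<longleftrightarrow>
     distributed M lborel T (\<lambda>s. ennreal (tilt \<beta> \<sigma> c s * max_density \<sigma> s)) \<and>
     cond_law M borel T seq_space (\<lambda>w n. \<theta> n w) G \<and>
     prob_space.indep_vars M (\<lambda>_. borel) \<omega> UNIV \<and>
     (\<forall>n. distr M borel (\<omega> n) = uniform_measure lborel {0..1}) \<and>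
     prob_space.indep_set M
       (sets (vimage_algebra (space M) (\<lambda>w n. \<omega> n w) seq_space))
       (sets (vimage_algebra (space M) (\<lambda>w. (T w, \<lambda>n. \<theta> n w)) (borel \<Otimes>\<^sub>M seq_space)))"

text \<open>
  \<open>A d n\<close> is the count of unit \<open>n\<close> on day \<open>d\<close> (days are numbered from \<open>0\<close>). Given the weights
  and atoms of \<open>\<Theta>\<close>, all counts are independent over both \<open>d\<close> and \<open>n\<close>, that of \<open>A d n\<close> having mass
  function \<open>neg_bin r (\<theta> n)\<close>. As countably many discrete variables, they are described by their
  finite-dimensional conditional probabilities.
\<close>
definition NBP_counts ::
  "'a measure \<Rightarrow> real \<Rightarrow> (nat \<Rightarrow> 'a \<Rightarrow> real) \<Rightarrow> (nat \<Rightarrow> 'a \<Rightarrow> real) \<Rightarrow> (nat \<Rightarrow> nat \<Rightarrow> 'a \<Rightarrow> nat) \<Rightarrow> bool"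
where
  "NBP_counts M r \<theta> \<omega> A \<longleftrightarrow>
     (\<forall>d n. A d n \<in> M \<rightarrow>\<^sub>M count_space UNIV) \<and>
     (\<forall>F x. finite F \<longrightarrow>
        (AE w in M.
           real_cond_exp M
             (vimage_algebra (space M) (\<lambda>w. (\<lambda>n. \<theta> n w, \<lambda>n. \<omega> n w)) (seq_space \<Otimes>\<^sub>M seq_space))
             (indicator {w \<in> space M. \<forall>(d, n)\<in>F. A d n w = x d n}) w =
           (\<Prod>(d, n)\<in>F. neg_bin r (\<theta> n w) (x d n))))"

text \<open>
  The measure \<open>\<Sum>n. a n \<cdot> \<delta>(x n)\<close> on the Borel sets.
\<close>
definition atomic_measure :: "(nat \<Rightarrow> nat) \<Rightarrow> (nat \<Rightarrow> real) \<Rightarrow> real measure" where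
  "atomic_measure a x = distr (density (count_space UNIV) (\<lambda>n. of_nat (a n))) borel x"

lemma emeasure_atomic_measure:
  assumes "B \<in> sets borel"
  shows "emeasure (atomic_measure a x) B = (\<Sum>n. of_nat (a n) * indicator B (x n))"
proof -
  have "emeasure (atomic_measure a x) B =
      (\<integral>\<^sup>+n. of_nat (a n) * indicator (x -` B) n \<partial>count_space UNIV)"
    using assms unfolding atomic_measure_def by (subst emeasure_distr) (auto simp: emeasure_density)
  also have "\<dots> = (\<Sum>n. of_nat (a n) * indicator (x -` B) n)"
    by (rule nn_integral_count_space_nat)
  finally show ?thesis by (simp add: indicator_def vimage_def)
qed

definition Z_process ::
  "(nat \<Rightarrow> 'a \<Rightarrow> real) \<Rightarrow> (nat \<Rightarrow> nat \<Rightarrow> 'a \<Rightarrow> nat) \<Rightarrow> nat \<Rightarrow> 'a \<Rightarrow> real measure"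
where
  "Z_process \<omega> A d w = atomic_measure (\<lambda>n. A d n w) (\<lambda>n. \<omega> n w)"

text \<open>
  The sigma-algebra generated by the first \<open>D\<close> random measures, that is, by all the variables
  \<open>Z d B\<close> with \<open>d < D\<close> and \<open>B\<close> Borel.
\<close>
definition data_algebra :: "'a measure \<Rightarrow> (nat \<Rightarrow> 'a \<Rightarrow> real measure) \<Rightarrow> nat \<Rightarrow> 'a measure" where
  "data_algebra M Z D = sigma (space M)
     {(\<lambda>w. emeasure (Z d w) B) -` S \<inter> space M | d B S.
        d < D \<and> B \<in> sets borel \<and> S \<in> sets borel}"

definition observed_units :: "(nat \<Rightarrow> 'a \<Rightarrow> real measure) \<Rightarrow> nat \<Rightarrow> 'a \<Rightarrow> real set" where
  "observed_units Z D w = {x. \<exists>d<D. emeasure (Z d w) {x} > 0}"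

definition new_units :: "(nat \<Rightarrow> nat \<Rightarrow> 'a \<Rightarrow> nat) \<Rightarrow> nat \<Rightarrow> nat \<Rightarrow> 'a \<Rightarrow> ennreal" where
  "new_units A D0 D1 w =
     (\<Sum>n. of_bool ((\<Sum>d<D0. A d n w) = 0) * of_bool ((\<Sum>d<D1. A (D0 + d) n w) > 0))"

end

theory Submission
  imports Defs
begin

text \<open>
  Given the largest point \<open>t\<close>, the weights are the points of a Poisson process on the unit interval
  with intensity \<open>l \<sigma> s\<^sup>-\<^sup>1\<^sup>-\<^sup>\<sigma> ds\<close>, where \<open>l = t\<^sup>-\<^sup>\<sigma>\<close> has a gamma law with parameters \<open>c + 1\<close> and \<open>\<beta>\<close>
  under the tilted density. So the expected product over the units of a factor, equal to
  \<open>u\<close> for a new unit and to \<open>0\<close> for an observed unit in a prescribed region, is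
  \<open>(\<beta> / (\<beta> + C)) powr (c + 1)\<close> with \<open>C\<close> linear in these factors. The same value, up to the factor
  \<open>q powr (c + 1)\<close>, arises from weighting every observed unit by
  \<open>q = (1 - p) / (1 - p u)\<close> instead. The events that a region contains no observed unit are closed
  under intersection and generate the data, hence the conditional generating function of the number of
  new units is \<open>q powr (N + c + 1)\<close>, which is that of the negative binomial law.
\<close>

text \<open>Conditioning on the largest point means conditioning on null events, and the kernel
  \<open>G\<close> is fixed only up to null sets. So the conditional Poisson property is never
  stated for a single \<open>t\<close>; it is proved in integrated form, against an arbitrary
  function of the maximum with finite integral (\<open>laplace_ratios\<close>). Of the tilt, only
  the Laplace transform of \<open>l\<close> is used after that.

  The labels \<open>n\<close> are not part of the data: since the weights are in decreasing order,
  labels would be informative. Hence one cannot condition on the counts unit by unit, and void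
  events, as in Renyi's theorem on point processes, take their place. A single \<open>q\<close>
  serves all regions because a region enters \<open>C\<close> through one constant, which appears
  unchanged on the side of the new units and multiplied by \<open>q\<close> on the other side. The
  two values of \<beta> + C can then differ by exactly the factor \<open>q\<close>, whatever that
  constant is.\<close>

section \<open>Infinite products of factors in the unit interval\<close>

text \<open>A plain limit of partial products, not a convergent infinite product in the strict
  sense: a factor \<open>u < 1\<close> repeated infinitely often has to give the value 0.\<close>

definition iprod :: "(nat \<Rightarrow> real) \<Rightarrow> real" where
  "iprod y = lim (\<lambda>m. \<Prod>n<m. y n)"

lemma prod_unit_interval:
  fixes y :: "'i \<Rightarrow> real"
  assumes "\<And>n. n \<in> I \<Longrightarrow> 0 \<le> y n \<and> y n \<le> 1"
  shows "0 \<le> (\<Prod>n\<in>I. y n)" "(\<Prod>n\<in>I. y n) \<le> 1"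
  using assms by (auto intro!: prod_nonneg prod_le_1)

lemma
  assumes "\<And>n. 0 \<le> y n \<and> y n \<le> 1"
  shows iprod_LIMSEQ: "(\<lambda>m. \<Prod>n<m. y n) \<longlonglongrightarrow> iprod y"
    and iprod_le_prod: "iprod y \<le> (\<Prod>n<m. y n)"
    and iprod_nonneg: "0 \<le> iprod y"
    and iprod_le_1: "iprod y \<le> 1"
proof -
  have dec: "decseq (\<lambda>m. \<Prod>n<m. y n)"
    using assms by (intro decseq_SucI) (simp add: mult_left_le prod_unit_interval)
  have "convergent (\<lambda>m. \<Prod>n<m. y n)"
    using dec prod_unit_interval[of _ y] assms
    by (intro Bseq_monoseq_convergent BseqI'[where K=1]) (auto simp: decseq_imp_monoseq)
  then show lim: "(\<lambda>m. \<Prod>n<m. y n) \<longlonglongrightarrow> iprod y"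
    by (simp add: convergent_LIMSEQ_iff iprod_def)
  show "iprod y \<le> (\<Prod>n<m. y n)" for m
    using decseq_ge[OF dec lim] .
  from this[of 0] show "iprod y \<le> 1" by simp
  show "0 \<le> iprod y"
    using lim by (rule LIMSEQ_le_const) (simp add: assms prod_unit_interval)
qed

lemma abs_iprod_le_1:
  assumes "\<And>n. 0 \<le> y n \<and> y n \<le> 1"
  shows "\<bar>iprod y\<bar> \<le> 1"
  using iprod_nonneg[of y, OF assms] iprod_le_1[of y, OF assms] by simp

lemma iprod_eq_prod:
  assumes "\<And>n. n \<ge> m \<Longrightarrow> y n = 1"
  shows "iprod y = (\<Prod>n<m. y n)"
proof -
  have "(\<Prod>n<k. y n) = (\<Prod>n<m. y n)" if "k \<ge> m" for k
    using that assms by (intro prod.mono_neutral_right) auto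
  then have "(\<lambda>k. \<Prod>n<k. y n) \<longlonglongrightarrow> (\<Prod>n<m. y n)"
    by (intro tendsto_eventually eventually_sequentiallyI[of m])
  then show ?thesis by (simp add: iprod_def limI)
qed

lemma iprod_shift:
  assumes "y 0 = 1"
  shows "iprod y = iprod (\<lambda>n. y (Suc n))"
proof -
  have "(\<lambda>m. \<Prod>n<m. y (Suc n)) = (\<lambda>m. \<Prod>n<Suc m. y n)"
    by (subst prod.lessThan_Suc_shift) (simp add: assms)
  then show ?thesis
    unfolding iprod_def lim_def by (subst filterlim_sequentially_Suc[of "\<lambda>m. \<Prod>n<m. y n", symmetric]) simp
qed

lemma iprod_mult:
  assumes "\<And>n. 0 \<le> y n \<and> y n \<le> 1" "\<And>n. 0 \<le> z n \<and> z n \<le> 1"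
  shows "iprod (\<lambda>n. y n * z n) = iprod y * iprod z"
  unfolding iprod_def[of "\<lambda>n. y n * z n"] prod.distrib
  by (intro limI tendsto_mult iprod_LIMSEQ assms)

lemma iprod_prod:
  assumes "finite J" "\<And>j n. j \<in> J \<Longrightarrow> 0 \<le> y j n \<and> y j n \<le> 1"
  shows "iprod (\<lambda>n. \<Prod>j\<in>J. y j n) = (\<Prod>j\<in>J. iprod (y j))"
  using assms
proof (induction rule: finite_induct)
  case empty
  then show ?case by (simp add: iprod_eq_prod[where m=0])
next
  case (insert j J)
  then show ?case
    by (simp add: iprod_mult prod_unit_interval)
qed

lemma prod_of_bool_power:
  fixes u :: "'a :: comm_semiring_1"
  assumes "finite I"
  shows "(\<Prod>n\<in>I. if Q n then u else 1) = u ^ card {n \<in> I. Q n}"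
proof -
  have "(\<Prod>n\<in>I. if Q n then u else 1) = (\<Prod>n\<in>{n \<in> I. Q n}. u)"
    using assms by (intro prod.mono_neutral_cong_right) auto
  then show ?thesis by simp
qed

lemma iprod_power:
  assumes "0 \<le> u" "u < 1"
  shows "iprod (\<lambda>n. if Q n then u else 1) = (if finite {n. Q n} then u ^ card {n. Q n} else 0)"
proof (cases "finite {n. Q n}")
  case True
  then obtain m where m: "\<And>n. Q n \<Longrightarrow> n < m"
    using finite_nat_set_iff_bounded by auto
  have "iprod (\<lambda>n. if Q n then u else 1) = (\<Prod>n<m. if Q n then u else 1)"
    using m by (intro iprod_eq_prod) (auto simp: not_le[symmetric])
  also have "\<dots> = u ^ card {n. Q n}"
    using m by (subst prod_of_bool_power) (auto intro!: arg_cong[where f="\<lambda>S. u ^ card S"])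
  finally show ?thesis using True by simp
next
  case False
  have lim: "(\<lambda>j. u ^ j) \<longlonglongrightarrow> 0"
    using assms by (intro LIMSEQ_realpow_zero)
  have "iprod (\<lambda>n. if Q n then u else 1) \<le> u ^ j" for j
  proof -
    obtain T where T: "T \<subseteq> {n. Q n}" "finite T" "card T = j"
      using infinite_arbitrarily_large[OF False] by blast
    obtain m where m: "T \<subseteq> {..<m}"
      using T(2) finite_nat_iff_bounded by blast
    have "iprod (\<lambda>n. if Q n then u else 1) \<le> u ^ card {n \<in> {..<m}. Q n}"
      using iprod_le_prod[of "\<lambda>n. if Q n then u else 1" m] assms by (simp add: prod_of_bool_power)
    also have "\<dots> \<le> u ^ j"
      using assms T m by (intro power_decreasing) (auto intro!: card_mono)
    finally show ?thesis .
  qed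
  then have "iprod (\<lambda>n. if Q n then u else 1) \<le> 0"
    using lim by (intro LIMSEQ_le_const[OF lim]) auto
  moreover have "0 \<le> iprod (\<lambda>n. if Q n then u else 1)"
    using assms by (intro iprod_nonneg) auto
  ultimately show ?thesis using False by simp
qed

lemma iprod_of_bool:
  "iprod (\<lambda>n. of_bool (Q n)) = of_bool (\<forall>n. Q n)"
proof -
  have "iprod (\<lambda>n. of_bool (Q n)) = iprod (\<lambda>n. if \<not> Q n then 0 else 1)"
    by (intro arg_cong[where f=iprod]) auto
  \<comment> \<open>The case \<open>u = 0\<close> of \<open>iprod_power\<close>: as
    \<open>0 ^ 0 = 1\<close>, the power of 0 is 1 exactly if no index fails.\<close>
  also have "\<dots> = of_bool (\<forall>n. Q n)"
    by (subst iprod_power) (auto simp: card_eq_0_iff power_0_left)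
  finally show ?thesis .
qed

text \<open>Infinite products are not continuous under pointwise convergence of the factors, but
  they are under convergence from above. The lower bound is monotonicity. For the upper bound, an
  infinite product is at most each of its partial products, so a partial product of \<open>y\<close>
  below \<open>a\<close> forces \<open>iprod (z k)\<close> below \<open>a\<close> for large
  \<open>k\<close>.\<close>

lemma iprod_tendsto_below:
  assumes "\<And>n. 0 \<le> y n" "\<And>k n. y n \<le> z k n \<and> z k n \<le> 1" "\<And>n. (\<lambda>k. z k n) \<longlonglongrightarrow> y n"
  shows "(\<lambda>k. iprod (z k)) \<longlonglongrightarrow> iprod y"
proof (rule order_tendstoI)
  have z: "0 \<le> z k n \<and> z k n \<le> 1" for k n
    using assms(1)[of n] assms(2)[of n k] by auto
  have y: "0 \<le> y n \<and> y n \<le> 1" for n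
    using assms(1)[of n] assms(2)[of n 0] by auto
  fix a
  {
    assume a: "a < iprod y"
    have "iprod y \<le> iprod (z k)" for k
      using iprod_LIMSEQ[OF y] iprod_LIMSEQ[of "z k", OF z]
      by (rule LIMSEQ_le) (use assms in \<open>auto intro!: prod_mono\<close>)
    with a show "\<forall>\<^sub>F k in sequentially. a < iprod (z k)"
      by (intro always_eventually allI) (rule less_le_trans)
  next
    assume a: "iprod y < a"
    then have "\<forall>\<^sub>F m in sequentially. (\<Prod>n<m. y n) < a"
      by (rule order_tendstoD[OF iprod_LIMSEQ[OF y]])
    then obtain m where m: "(\<Prod>n<m. y n) < a"
      by (auto simp: eventually_sequentially)
    have "(\<lambda>k. \<Prod>n<m. z k n) \<longlonglongrightarrow> (\<Prod>n<m. y n)"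
      by (intro tendsto_prod assms)
    from order_tendstoD(2)[OF this m] show "\<forall>\<^sub>F k in sequentially. iprod (z k) < a"
      by eventually_elim (rule le_less_trans[OF iprod_le_prod], rule z)
  }
qed

lemma borel_measurable_iprod[measurable]:
  assumes [measurable]: "\<And>n. (\<lambda>w. y w n) \<in> borel_measurable M"
  shows "(\<lambda>w. iprod (y w)) \<in> borel_measurable M"
  unfolding iprod_def by measurable

section \<open>Poisson counts\<close>

lemma suminf_indicator_card:
  "(\<Sum>n. indicator S n :: ennreal) = (if finite S then of_nat (card S) else \<top>)"
proof -
  have "(\<Sum>n. indicator S n :: ennreal) = emeasure (count_space UNIV) S"
    by (subst nn_integral_count_space_nat[symmetric]) simp
  then show ?thesis by (simp add: emeasure_count_space)
qed

lemma point_count_eq_card: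
  "point_count X B w = (if finite {n. X n w \<in> B} then of_nat (card {n. X n w \<in> B}) else \<top>)"
  unfolding point_count_def suminf_indicator_card[symmetric]
  by (intro suminf_cong) (simp add: indicator_def)

text \<open>A power whose exponent is a possibly infinite count. The value 0 at \<top> is the limit
  for \<open>0 \<le> z < 1\<close>; at \<open>z = 1\<close> the convention yields the indicator of a
  finite count.\<close>

definition ennreal_power :: "real \<Rightarrow> ennreal \<Rightarrow> real" where
  "ennreal_power z x = (if x = \<top> then 0 else z ^ nat \<lfloor>enn2real x\<rfloor>)"

lemma ennreal_power_of_nat[simp]: "ennreal_power z (of_nat k) = z ^ k"
  by (simp add: ennreal_power_def ennreal_of_nat_eq_real_of_nat)

lemma ennreal_power_top[simp]: "ennreal_power z \<top> = 0"
  by (simp add: ennreal_power_def)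

lemma borel_measurable_ennreal_power[measurable]: "ennreal_power z \<in> borel_measurable borel"
  unfolding ennreal_power_def[abs_def] by measurable

lemma iprod_point_count:
  assumes "0 \<le> z" "z < 1"
  shows "iprod (\<lambda>n. if X n w \<in> B then z else 1) = ennreal_power z (point_count X B w)"
  using assms by (simp add: iprod_power point_count_eq_card)

lemma (in prob_space) expectation_sums:
  fixes X :: "nat \<Rightarrow> 'a \<Rightarrow> real"
  assumes [measurable]: "\<And>k. X k \<in> borel_measurable M" "Y \<in> borel_measurable M"
    and sums: "AE w in M. (\<forall>k. 0 \<le> X k w) \<and> (\<lambda>k. X k w) sums Y w \<and> Y w \<le> 1"
  shows "(\<lambda>k. expectation (X k)) sums expectation Y"
proof -
  have partial: "AE w in M. \<forall>n. 0 \<le> (\<Sum>k<n. X k w) \<and> (\<Sum>k<n. X k w) \<le> 1"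
    using sums
  proof eventually_elim
    case (elim w)
    have "(\<Sum>k<n. X k w) \<le> (\<Sum>k. X k w)" for n
      using elim by (intro sum_le_suminf) (auto simp: sums_iff)
    then show ?case using elim by (auto simp: sums_iff intro!: sum_nonneg intro: order_trans)
  qed
  have "integrable M (X k)" for k
  proof (rule integrable_const_bound)
    show "AE w in M. norm (X k w) \<le> 1"
      using partial sums
    proof eventually_elim
      case (elim w)
      have "X k w \<le> (\<Sum>j<Suc k. X j w)" using elim by (simp add: sum_nonneg)
      also have "\<dots> \<le> 1" using elim by blast
      finally show ?case using elim by simp
    qed
  qed simp
  then have "(\<Sum>k<n. expectation (X k)) = expectation (\<lambda>w. \<Sum>k<n. X k w)" for n
    by simp
  moreover have "(\<lambda>n. expectation (\<lambda>w. \<Sum>k<n. X k w)) \<longlonglongrightarrow> expectation Y"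
  proof (rule integral_dominated_convergence[where w="\<lambda>_. 1"])
    show "AE w in M. (\<lambda>n. \<Sum>k<n. X k w) \<longlonglongrightarrow> Y w"
      using sums by eventually_elim (simp add: sums_def)
    show "AE w in M. norm (\<Sum>k<n. X k w) \<le> 1" for n
      using partial by eventually_elim simp
  qed auto
  ultimately show ?thesis by (simp add: sums_def)
qed

lemma ennreal_power_sums:
  assumes "y = \<top> \<or> (\<exists>j. y = of_nat j)"
  shows "(\<lambda>k. of_bool (y = of_nat k) * z ^ k) sums ennreal_power z y"
proof (cases "y = \<top>")
  case False
  with assms obtain j where "y = of_nat j" by auto
  moreover have "(\<lambda>k. of_bool (j = k) * z ^ k) = (\<lambda>k. if k = j then z ^ k else 0)" by auto
  ultimately show ?thesis using sums_single[of j "\<lambda>k. z ^ k"] by simp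
qed simp

lemma ennreal_power_unit:
  assumes "0 \<le> z" "z \<le> 1"
  shows "0 \<le> ennreal_power z y" "ennreal_power z y \<le> 1"
  using assms by (auto simp: ennreal_power_def power_le_one)

lemma (in prob_space) expectation_of_bool:
  assumes "Measurable.pred M Q"
  shows "expectation (\<lambda>w. of_bool (Q w)) = prob {w \<in> space M. Q w}"
  using assms by (subst Bochner_Integration.integral_cong[OF refl, where g="indicator {w \<in> space M. Q w}"])
    (auto simp: indicator_def)

lemma (in prob_space) expectation_ennreal_power_poisson:
  assumes [measurable]: "Y \<in> borel_measurable M"
    and Y: "\<And>k. prob {w \<in> space M. Y w = of_nat k} = l ^ k / fact k * exp (- l)"
    and z: "0 \<le> z" "z \<le> 1" and cases: "\<And>w. Y w = \<top> \<or> (\<exists>j. Y w = of_nat j)"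
  shows "expectation (\<lambda>w. ennreal_power z (Y w)) = exp (- l * (1 - z))"
proof -
  have "(\<lambda>k. expectation (\<lambda>w. of_bool (Y w = of_nat k) * z ^ k)) sums expectation (\<lambda>w. ennreal_power z (Y w))"
    using ennreal_power_sums[OF cases] ennreal_power_unit[OF z] z by (intro expectation_sums AE_I2) auto
  moreover have "expectation (\<lambda>w. of_bool (Y w = of_nat k) * z ^ k) = exp (- l) * ((l * z) ^ k /\<^sub>R fact k)" for k
  proof -
    have "expectation (\<lambda>w. of_bool (Y w = of_nat k)) = prob {w \<in> space M. Y w = of_nat k}"
      by (rule expectation_of_bool) measurable
    then show ?thesis
      by (simp add: Y power_mult_distrib divide_simps scaleR_conv_of_real)
  qed
  moreover have "(\<lambda>k. exp (- l) * ((l * z) ^ k /\<^sub>R fact k)) sums (exp (- l) * exp (l * z))"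
    by (intro sums_mult exp_converges)
  moreover have "exp (- l) * exp (l * z) = exp (- l * (1 - z))"
    by (simp add: exp_add[symmetric] algebra_simps)
  ultimately show ?thesis by (simp add: sums_iff)
qed

section \<open>The stable Poisson process and its ratios\<close>

text \<open>Reads an expectation over an event as the value of a finite measure with density
  \<open>f\<close>, so that uniqueness theorems for measures apply to identities between
  expectations.\<close>

lemma (in prob_space) emeasure_density_unit:
  fixes f :: "'a \<Rightarrow> real"
  assumes [measurable]: "f \<in> borel_measurable M" "B \<in> sets M" and f: "\<And>w. 0 \<le> f w" "\<And>w. f w \<le> 1"
  shows "emeasure (density M (\<lambda>w. ennreal (f w))) B = ennreal (expectation (\<lambda>w. indicator B w * f w))"
proof -
  have "emeasure (density M (\<lambda>w. ennreal (f w))) B = (\<integral>\<^sup>+w. ennreal (indicator B w * f w) \<partial>M)"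
    by (subst emeasure_density) (auto intro!: nn_integral_cong simp: indicator_def)
  also have "\<dots> = ennreal (expectation (\<lambda>w. indicator B w * f w))"
    using f by (intro nn_integral_eq_integral integrable_const_bound[where B=1]) (auto simp: indicator_def)
  finally show ?thesis .
qed

lemma borel_measurable_max_density[measurable]: "max_density \<sigma> \<in> borel_measurable borel"
  unfolding max_density_def[abs_def] by measurable

lemma borel_measurable_on_unit_interval:
  fixes \<phi> :: "real \<Rightarrow> real"
  assumes "continuous_on {0<..<1} \<phi>"
  shows "(\<lambda>s. indicator {0<..<1} s * \<phi> s) \<in> borel_measurable borel"
  using borel_measurable_continuous_on_restrict[OF assms]
    borel_measurable_restrict_space_iff[of "{0<..<1}" borel \<phi>] by (simp add: mult.commute)

lemma sets_stable_intensity[measurable_cong]: "sets (stable_intensity \<sigma>) = sets borel"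
  by (simp add: stable_intensity_def)

lemma space_stable_intensity[simp]: "space (stable_intensity \<sigma>) = UNIV"
  by (simp add: stable_intensity_def)

lemma nn_integral_stable_intensity:
  assumes "f \<in> borel_measurable borel"
  shows "(\<integral>\<^sup>+s. f s \<partial>stable_intensity \<sigma>) =
    (\<integral>\<^sup>+s. ennreal (if s > 0 then \<sigma> * s powr (- 1 - \<sigma>) else 0) * f s \<partial>lborel)"
  unfolding stable_intensity_def using assms by (subst nn_integral_density) auto

lemma stable_intensity_greaterThan:
  assumes "0 < \<sigma>" "0 < a"
  shows "emeasure (stable_intensity \<sigma>) {a<..} = ennreal (a powr - \<sigma>)"
proof -
  have "emeasure (stable_intensity \<sigma>) {a<..} =
    (\<integral>\<^sup>+s. ennreal (if s > 0 then \<sigma> * s powr (- 1 - \<sigma>) else 0) * indicator {a<..} s \<partial>lborel)"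
    unfolding stable_intensity_def by (subst emeasure_density) auto
  also have "\<dots> = (\<integral>\<^sup>+s. ennreal (\<sigma> * s powr (- 1 - \<sigma>)) * indicator {a..} s \<partial>lborel)"
    using AE_lborel_singleton[of a] assms
    by (intro nn_integral_cong_AE) (auto elim!: eventually_mono simp: indicator_def)
  also have "\<dots> = ennreal (0 - (- (a powr - \<sigma>)))"
  proof (rule nn_integral_FTC_atLeast)
    show "((\<lambda>s. - (s powr - \<sigma>)) has_real_derivative \<sigma> * x powr (- 1 - \<sigma>)) (at x)" if "a \<le> x" for x
      using that assms by (auto intro!: derivative_eq_intros simp: algebra_simps minus_diff_commute)
    have "((\<lambda>s. - (s powr - \<sigma>)) \<longlongrightarrow> - 0) at_top"
      using assms by (intro tendsto_minus tendsto_neg_powr filterlim_ident) auto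
    then show "((\<lambda>s. - (s powr - \<sigma>)) \<longlongrightarrow> 0) at_top" by simp
  qed (use assms in auto)
  finally show ?thesis by simp
qed

lemma stable_intensity_nonpos: "emeasure (stable_intensity \<sigma>) {..0} = 0"
  unfolding stable_intensity_def
  by (subst emeasure_density) (auto simp: indicator_def intro!: nn_integral_zero' AE_I2)

text \<open>Self-similarity: dilation by \<open>b\<close> multiplies the stable intensity by
  \<open>b powr - \<sigma>\<close>. This is the origin of the factor
  \<open>\<Delta> 0 w powr - \<sigma>\<close> in the law of the ratios.\<close>

lemma nn_integral_stable_intensity_scale:
  assumes [measurable]: "f \<in> borel_measurable borel" and b: "0 < b"
  shows "(\<integral>\<^sup>+s. f (s / b) \<partial>stable_intensity \<sigma>) = ennreal (b powr - \<sigma>) * (\<integral>\<^sup>+s. f s \<partial>stable_intensity \<sigma>)"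
proof -
  let ?r = "\<lambda>s. if s > 0 then \<sigma> * s powr (- 1 - \<sigma>) else 0"
  have "(\<integral>\<^sup>+s. f (s / b) \<partial>stable_intensity \<sigma>) = (\<integral>\<^sup>+s. ennreal (?r s) * f (s / b) \<partial>lborel)"
    by (simp add: nn_integral_stable_intensity)
  also have "\<dots> = b * (\<integral>\<^sup>+s. ennreal (?r (0 + b * s)) * f ((0 + b * s) / b) \<partial>lborel)"
    using b by (subst nn_integral_real_affine[where c=b and t=0]) auto
  also have "\<dots> = (\<integral>\<^sup>+s. ennreal (b * ?r (b * s)) * f s \<partial>lborel)"
    using b by (subst nn_integral_cmult[symmetric])
      (auto intro!: nn_integral_cong simp: ennreal_mult' mult.assoc)
  also have "\<dots> = (\<integral>\<^sup>+s. ennreal (b powr - \<sigma>) * (ennreal (?r s) * f s) \<partial>lborel)"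
  proof (intro nn_integral_cong)
    fix s :: real
    have "b * ?r (b * s) = b powr - \<sigma> * ?r s"
      using b by (auto simp: powr_mult powr_diff powr_minus zero_less_mult_iff divide_simps)
    then show "ennreal (b * ?r (b * s)) * f s = ennreal (b powr - \<sigma>) * (ennreal (?r s) * f s)"
      by (simp only: ennreal_mult' powr_ge_zero mult.assoc)
  qed
  finally show ?thesis
    by (simp add: nn_integral_cmult nn_integral_stable_intensity)
qed

lemma integral_stable_intensity_scale:
  assumes [measurable]: "f \<in> borel_measurable borel" and b: "0 < b" and f: "\<And>s. 0 \<le> f s"
    and int: "integrable (stable_intensity \<sigma>) f"
  shows "integrable (stable_intensity \<sigma>) (\<lambda>s. f (s / b))"
    and "(\<integral>s. f (s / b) \<partial>stable_intensity \<sigma>) = b powr - \<sigma> * (\<integral>s. f s \<partial>stable_intensity \<sigma>)"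
proof -
  have eq: "(\<integral>\<^sup>+s. ennreal (f (s / b)) \<partial>stable_intensity \<sigma>) =
      ennreal (b powr - \<sigma> * (\<integral>s. f s \<partial>stable_intensity \<sigma>))"
    using nn_integral_stable_intensity_scale[of "\<lambda>s. ennreal (f s)" b] b int f
    by (simp add: nn_integral_eq_integral ennreal_mult')
  show "integrable (stable_intensity \<sigma>) (\<lambda>s. f (s / b))"
    using f by (intro integrableI_nonneg) (auto simp: eq)
  then show "(\<integral>s. f (s / b) \<partial>stable_intensity \<sigma>) = b powr - \<sigma> * (\<integral>s. f s \<partial>stable_intensity \<sigma>)"
    using f by (subst integral_eq_nn_integral) (auto simp: eq integral_nonneg_AE)
qed

section \<open>Generating functional of the stable Poisson process\<close>

locale stable_points = prob_space P
  for P :: "'b measure" and \<Delta> :: "nat \<Rightarrow> 'b \<Rightarrow> real" and \<sigma> :: real +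
  assumes sigma: "0 < \<sigma>" "\<sigma> < 1"
    and points: "ordered_poisson_points (stable_intensity \<sigma>) P \<Delta>"
begin

abbreviation "\<mu> \<equiv> stable_intensity \<sigma>"
abbreviation "ratio n w \<equiv> \<Delta> (Suc n) w / \<Delta> 0 w"

lemma measurable_point[measurable]: "\<Delta> n \<in> borel_measurable P"
  using points by (auto simp: ordered_poisson_points_def)

lemma measurable_point_count[measurable]:
  assumes [measurable]: "B \<in> sets borel"
  shows "point_count \<Delta> B \<in> borel_measurable P"
  unfolding point_count_def[abs_def] by measurable

lemma pgf_point_count:
  assumes "B \<in> sets borel" "emeasure \<mu> B < \<infinity>" "0 \<le> z" "z \<le> 1"
  shows "expectation (\<lambda>w. ennreal_power z (point_count \<Delta> B w)) = exp (- measure \<mu> B * (1 - z))"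
  using points assms
  by (intro expectation_ennreal_power_poisson)
     (auto simp: ordered_poisson_points_def point_count_eq_card)

text \<open>Once \<phi> is rounded down to multiples of \<open>1 / k\<close>, the product over all
  points is a finite product of powers of the counts in disjoint sets, and these counts are
  independent Poisson variables.\<close>

lemma laplace_functional_step:
  assumes [measurable]: "\<phi> \<in> borel_measurable borel"
    and \<phi>: "\<And>s. 0 \<le> \<phi> s \<and> \<phi> s \<le> 1" "integrable \<mu> \<phi>"
  defines "step k s \<equiv> real_of_int \<lfloor>real k * \<phi> s\<rfloor> / real k"
  shows "expectation (\<lambda>w. iprod (\<lambda>n. 1 - step k (\<Delta> n w))) = exp (- (\<integral>s. step k s \<partial>\<mu>))"
proof (cases "k = 0")
  case True
  then show ?thesis
    by (simp add: step_def iprod_eq_prod[where m=0] prob_space)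
next
  case False
  then have k: "0 < real k" by simp
  \<comment> \<open>The index is shifted by one: on \<open>B j\<close> the rounded value is
    \<open>(j + 1) / k\<close>. The set where it is 0, in general of infinite measure, is left out;
    on each \<open>B j\<close> the function \<phi> is at least \<open>1 / k\<close>, so that
    \<open>B j\<close> has finite measure.\<close>
  define B where "B j = {s. \<lfloor>real k * \<phi> s\<rfloor> = int (Suc j)}" for j
  have [measurable]: "B j \<in> sets borel" for j
    unfolding B_def by measurable
  define z where "z j = 1 - real (Suc j) / real k" for j
  have z: "0 \<le> z j" "z j < 1" if "j < k" for j
    using that by (auto simp: z_def divide_simps)
  have finB: "emeasure \<mu> (B j) < \<infinity>" for j
  proof -
    have "1 / k \<le> \<phi> s" if "s \<in> B j" for s
    proof -
      have "1 \<le> \<lfloor>k * \<phi> s\<rfloor>" using that by (simp add: B_def)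
      then show ?thesis using k by (simp add: le_floor_iff field_simps)
    qed
    then have "(\<integral>\<^sup>+s. indicator (B j) s \<partial>\<mu>) \<le> (\<integral>\<^sup>+s. ennreal k * ennreal (\<phi> s) \<partial>\<mu>)"
      using k by (intro nn_integral_mono)
        (auto simp: indicator_def ennreal_mult'[symmetric] field_simps)
    then have "emeasure \<mu> (B j) \<le> (\<integral>\<^sup>+s. ennreal k * ennreal (\<phi> s) \<partial>\<mu>)"
      by (simp add: sets_stable_intensity)
    also have "\<dots> < \<infinity>"
      using \<phi> by (simp add: nn_integral_cmult nn_integral_eq_integral ennreal_mult_less_top)
    finally show ?thesis .
  qed
  have cell: "\<exists>j<k. s \<in> B j" if "\<lfloor>real k * \<phi> s\<rfloor> \<noteq> 0" for s
  proof -
    have "0 \<le> \<lfloor>k * \<phi> s\<rfloor>" using \<phi> k by simp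
    with that have 1: "0 < \<lfloor>k * \<phi> s\<rfloor>" by linarith
    have "real k * \<phi> s \<le> real k * 1" using \<phi> k by (intro mult_left_mono) auto
    then have 2: "\<lfloor>k * \<phi> s\<rfloor> \<le> int k" by (simp add: floor_le_iff)
    define j where "j = nat (\<lfloor>k * \<phi> s\<rfloor> - 1)"
    have "j < k" "\<lfloor>k * \<phi> s\<rfloor> = int (Suc j)" using 1 2 unfolding j_def by linarith+
    then show ?thesis unfolding B_def by blast
  qed
  have disj: "j = j'" if "s \<in> B j" "s \<in> B j'" for j j' s
    using that by (simp add: B_def)
  have factor: "1 - step k s = (\<Prod>j<k. if s \<in> B j then z j else 1)" for s
  proof (cases "\<lfloor>real k * \<phi> s\<rfloor> = 0")
    case True
    then show ?thesis by (simp add: step_def B_def)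
  next
    case False
    then obtain j where j: "j < k" "s \<in> B j" using cell by blast
    have "(\<Prod>j<k. if s \<in> B j then z j else 1) = (\<Prod>i\<in>{j}. if s \<in> B i then z i else 1)"
      using j disj by (intro prod.mono_neutral_right) auto
    then show ?thesis using j by (simp add: step_def B_def z_def)
  qed
  have summand: "step k s = (\<Sum>j<k. real (Suc j) / k * indicator (B j) s)" for s
  proof (cases "\<lfloor>real k * \<phi> s\<rfloor> = 0")
    case True
    then show ?thesis by (simp add: step_def B_def)
  next
    case False
    then obtain j where j: "j < k" "s \<in> B j" using cell by blast
    have "(\<Sum>j<k. real (Suc j) / k * indicator (B j) s) = (\<Sum>i\<in>{j}. real (Suc i) / k * indicator (B i) s)"
      using j disj by (intro sum.mono_neutral_right) (auto simp: indicator_def)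
    then show ?thesis using j by (simp add: step_def B_def)
  qed
  have "expectation (\<lambda>w. iprod (\<lambda>n. 1 - step k (\<Delta> n w))) =
      expectation (\<lambda>w. \<Prod>j<k. ennreal_power (z j) (point_count \<Delta> (B j) w))"
    unfolding factor by (subst iprod_prod) (use z in \<open>auto simp: iprod_point_count less_imp_le\<close>)
  also have "\<dots> = (\<Prod>j<k. expectation (\<lambda>w. ennreal_power (z j) (point_count \<Delta> (B j) w)))"
  proof (rule indep_vars_lebesgue_integral)
    have "disjoint_family_on B {..<k}" using disj by (auto simp: disjoint_family_on_def)
    then have "indep_vars (\<lambda>_. borel) (\<lambda>j. point_count \<Delta> (B j)) {..<k}"
      using points by (simp add: ordered_poisson_points_def)
    from indep_vars_compose2[OF this, of "\<lambda>j. ennreal_power (z j)" "\<lambda>_. borel"]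
    show "indep_vars (\<lambda>_. borel) (\<lambda>j w. ennreal_power (z j) (point_count \<Delta> (B j) w)) {..<k}"
      by simp
    show "integrable P (\<lambda>w. ennreal_power (z j) (point_count \<Delta> (B j) w))" if "j \<in> {..<k}" for j
      using that z[of j] by (intro integrable_const_bound[where B=1])
        (auto simp: ennreal_power_def power_le_one)
  qed auto
  also have "\<dots> = (\<Prod>j<k. exp (- measure \<mu> (B j) * (real (Suc j) / k)))"
    using z finB by (intro prod.cong refl) (subst pgf_point_count, auto simp: z_def)
  also have "\<dots> = exp (- (\<Sum>j<k. real (Suc j) / k * measure \<mu> (B j)))"
    by (simp add: exp_sum[symmetric] sum_negf mult.commute)
  also have "(\<Sum>j<k. real (Suc j) / k * measure \<mu> (B j)) = (\<integral>s. step k s \<partial>\<mu>)"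
    unfolding summand using finB
    by (subst Bochner_Integration.integral_sum) (auto simp: sets_stable_intensity)
  finally show ?thesis .
qed

text \<open>The step functions lie below \<phi>, so the factors \<open>1 - step\<close> approach
  \<open>1 - \<phi>\<close> from above, which is what \<open>iprod_tendsto_below\<close> asks for.
  The integrals converge with \<phi> itself as the dominating function.\<close>

lemma laplace_functional:
  assumes [measurable]: "\<phi> \<in> borel_measurable borel"
    and \<phi>: "\<And>s. 0 \<le> \<phi> s \<and> \<phi> s \<le> 1" "integrable \<mu> \<phi>"
  shows "expectation (\<lambda>w. iprod (\<lambda>n. 1 - \<phi> (\<Delta> n w))) = exp (- (\<integral>s. \<phi> s \<partial>\<mu>))"
proof -
  define step where "step k s = real_of_int \<lfloor>real k * \<phi> s\<rfloor> / real k" for k s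
  have [measurable]: "step k \<in> borel_measurable borel" for k
    unfolding step_def[abs_def] by measurable
  have step: "0 \<le> step k s" "step k s \<le> \<phi> s" for k s
    using \<phi>(1)[of s] by (cases "k = 0"; simp add: step_def divide_simps mult.commute of_int_floor_le)+
  have lim: "(\<lambda>k. step k s) \<longlonglongrightarrow> \<phi> s" for s
  proof (rule real_tendsto_sandwich)
    show "\<forall>\<^sub>F k in sequentially. \<phi> s - inverse (real k) \<le> step k s"
    proof (intro eventually_sequentiallyI[of 1])
      fix k :: nat assume "1 \<le> k"
      moreover have "(k * \<phi> s - 1) / k \<le> \<lfloor>k * \<phi> s\<rfloor> / k"
        by (intro divide_right_mono) linarith+
      ultimately show "\<phi> s - inverse (real k) \<le> step k s"
        by (simp add: step_def diff_divide_distrib inverse_eq_divide)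
    qed
    show "\<forall>\<^sub>F k in sequentially. step k s \<le> \<phi> s" using step by simp
    have "(\<lambda>k. \<phi> s - inverse (real k)) \<longlonglongrightarrow> \<phi> s - 0"
      by (intro tendsto_diff tendsto_const lim_inverse_n)
    then show "(\<lambda>k. \<phi> s - inverse (real k)) \<longlonglongrightarrow> \<phi> s" by simp
  qed simp
  have unit: "0 \<le> 1 - step k s \<and> 1 - step k s \<le> 1" for k s
    using step[of k s] \<phi>(1)[of s] by linarith
  have "(\<lambda>k. expectation (\<lambda>w. iprod (\<lambda>n. 1 - step k (\<Delta> n w))))
      \<longlonglongrightarrow> expectation (\<lambda>w. iprod (\<lambda>n. 1 - \<phi> (\<Delta> n w)))"
  proof (rule integral_dominated_convergence[where w="\<lambda>_. 1"])
    show "AE w in P. (\<lambda>k. iprod (\<lambda>n. 1 - step k (\<Delta> n w))) \<longlonglongrightarrow> iprod (\<lambda>n. 1 - \<phi> (\<Delta> n w))"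
      using step \<phi> lim by (intro AE_I2 iprod_tendsto_below tendsto_intros) auto
    show "AE w in P. norm (iprod (\<lambda>n. 1 - step k (\<Delta> n w))) \<le> 1" for k
      using unit by (auto intro!: abs_iprod_le_1)
  qed auto
  moreover have "(\<lambda>k. expectation (\<lambda>w. iprod (\<lambda>n. 1 - step k (\<Delta> n w))))
      = (\<lambda>k. exp (- (\<integral>s. step k s \<partial>\<mu>)))"
    using laplace_functional_step[OF assms] by (simp add: step_def)
  moreover have "(\<lambda>k. exp (- (\<integral>s. step k s \<partial>\<mu>))) \<longlonglongrightarrow> exp (- (\<integral>s. \<phi> s \<partial>\<mu>))"
    using step \<phi> lim by (intro tendsto_exp tendsto_minus integral_dominated_convergence[where w=\<phi>]) auto
  ultimately show ?thesis by (auto intro: LIMSEQ_unique)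
qed

section \<open>Almost sure properties of the points, and their maximum\<close>

lemma integrable_indicator_greaterThan:
  assumes "0 < a"
  shows "integrable \<mu> (indicator {a<..} :: real \<Rightarrow> real)"
    and "(\<integral>s. indicator {a<..} s \<partial>\<mu>) = a powr - \<sigma>"
  using assms sigma
  by (auto simp: stable_intensity_greaterThan sets_stable_intensity measure_def)

text \<open>The generating functional of the indicator of \<open>{..0}\<close> is the probability of
  no point there, and the intensity gives that set no mass.\<close>

lemma AE_points_pos: "AE w in P. \<forall>n. 0 < \<Delta> n w"
proof -
  have null: "emeasure \<mu> {..0} = 0" by (rule stable_intensity_nonpos)
  have "expectation (\<lambda>w. iprod (\<lambda>n. 1 - indicator {..0} (\<Delta> n w)))
      = exp (- (\<integral>s. indicator {..0} s \<partial>\<mu>))"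
    by (rule laplace_functional)
      (auto simp: null sets_stable_intensity integrable_indicator_iff)
  also have "\<dots> = 1"
    using null by (simp add: sets_stable_intensity measure_def)
  also have "(\<lambda>w. iprod (\<lambda>n. 1 - indicator {..0} (\<Delta> n w))) = (\<lambda>w. of_bool (\<forall>n. 0 < \<Delta> n w))"
    by (subst iprod_of_bool[symmetric]) (auto intro!: ext arg_cong[where f=iprod] simp: indicator_def not_le)
  also have "expectation (\<lambda>w. of_bool (\<forall>n. 0 < \<Delta> n w)) = prob {w \<in> space P. \<forall>n. 0 < \<Delta> n w}"
    by (rule expectation_of_bool) measurable
  finally show ?thesis
    by (subst (asm) prob_Collect_eq_1) auto
qed

lemma AE_decreasing: "AE w in P. \<forall>n. 0 < n \<longrightarrow> \<Delta> n w < \<Delta> 0 w"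
proof -
  have "AE w in P. \<forall>n. \<Delta> (Suc n) w < \<Delta> n w"
    using points by (auto simp: ordered_poisson_points_def)
  then show ?thesis
  proof eventually_elim
    case (elim w)
    have "\<Delta> (Suc n) w < \<Delta> 0 w" for n
      using elim by (induction n) (auto intro: less_trans)
    then show ?case by (metis gr0_conv_Suc)
  qed
qed

text \<open>For \<open>z < 1\<close> the power \<open>ennreal_power z\<close> is at most the
  indicator of a finite count, while its expectation tends to 1 as \<open>z\<close> tends to
  1.\<close>

lemma AE_finite_greaterThan:
  assumes "0 < a"
  shows "AE w in P. finite {n. a < \<Delta> n w}"
proof -
  let ?fin = "{w \<in> space P. point_count \<Delta> {a<..} w \<noteq> \<top>}"
  have sub: "exp (- (a powr - \<sigma>) * (1 - z)) \<le> prob ?fin" if z: "0 \<le> z" "z < 1" for z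
  proof -
    have "exp (- (a powr - \<sigma>) * (1 - z)) = expectation (\<lambda>w. ennreal_power z (point_count \<Delta> {a<..} w))"
      using assms sigma z by (subst pgf_point_count) (auto simp: stable_intensity_greaterThan measure_def)
    also have "\<dots> \<le> expectation (indicator ?fin)"
      using z by (intro integral_mono) (auto intro!: integrable_const_bound[where B=1]
          simp: ennreal_power_def indicator_def power_le_one)
    finally show ?thesis by simp
  qed
  have "(\<lambda>k. exp (- (a powr - \<sigma>) * inverse (real (Suc k)))) \<longlonglongrightarrow> exp (- (a powr - \<sigma>) * 0)"
    by (intro tendsto_intros LIMSEQ_inverse_real_of_nat)
  then have "exp (- (a powr - \<sigma>) * 0) \<le> prob ?fin"
    using sub[of "1 - inverse (real (Suc _))"]
    by (intro LIMSEQ_le_const2) (auto simp: divide_simps)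
  then have "prob ?fin = 1" by (simp add: antisym prob_le_1)
  then have "AE w in P. point_count \<Delta> {a<..} w \<noteq> \<top>"
    by (subst (asm) prob_Collect_eq_1) auto
  then show ?thesis
    by (auto elim!: eventually_mono simp: point_count_eq_card split: if_splits)
qed

text \<open>The event that the maximum is at most \<open>a\<close> is itself a product over the
  points, with factor 0 for each point above \<open>a\<close>. As \<phi> vanishes there, adding the
  indicator of \<open>{a<..}\<close> to \<phi> merges both products into one generating
  functional.\<close>

lemma expectation_max_le:
  assumes [measurable]: "\<phi> \<in> borel_measurable borel"
    and \<phi>: "\<And>s. 0 \<le> \<phi> s \<and> \<phi> s \<le> 1" "integrable \<mu> \<phi>" "\<And>s. a < s \<Longrightarrow> \<phi> s = 0" and "0 < a"
  shows "expectation (\<lambda>w. of_bool (\<Delta> 0 w \<le> a) * iprod (\<lambda>n. 1 - \<phi> (\<Delta> n w)))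
    = exp (- (a powr - \<sigma>) - (\<integral>s. \<phi> s \<partial>\<mu>))"
proof -
  let ?\<phi> = "\<lambda>s. \<phi> s + indicator {a<..} s"
  have unit: "0 \<le> ?\<phi> s \<and> ?\<phi> s \<le> 1" for s
    using \<phi>(1)[of s] \<phi>(3)[of s] by (auto simp: indicator_def)
  have "AE w in P. of_bool (\<Delta> 0 w \<le> a) * iprod (\<lambda>n. 1 - \<phi> (\<Delta> n w)) = iprod (\<lambda>n. 1 - ?\<phi> (\<Delta> n w))"
    using AE_decreasing
  proof eventually_elim
    case (elim w)
    have le: "\<Delta> n w \<le> \<Delta> 0 w" for n
      using elim by (cases "n = 0") (auto intro: less_imp_le)
    have "of_bool (\<Delta> 0 w \<le> a) = iprod (\<lambda>n. of_bool (\<Delta> n w \<le> a))"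
      using le by (subst iprod_of_bool) (auto intro: order_trans)
    then have "of_bool (\<Delta> 0 w \<le> a) * iprod (\<lambda>n. 1 - \<phi> (\<Delta> n w))
        = iprod (\<lambda>n. of_bool (\<Delta> n w \<le> a) * (1 - \<phi> (\<Delta> n w)))"
      using \<phi>(1) by (simp add: iprod_mult)
    also have "\<dots> = iprod (\<lambda>n. 1 - ?\<phi> (\<Delta> n w))"
      using \<phi>(3) by (intro arg_cong[where f=iprod] ext) (auto simp: indicator_def)
    finally show ?case .
  qed
  then have "expectation (\<lambda>w. of_bool (\<Delta> 0 w \<le> a) * iprod (\<lambda>n. 1 - \<phi> (\<Delta> n w)))
      = expectation (\<lambda>w. iprod (\<lambda>n. 1 - ?\<phi> (\<Delta> n w)))"
    by (intro integral_cong_AE) auto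
  also have "\<dots> = exp (- (\<integral>s. ?\<phi> s \<partial>\<mu>))"
    using unit \<phi> \<open>0 < a\<close> by (intro laplace_functional) (auto simp: integrable_indicator_greaterThan)
  also have "(\<integral>s. ?\<phi> s \<partial>\<mu>) = (\<integral>s. \<phi> s \<partial>\<mu>) + a powr - \<sigma>"
    using \<phi> \<open>0 < a\<close> integrable_indicator_greaterThan[of a]
    by (subst Bochner_Integration.integral_add) auto
  finally show ?thesis by (simp add: algebra_simps)
qed

text \<open>
  Since \<open>\<phi>\<close> vanishes near \<open>1\<close>, the factors of the points in \<open>{a<..b}\<close> are \<open>1\<close>, so the maximum and
  the product decouple exactly.
\<close>
lemma expectation_max_interval:
  assumes [measurable]: "\<phi> \<in> borel_measurable borel"
    and \<phi>: "\<And>s. 0 \<le> \<phi> s \<and> \<phi> s \<le> 1" "integrable \<mu> \<phi>" "\<And>s. e < s \<Longrightarrow> \<phi> s = 0"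
    and ab: "0 < a" "a \<le> b" "e * b \<le> a"
  shows "expectation (\<lambda>w. indicator {a<..b} (\<Delta> 0 w) * iprod (\<lambda>n. 1 - \<phi> (\<Delta> n w / b))) =
    expectation (\<lambda>w. indicator {a<..b} (\<Delta> 0 w) * exp (- (b powr - \<sigma>) * (\<integral>s. \<phi> s \<partial>\<mu>)))"
proof -
  let ?C = "\<integral>s. \<phi> s \<partial>\<mu>"
  have b: "0 < b" using ab by simp
  have unit: "0 \<le> 1 - \<phi> s \<and> 1 - \<phi> s \<le> 1" for s using \<phi>(1)[of s] by simp
  have bound: "\<bar>iprod (\<lambda>n. 1 - \<phi> (f n))\<bar> \<le> 1" for f :: "nat \<Rightarrow> real"
    using unit by (rule abs_iprod_le_1)
  note scale = integral_stable_intensity_scale[OF assms(1) b conjunct1[OF \<phi>(1)] \<phi>(2)]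
  have max_le: "expectation (\<lambda>w. of_bool (\<Delta> 0 w \<le> x) * iprod (\<lambda>n. 1 - \<phi> (\<Delta> n w / b)))
      = exp (- (x powr - \<sigma>) - b powr - \<sigma> * ?C)" if "a \<le> x" for x
  proof -
    \<comment> \<open>From \<open>e * b \<le> a \<le> x < s\<close> follows
      \<open>e < s / b\<close>. Therefore \<open>expectation_max_le\<close> applies at both ends
      \<open>x = a\<close> and \<open>x = b\<close> with the same dilated function.\<close>
    have "\<phi> (s / b) = 0" if "x < s" for s
      using that \<open>a \<le> x\<close> ab b by (intro \<phi>(3)) (simp add: divide_simps)
    with scale \<phi>(1) ab that show ?thesis
      by (subst expectation_max_le[of "\<lambda>s. \<phi> (s / b)"]) auto
  qed
  have max_le': "expectation (\<lambda>w. of_bool (\<Delta> 0 w \<le> x)) = exp (- (x powr - \<sigma>))" if "a \<le> x" for x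
    using expectation_max_le[of "\<lambda>_. 0" x] ab that by (simp add: iprod_eq_prod[where m=0])
  have split: "indicator {a<..b} x * y = of_bool (x \<le> b) * y - of_bool (x \<le> a) * y" for x y :: real
    using ab by (auto simp: indicator_def)
  have "expectation (\<lambda>w. indicator {a<..b} (\<Delta> 0 w) * iprod (\<lambda>n. 1 - \<phi> (\<Delta> n w / b)))
      = exp (- (b powr - \<sigma>) - b powr - \<sigma> * ?C) - exp (- (a powr - \<sigma>) - b powr - \<sigma> * ?C)"
    unfolding split
    by (subst Bochner_Integration.integral_diff)
      (auto intro!: integrable_const_bound[where B=1] simp: max_le ab abs_mult bound)
  also have "\<dots> = (exp (- (b powr - \<sigma>)) - exp (- (a powr - \<sigma>))) * exp (- (b powr - \<sigma>) * ?C)"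
    by (simp add: left_diff_distrib exp_add[symmetric])
  also have "\<dots> = expectation (\<lambda>w. indicator {a<..b} (\<Delta> 0 w) * exp (- (b powr - \<sigma>) * ?C))"
    unfolding split
    by (subst Bochner_Integration.integral_diff)
      (auto intro!: integrable_const_bound[where B=1] simp: max_le' ab left_diff_distrib)
  finally show ?thesis .
qed

text \<open>The largest point is rounded up to the grid \<open>a + j / m\<close>, and then \<open>m\<close> tends to infinity.\<close>
lemma expectation_max_greaterThan:
  assumes cont: "continuous_on UNIV \<phi>"
    and \<phi>: "\<And>s. 0 \<le> \<phi> s \<and> \<phi> s \<le> 1" "integrable \<mu> \<phi>" "\<And>s. 1 - e < s \<Longrightarrow> \<phi> s = 0"
      "\<And>s. s < e \<Longrightarrow> \<phi> s = 0" "0 < e"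
    and a: "0 < a"
  shows "expectation (\<lambda>w. indicator {a<..} (\<Delta> 0 w) * iprod (\<lambda>n. 1 - \<phi> (\<Delta> n w / \<Delta> 0 w))) =
    expectation (\<lambda>w. indicator {a<..} (\<Delta> 0 w) * exp (- (\<Delta> 0 w powr - \<sigma>) * (\<integral>s. \<phi> s \<partial>\<mu>)))"
proof -
  let ?C = "\<integral>s. \<phi> s \<partial>\<mu>"
  have C: "0 \<le> ?C" using \<phi> by (intro integral_nonneg_AE) auto
  have [measurable]: "\<phi> \<in> borel_measurable borel"
    using cont by (rule borel_measurable_continuous_onI)
  have unit: "0 \<le> 1 - \<phi> s \<and> 1 - \<phi> s \<le> 1" for s using \<phi>(1)[of s] by simp
  have bound: "0 \<le> iprod (\<lambda>n. 1 - \<phi> (f n))" "iprod (\<lambda>n. 1 - \<phi> (f n)) \<le> 1" for f :: "nat \<Rightarrow> real"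
    using iprod_nonneg[of "\<lambda>n. 1 - \<phi> (f n)", OF unit] iprod_le_1[of "\<lambda>n. 1 - \<phi> (f n)", OF unit] by auto
  have expbound: "exp (- (x powr - \<sigma>) * ?C) \<le> 1" for x
    using C by (simp add: mult_nonneg_nonneg)
  define up where "up m x = a + real_of_int \<lceil>(x - a) * real m\<rceil> / real m" for m and x :: real
  have [measurable]: "up m \<in> borel_measurable borel" for m
    unfolding up_def[abs_def] by measurable
  have up_ge: "x \<le> up m x" and up_le: "up m x \<le> x + 1 / m" if "0 < m" for m x
  proof -
    have "(x - a) * m / m \<le> real_of_int \<lceil>(x - a) * real m\<rceil> / m"
      "real_of_int \<lceil>(x - a) * real m\<rceil> / m \<le> ((x - a) * m + 1) / m"
      by (intro divide_right_mono; linarith)+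
    then show "x \<le> up m x" "up m x \<le> x + 1 / m"
      using that by (auto simp: up_def add_divide_distrib)
  qed
  have up_lim: "(\<lambda>m. up m x) \<longlonglongrightarrow> x" for x
  proof (rule real_tendsto_sandwich)
    show "\<forall>\<^sub>F m in sequentially. x \<le> up m x"
      using up_ge by (intro eventually_sequentiallyI[of 1]) auto
    show "\<forall>\<^sub>F m in sequentially. up m x \<le> x + 1 / real m"
      using up_le by (intro eventually_sequentiallyI[of 1]) auto
    have "(\<lambda>m. x + 1 / real m) \<longlonglongrightarrow> x + 0"
      by (intro tendsto_add tendsto_const lim_1_over_n)
    then show "(\<lambda>m. x + 1 / real m) \<longlonglongrightarrow> x" by simp
  qed simp
  let ?L = "\<lambda>t w. indicator {a<..} (\<Delta> 0 w) * iprod (\<lambda>n. 1 - \<phi> (\<Delta> n w / t (\<Delta> 0 w)))"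
  let ?R = "\<lambda>t w. indicator {a<..} (\<Delta> 0 w) * exp (- (t (\<Delta> 0 w) powr - \<sigma>) * ?C)"
  \<comment> \<open>A mesh \<open>1 / m\<close> of at most \<open>e * a\<close> ensures
    \<open>(1 - e) * b \<le> b - 1 / m\<close> for the right end \<open>b\<close> of every cell
    above \<open>a\<close>. This is the hypothesis of \<open>expectation_max_interval\<close>, used
    with \<open>1 - e\<close> as the cutoff.\<close>
  have grid: "expectation (?L (up m)) = expectation (?R (up m))" if m: "1 / (e * a) \<le> real m" for m
  proof -
    have m0: "0 < real m" using m \<phi>(5) a by (smt (verit) mult_pos_pos zero_less_divide_1_iff)
    define I where "I j = {a + real j / m<..a + real (Suc j) / m}" for j
    have up_I: "up m x = a + real (Suc j) / m" if "x \<in> I j" for x j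
    proof -
      have "\<lceil>(x - a) * real m\<rceil> = int (Suc j)"
        using that m0 by (intro ceiling_unique) (auto simp: I_def field_simps)
      then show ?thesis by (simp add: up_def)
    qed
    have sums_I: "(\<lambda>j. indicator (I j) x * y) sums (indicator {a<..} x * y)" for x y :: real
    proof (cases "a < x")
      case True
      define k where "k = nat (\<lceil>(x - a) * real m\<rceil> - 1)"
      have "0 < \<lceil>(x - a) * real m\<rceil>" using True m0 by simp
      then have k: "\<lceil>(x - a) * real m\<rceil> = int (Suc k)" by (simp add: k_def)
      have "x \<in> I k"
        using k m0 by (simp add: ceiling_eq_iff I_def field_simps)
      moreover have "x \<notin> I j" if "j \<noteq> k" for j
        using that up_I[of x j] up_I[OF \<open>x \<in> I k\<close>] m0 by auto
      ultimately show ?thesis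
        using True sums_finite[of "{k}" "\<lambda>j. indicator (I j) x * y"] by auto
    next
      case False
      have "x \<notin> I j" for j
        using False m0 by (auto simp: I_def) (smt (verit) divide_nonneg_nonneg of_nat_0_le_iff)
      with False show ?thesis by simp
    qed
    have cell: "expectation (\<lambda>w. indicator (I j) (\<Delta> 0 w) * iprod (\<lambda>n. 1 - \<phi> (\<Delta> n w / up m (\<Delta> 0 w))))
        = expectation (\<lambda>w. indicator (I j) (\<Delta> 0 w) * exp (- (up m (\<Delta> 0 w) powr - \<sigma>) * ?C))" for j
    proof -
      have "1 / m \<le> e * a" using m m0 \<phi>(5) a by (simp add: field_simps)
      also have "\<dots> \<le> e * (a + real (Suc j) / m)"
        using \<phi>(5) by (intro mult_left_mono) auto
      also have "\<dots> = e * a + e * (real (Suc j) / m)" by (simp add: distrib_left)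
      finally have "(1 - e) * (a + real (Suc j) / m) \<le> a + real (Suc j) / m - 1 / m"
        by (simp only: left_diff_distrib distrib_left mult_1)
      also have "\<dots> = a + real j / m" by (simp add: add_divide_distrib)
      finally have "(1 - e) * (a + real (Suc j) / m) \<le> a + real j / m" .
      then have "expectation (\<lambda>w. indicator (I j) (\<Delta> 0 w) * iprod (\<lambda>n. 1 - \<phi> (\<Delta> n w / (a + real (Suc j) / m))))
        = expectation (\<lambda>w. indicator (I j) (\<Delta> 0 w) * exp (- ((a + real (Suc j) / m) powr - \<sigma>) * ?C))"
        unfolding I_def using \<phi> a m0
        by (intro expectation_max_interval) (auto simp: divide_right_mono add_pos_nonneg)
      moreover have "indicator (I j) x * iprod (\<lambda>n. 1 - \<phi> (\<Delta> n w / up m x)) =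
          indicator (I j) x * iprod (\<lambda>n. 1 - \<phi> (\<Delta> n w / (a + real (Suc j) / m)))"
        "indicator (I j) x * exp (- (up m x powr - \<sigma>) * ?C) =
          indicator (I j) x * exp (- ((a + real (Suc j) / m) powr - \<sigma>) * ?C)" for x w
        by (cases "x \<in> I j"; simp add: up_I)+
      ultimately show ?thesis by (simp only:)
    qed
    have swap: "(\<lambda>j. expectation (\<lambda>w. indicator (I j) (\<Delta> 0 w) * f w)) sums
        expectation (\<lambda>w. indicator {a<..} (\<Delta> 0 w) * f w)"
      if [measurable]: "f \<in> borel_measurable P" and f: "\<And>w. 0 \<le> f w" "\<And>w. f w \<le> 1" for f :: "'b \<Rightarrow> real"
    proof (rule expectation_sums)
      show "(\<lambda>w. indicator (I j) (\<Delta> 0 w) * f w) \<in> borel_measurable P" for j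
        unfolding I_def by measurable
      show "AE w in P. (\<forall>j. 0 \<le> indicator (I j) (\<Delta> 0 w) * f w) \<and>
          (\<lambda>j. indicator (I j) (\<Delta> 0 w) * f w) sums (indicator {a<..} (\<Delta> 0 w) * f w) \<and>
          indicator {a<..} (\<Delta> 0 w) * f w \<le> 1"
        using f sums_I by (intro AE_I2) (auto simp: indicator_def)
    qed measurable
    show ?thesis
    proof (rule sums_unique2)
      show "(\<lambda>j. expectation (\<lambda>w. indicator (I j) (\<Delta> 0 w) * exp (- (up m (\<Delta> 0 w) powr - \<sigma>) * ?C)))
          sums expectation (?L (up m))"
        unfolding cell[symmetric] by (rule swap) (simp_all add: bound)
      show "(\<lambda>j. expectation (\<lambda>w. indicator (I j) (\<Delta> 0 w) * exp (- (up m (\<Delta> 0 w) powr - \<sigma>) * ?C)))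
          sums expectation (?R (up m))"
        by (rule swap) (use expbound in simp_all)
    qed
  qed
  have limL: "(\<lambda>m. expectation (?L (up m))) \<longlonglongrightarrow> expectation (?L (\<lambda>x. x))"
  proof (rule integral_dominated_convergence[where w="\<lambda>_. 1"])
    \<comment> \<open>Since \<phi> vanishes below \<open>e\<close>, only points above
      \<open>e * a\<close> can have a factor other than 1 when the divisor is at least
      \<open>a\<close>. They are finitely many, so the infinite product is a finite product of
      continuous factors. Taking half of \<open>e * a\<close> gives the strict inequality needed
      beyond \<open>K\<close>.\<close>
    have "AE w in P. finite {n. e * a / 2 < \<Delta> n w}"
      using \<phi>(5) a by (intro AE_finite_greaterThan) simp
    then show "AE w in P. (\<lambda>m. ?L (up m) w) \<longlonglongrightarrow> ?L (\<lambda>x. x) w"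
      using AE_points_pos
    proof eventually_elim
      case (elim w)
      show ?case
      proof (cases "a < \<Delta> 0 w")
        case True
        obtain K where "\<And>n. e * a / 2 < \<Delta> n w \<Longrightarrow> n < K"
          using elim(1) finite_nat_set_iff_bounded by auto
        then have "\<Delta> n w \<le> e * a / 2" if "n \<ge> K" for n
          using that by (meson leD not_le)
        moreover have "0 < e * a" using \<phi>(5) a by simp
        ultimately have K: "\<Delta> n w < e * a" if "n \<ge> K" for n
          using that by (smt (verit) field_sum_of_halves)
        have trivial: "1 - \<phi> (\<Delta> n w / t) = 1" if "n \<ge> K" "a \<le> t" for n t
        proof -
          have "e * a \<le> e * t" using that \<phi>(5) by (intro mult_left_mono) auto
          then have "\<Delta> n w / t < e"
            using K[OF that(1)] that a by (simp add: divide_less_eq mult.commute)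
          then show ?thesis using \<phi>(4) by simp
        qed
        have "\<forall>\<^sub>F m in sequentially. (\<Prod>n<K. 1 - \<phi> (\<Delta> n w / up m (\<Delta> 0 w))) = ?L (up m) w"
        proof (intro eventually_sequentiallyI[of 1])
          fix m :: nat assume "1 \<le> m"
          then have "a \<le> up m (\<Delta> 0 w)" using up_ge[of m "\<Delta> 0 w"] True by simp
          then show "(\<Prod>n<K. 1 - \<phi> (\<Delta> n w / up m (\<Delta> 0 w))) = ?L (up m) w"
            using True trivial by (subst iprod_eq_prod[where m=K]) auto
        qed
        moreover have "(\<lambda>m. \<Prod>n<K. 1 - \<phi> (\<Delta> n w / up m (\<Delta> 0 w))) \<longlonglongrightarrow> (\<Prod>n<K. 1 - \<phi> (\<Delta> n w / \<Delta> 0 w))"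
          using True a by (intro tendsto_prod tendsto_diff tendsto_const
            continuous_on_tendsto_compose[OF cont] tendsto_divide up_lim) auto
        ultimately have "(\<lambda>m. ?L (up m) w) \<longlonglongrightarrow> (\<Prod>n<K. 1 - \<phi> (\<Delta> n w / \<Delta> 0 w))"
          by (rule Lim_transform_eventually[rotated])
        also have "(\<Prod>n<K. 1 - \<phi> (\<Delta> n w / \<Delta> 0 w)) = ?L (\<lambda>x. x) w"
          using True trivial by (subst iprod_eq_prod[where m=K]) auto
        finally show ?thesis .
      qed simp
    qed
    show "AE w in P. norm (?L (up m) w) \<le> 1" for m
      using bound by (intro AE_I2) (simp add: indicator_def)
  qed auto
  have limR: "(\<lambda>m. expectation (?R (up m))) \<longlonglongrightarrow> expectation (?R (\<lambda>x. x))"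
  proof (rule integral_dominated_convergence[where w="\<lambda>_. 1"])
    show "AE w in P. (\<lambda>m. ?R (up m) w) \<longlonglongrightarrow> ?R (\<lambda>x. x) w"
      using AE_points_pos by eventually_elim (intro tendsto_intros up_lim; metis less_irrefl)
    show "AE w in P. norm (?R (up m) w) \<le> 1" for m
      using expbound by (intro AE_I2) (simp add: indicator_def)
  qed auto
  have "\<forall>\<^sub>F m in sequentially. expectation (?L (up m)) = expectation (?R (up m))"
    using grid by (intro eventually_sequentiallyI[of "nat \<lceil>1 / (e * a)\<rceil>"]) (simp add: nat_le_iff ceiling_le_iff)
  with limL have "(\<lambda>m. expectation (?R (up m))) \<longlonglongrightarrow> expectation (?L (\<lambda>x. x))"
    by (rule Lim_transform_eventually)
  then show ?thesis
    using limR by (rule LIMSEQ_unique)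
qed

end

section \<open>Measures on the positive reals determined by their tails\<close>

lemma greaterThan_0_eq_Union: "{0<..} = (\<Union>n. {inverse (real (Suc n))<..})"
proof (intro set_eqI iffI)
  fix x :: real assume "x \<in> (\<Union>n. {inverse (real (Suc n))<..})"
  then obtain n where "inverse (real (Suc n)) < x" by auto
  moreover have "0 < inverse (real (Suc n))" by simp
  ultimately show "x \<in> {0<..}" by (simp only: greaterThan_iff)
next
  fix x :: real assume "x \<in> {0<..}"
  then show "x \<in> (\<Union>n. {inverse (real (Suc n))<..})"
    using reals_Archimedean[of x] by (simp only: greaterThan_iff UN_iff) blast
qed

lemma emeasure_greaterThan_0:
  fixes M :: "real measure"
  assumes "sets M = sets borel"
  shows "emeasure M {0<..} = (SUP n. emeasure M {inverse (real (Suc n))<..})"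
proof -
  have "incseq (\<lambda>n. {inverse (real (Suc n))<..})"
    by (auto simp: incseq_Suc_iff intro: le_less_trans[rotated])
  moreover have "range (\<lambda>n. {inverse (real (Suc n))<..}) \<subseteq> sets M"
    unfolding assms by auto
  ultimately show ?thesis
    unfolding greaterThan_0_eq_Union by (rule SUP_emeasure_incseq[rotated, symmetric])
qed

text \<open>The available tail formulas hold for positive \<open>x\<close> only. The tail above 0 is
  their increasing limit, and a tail above a nonpositive \<open>x\<close> differs from it by a null
  set.\<close>

lemma measure_eqI_positive_reals:
  fixes M N :: "real measure"
  assumes sets[measurable_cong]: "sets M = sets borel" "sets N = sets borel"
    and fin: "finite_measure M" "finite_measure N"
    and null: "emeasure M {..0} = 0" "emeasure N {..0} = 0"
    and eq: "\<And>x. 0 < x \<Longrightarrow> emeasure M {x<..} = emeasure N {x<..}"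
  shows "M = N"
proof (rule measure_eqI_lessThan)
  show "emeasure M {x<..} < \<infinity>" for x
    using fin(1) by (simp add: finite_measure.emeasure_finite less_top[symmetric])
  have "emeasure M {inverse (real (Suc n))<..} = emeasure N {inverse (real (Suc n))<..}" for n
    by (rule eq) simp
  then have eq0: "emeasure M {0<..} = emeasure N {0<..}"
    by (simp only: emeasure_greaterThan_0 sets)
  have le0: "emeasure L {x<..} = emeasure L {0<..}"
    if "sets L = sets borel" "emeasure L {..0} = 0" "x \<le> 0" for L :: "real measure" and x
  proof (rule antisym)
    have borel: "B \<in> sets L" if "B \<in> sets borel" for B
      using that by (simp only: \<open>sets L = sets borel\<close>)
    have "emeasure L {x<..} \<le> emeasure L ({0<..} \<union> {..0})"
      by (intro emeasure_mono borel) auto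
    also have "\<dots> \<le> emeasure L {0<..} + emeasure L {..0}"
      by (intro emeasure_subadditive borel) simp_all
    finally show "emeasure L {x<..} \<le> emeasure L {0<..}" using that(2) by simp
    show "emeasure L {0<..} \<le> emeasure L {x<..}"
      using that(3) by (intro emeasure_mono borel) auto
  qed
  show "emeasure M {x<..} = emeasure N {x<..}" for x
  proof (cases "0 < x")
    case False
    then have "x \<le> 0" by simp
    then show ?thesis
      using eq0 by (simp only: le0[OF sets(1) null(1) \<open>x \<le> 0\<close>] le0[OF sets(2) null(2) \<open>x \<le> 0\<close>])
  qed (rule eq)
qed (simp_all add: sets)

lemma max_density_greaterThan:
  assumes "0 < \<sigma>" "0 < a"
  shows "emeasure (density lborel (max_density \<sigma>)) {a<..} = ennreal (1 - exp (- (a powr - \<sigma>)))"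
proof -
  have "emeasure (density lborel (max_density \<sigma>)) {a<..}
      = (\<integral>\<^sup>+s. ennreal (max_density \<sigma> s) * indicator {a<..} s \<partial>lborel)"
    by (subst emeasure_density) auto
  also have "\<dots> = (\<integral>\<^sup>+s. ennreal (max_density \<sigma> s) * indicator {a..} s \<partial>lborel)"
    using AE_lborel_singleton[of a]
    by (intro nn_integral_cong_AE) (auto elim!: eventually_mono simp: indicator_def)
  also have "\<dots> = ennreal (1 - exp (- (a powr - \<sigma>)))"
  proof (rule nn_integral_FTC_atLeast)
    show "((\<lambda>s. exp (- (s powr - \<sigma>))) has_real_derivative max_density \<sigma> x) (at x)" if "a \<le> x" for x
      using that assms by (auto intro!: derivative_eq_intros simp: max_density_def algebra_simps minus_diff_commute)
    have "((\<lambda>s. exp (- (s powr - \<sigma>))) \<longlongrightarrow> exp (- 0)) at_top"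
      using assms by (intro tendsto_exp tendsto_minus tendsto_neg_powr filterlim_ident) auto
    then show "((\<lambda>s. exp (- (s powr - \<sigma>))) \<longlongrightarrow> 1) at_top" by simp
  qed (use assms in \<open>auto simp: max_density_def\<close>)
  finally show ?thesis .
qed

section \<open>The law of the largest point and of the ratios\<close>

context stable_points
begin

text \<open>The case \<phi> = 0 of \<open>expectation_max_le\<close> gives the distribution function
  \<open>exp (- (x powr - \<sigma>))\<close>, a Frechet law. That \<open>max_density\<close> is the
  density of the largest point is thereby derived from the Poisson property.\<close>

lemma distr_max: "distr P borel (\<Delta> 0) = density lborel (max_density \<sigma>)"
proof (rule measure_eqI_positive_reals)
  let ?D = "density lborel (max_density \<sigma>)"
  interpret D: prob_space "distr P borel (\<Delta> 0)" by (rule prob_space_distr) simp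
  show "finite_measure (distr P borel (\<Delta> 0))" by (rule D.finite_measure_axioms)
  have null: "AE w in P. \<not> \<Delta> 0 w \<le> 0"
    using AE_points_pos by (auto elim!: eventually_mono simp: not_le)
  then show "emeasure (distr P borel (\<Delta> 0)) {..0} = 0"
    by (subst emeasure_distr) (auto simp: AE_iff_measurable[OF _ refl] vimage_def Int_def conj_commute)
  have "(\<integral>\<^sup>+s. ennreal (max_density \<sigma> s) * indicator {..0} s \<partial>lborel) = 0"
    by (intro nn_integral_zero' AE_I2) (auto simp: max_density_def indicator_def)
  then show null': "emeasure ?D {..0} = 0"
    by (subst emeasure_density) auto
  have "emeasure ?D {0<..} \<le> 1"
    using sigma by (auto simp: emeasure_greaterThan_0 max_density_greaterThan simp del: of_nat_Suc
      intro!: SUP_least ennreal_le_1[THEN iffD2])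
  moreover have "space ?D = {..0} \<union> {0<..}" by auto
  ultimately have "emeasure ?D (space ?D) \<le> 0 + 1"
    using null' by (metis (no_types, lifting) add_mono emeasure_subadditive order_trans order_refl
        sets_density sets_lborel atMost_borel greaterThan_borel)
  then show "finite_measure ?D"
    by (intro finite_measureI) (auto simp: top_unique)
  fix x :: real assume x: "0 < x"
  have le: "expectation (\<lambda>w. of_bool (\<Delta> 0 w \<le> x)) = exp (- (x powr - \<sigma>))"
    using expectation_max_le[of "\<lambda>_. 0" x] x by (simp add: iprod_eq_prod[where m=0])
  have "emeasure (distr P borel (\<Delta> 0)) {x<..} = ennreal (expectation (\<lambda>w. 1 - of_bool (\<Delta> 0 w \<le> x)))"
  proof (subst emeasure_distr)
    have "expectation (\<lambda>w. 1 - of_bool (\<Delta> 0 w \<le> x)) = expectation (indicator (\<Delta> 0 -` {x<..} \<inter> space P))"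
      by (intro Bochner_Integration.integral_cong) (auto simp: indicator_def)
    also have "\<dots> = prob (\<Delta> 0 -` {x<..} \<inter> space P)" by simp
    finally show "emeasure P (\<Delta> 0 -` {x<..} \<inter> space P) = ennreal (expectation (\<lambda>w. 1 - of_bool (\<Delta> 0 w \<le> x)))"
      by (simp only: emeasure_eq_measure)
  qed auto
  also have "expectation (\<lambda>w. 1 - of_bool (\<Delta> 0 w \<le> x)) = 1 - exp (- (x powr - \<sigma>))"
    by (subst Bochner_Integration.integral_diff)
      (auto intro!: integrable_const_bound[where B=1] simp: le prob_space)
  finally show "emeasure (distr P borel (\<Delta> 0)) {x<..} = emeasure ?D {x<..}"
    using x sigma by (simp add: max_density_greaterThan)
qed auto

text \<open>\<open>expectation_max_greaterThan\<close> says that the measures with densities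
  \<open>L\<close> and \<open>R\<close> have images under \<open>\<Delta> 0\<close> with equal
  positive tails. The images therefore coincide, and any \<open>h\<close> can be integrated against
  them.\<close>

lemma laplace_ratios_compact:
  assumes cont: "continuous_on UNIV \<phi>"
    and \<phi>: "\<And>s. 0 \<le> \<phi> s \<and> \<phi> s \<le> 1" "integrable \<mu> \<phi>" "\<And>s. 1 - e < s \<Longrightarrow> \<phi> s = 0"
      "\<And>s. s < e \<Longrightarrow> \<phi> s = 0" "0 < e"
    and h: "h \<in> borel_measurable borel"
  shows "(\<integral>\<^sup>+w. h (\<Delta> 0 w) * ennreal (iprod (\<lambda>n. 1 - \<phi> (ratio n w))) \<partial>P) =
    (\<integral>\<^sup>+w. h (\<Delta> 0 w) * ennreal (exp (- (\<Delta> 0 w powr - \<sigma>) * (\<integral>s. \<phi> s \<partial>\<mu>))) \<partial>P)"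
proof -
  note h[measurable]
  have [measurable]: "\<phi> \<in> borel_measurable borel"
    using cont by (rule borel_measurable_continuous_onI)
  define L where "L w = iprod (\<lambda>n. 1 - \<phi> (\<Delta> n w / \<Delta> 0 w))" for w
  define R where "R w = exp (- (\<Delta> 0 w powr - \<sigma>) * (\<integral>s. \<phi> s \<partial>\<mu>))" for w
  have [measurable]: "L \<in> borel_measurable P" "R \<in> borel_measurable P"
    unfolding L_def[abs_def] R_def[abs_def] by measurable
  have L: "0 \<le> L w" "L w \<le> 1" for w
    using \<phi>(1) by (auto simp: L_def intro!: iprod_nonneg iprod_le_1)
  have "0 \<le> (\<integral>s. \<phi> s \<partial>\<mu>)" using \<phi> by (intro integral_nonneg_AE) auto
  then have R: "0 \<le> R w" "R w \<le> 1" for w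
    by (auto simp: R_def)
  have meas: "emeasure (distr (density P (\<lambda>w. ennreal (f w))) borel (\<Delta> 0)) B
      = ennreal (expectation (\<lambda>w. indicator B (\<Delta> 0 w) * f w))"
    if [measurable]: "f \<in> borel_measurable P" "B \<in> sets borel" and f: "\<And>w. 0 \<le> f w" "\<And>w. f w \<le> 1"
    for f B
  proof -
    have "emeasure (distr (density P (\<lambda>w. ennreal (f w))) borel (\<Delta> 0)) B =
        ennreal (expectation (\<lambda>w. indicator (\<Delta> 0 -` B \<inter> space P) w * f w))"
      using f by (subst emeasure_distr) (auto intro!: emeasure_density_unit)
    also have "expectation (\<lambda>w. indicator (\<Delta> 0 -` B \<inter> space P) w * f w) = expectation (\<lambda>w. indicator B (\<Delta> 0 w) * f w)"
      by (intro Bochner_Integration.integral_cong) (auto simp: indicator_def)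
    finally show ?thesis .
  qed
  have null: "expectation (\<lambda>w. indicator {..0} (\<Delta> 0 w) * f w) = 0" for f :: "'b \<Rightarrow> real"
  proof -
    have "AE w in P. indicator {..0} (\<Delta> 0 w) * f w = 0"
      using AE_points_pos by eventually_elim (auto simp: indicator_def not_le)
    then show ?thesis by (rule integral_eq_zero_AE)
  qed
  have eq: "distr (density P (\<lambda>w. ennreal (L w))) borel (\<Delta> 0) = distr (density P (\<lambda>w. ennreal (R w))) borel (\<Delta> 0)"
  proof (rule measure_eqI_positive_reals)
    show "finite_measure (distr (density P (\<lambda>w. ennreal (L w))) borel (\<Delta> 0))"
      "finite_measure (distr (density P (\<lambda>w. ennreal (R w))) borel (\<Delta> 0))"
      by (intro finite_measureI; simp add: meas L R)+
    show "emeasure (distr (density P (\<lambda>w. ennreal (L w))) borel (\<Delta> 0)) {x<..} =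
        emeasure (distr (density P (\<lambda>w. ennreal (R w))) borel (\<Delta> 0)) {x<..}" if "0 < x" for x
      using expectation_max_greaterThan[OF cont \<phi> that] by (simp add: meas L R) (simp add: L_def R_def)
  qed (simp_all add: meas L R null)
  have "(\<integral>\<^sup>+w. h (\<Delta> 0 w) * ennreal (L w) \<partial>P) = (\<integral>\<^sup>+s. h s \<partial>distr (density P (\<lambda>w. ennreal (L w))) borel (\<Delta> 0))"
    by (simp add: nn_integral_distr nn_integral_density mult.commute)
  also have "\<dots> = (\<integral>\<^sup>+w. h (\<Delta> 0 w) * ennreal (R w) \<partial>P)"
    unfolding eq by (simp add: nn_integral_distr nn_integral_density mult.commute)
  finally have "(\<integral>\<^sup>+w. h (\<Delta> 0 w) * ennreal (L w) \<partial>P) = (\<integral>\<^sup>+w. h (\<Delta> 0 w) * ennreal (R w) \<partial>P)" .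
  \<comment> \<open>\<open>L\<close> runs over all points, the maximum included. Its factor is
    \<open>1 - \<phi> 1 = 1\<close>, so the product may start at the first ratio.\<close>
  moreover have "AE w in P. L w = iprod (\<lambda>n. 1 - \<phi> (ratio n w))"
    using AE_points_pos
  proof eventually_elim
    case (elim w)
    have "\<Delta> 0 w \<noteq> 0" using elim by (metis less_irrefl)
    then show ?case
      unfolding L_def using \<phi>(3)[of 1] \<phi>(5) by (subst iprod_shift) auto
  qed
  then have "(\<integral>\<^sup>+w. h (\<Delta> 0 w) * ennreal (L w) \<partial>P) =
      (\<integral>\<^sup>+w. h (\<Delta> 0 w) * ennreal (iprod (\<lambda>n. 1 - \<phi> (ratio n w))) \<partial>P)"
    by (intro nn_integral_cong_AE) (auto elim!: eventually_mono)
  ultimately show ?thesis by (simp add: R_def)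
qed

text \<open>
  \<open>laplace_ratios_compact\<close> for \<open>\<phi>\<close> times a cutoff that vanishes within \<open>1 / k\<close> of \<open>0\<close> and \<open>1\<close>;
  then \<open>k\<close> tends to infinity.
\<close>
lemma laplace_ratios:
  assumes cont: "continuous_on {0<..<1} \<phi>"
    and \<phi>: "\<And>s. 0 < s \<Longrightarrow> s < 1 \<Longrightarrow> 0 \<le> \<phi> s \<and> \<phi> s \<le> 1"
    and int: "integrable \<mu> (\<lambda>s. indicator {0<..<1} s * \<phi> s)"
    and h: "h \<in> borel_measurable borel" "(\<integral>\<^sup>+w. h (\<Delta> 0 w) \<partial>P) < \<infinity>"
  shows "(\<integral>\<^sup>+w. h (\<Delta> 0 w) * ennreal (iprod (\<lambda>n. 1 - indicator {0<..<1} (ratio n w) *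
      \<phi> (ratio n w))) \<partial>P) =
    (\<integral>\<^sup>+w. h (\<Delta> 0 w) * ennreal (exp (- (\<Delta> 0 w powr - \<sigma>) * (\<integral>s. indicator {0<..<1} s * \<phi> s \<partial>\<mu>))) \<partial>P)"
proof -
  define \<psi> where "\<psi> s = indicator {0<..<1} s * \<phi> s" for s :: real
  define cut where "cut k s = max 0 (min 1 (real k * min s (1 - s) - 1))" for k :: nat and s :: real
  have \<psi>: "0 \<le> \<psi> s \<and> \<psi> s \<le> 1" for s using \<phi> by (auto simp: \<psi>_def indicator_def)
  have cut: "0 \<le> cut k s \<and> cut k s \<le> 1" for k s by (simp add: cut_def)
  have \<psi>cut: "0 \<le> \<psi> s * cut k s \<and> \<psi> s * cut k s \<le> \<psi> s" for k s
    using \<psi>[of s] cut[of k s] by (simp add: mult_left_le)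
  \<comment> \<open>The width \<open>1 / (k + 1)\<close>, slightly smaller than
    \<open>1 / k\<close>, also makes sense for \<open>k = 0\<close>, where \<open>cut\<close> is
    identically 0; \<open>laplace_ratios_compact\<close> needs a positive \<open>e\<close> for every
    \<open>k\<close>.\<close>
  have cut0: "cut k s = 0" if "min s (1 - s) \<le> 1 / (real k + 1)" for k s
  proof -
    have "real k * min s (1 - s) \<le> real k * (1 / (real k + 1))" using that by (intro mult_left_mono) auto
    also have "\<dots> \<le> 1" by simp
    finally show ?thesis by (simp add: cut_def)
  qed
  have cont\<psi>cut: "continuous_on UNIV (\<lambda>s. \<psi> s * cut k s)" for k
  proof -
    let ?e = "1 / (real k + 1)"
    \<comment> \<open>Nothing is known of \<phi> at the ends 0 and 1. The line is covered by two
      open sets: the unit interval, where \<phi> is continuous, and the complement of a compact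
      subinterval, where the product is 0.\<close>
    have "continuous_on ({0<..<1} \<union> (- {?e..1 - ?e})) (\<lambda>s. \<psi> s * cut k s)"
    proof (rule continuous_on_open_Un)
      have "continuous_on {0<..<1} (\<lambda>s. \<phi> s * cut k s)"
        unfolding cut_def by (intro continuous_intros cont)
      then show "continuous_on {0<..<1} (\<lambda>s. \<psi> s * cut k s)"
        by (rule continuous_on_eq) (simp add: \<psi>_def)
      have "cut k s = 0" if "s \<notin> {?e..1 - ?e}" for s
        using that by (intro cut0) auto
      then show "continuous_on (- {?e..1 - ?e}) (\<lambda>s. \<psi> s * cut k s)"
        by (intro continuous_on_eq[OF continuous_on_const[of _ 0]]) auto
    qed auto
    moreover have "{0<..<1} \<union> (- {e..1 - e}) = UNIV" if "0 < e" for e :: real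
      using that by auto
    then have "{0<..<1} \<union> (- {?e..1 - ?e}) = UNIV" by simp
    ultimately show ?thesis by simp
  qed
  have [measurable]: "\<psi> \<in> borel_measurable borel"
    unfolding \<psi>_def[abs_def] by (rule borel_measurable_on_unit_interval[OF cont])
  have [measurable]: "cut k \<in> borel_measurable borel" for k
    unfolding cut_def[abs_def] by measurable
  note h(1)[measurable]
  have cut_lim: "(\<lambda>k. \<psi> s * cut k s) \<longlonglongrightarrow> \<psi> s" for s
  proof (cases "s \<in> {0<..<1}")
    case True
    then have pos: "0 < min s (1 - s)" by auto
    have "\<forall>\<^sub>F k in sequentially. \<psi> s * cut k s = \<psi> s"
    proof (intro eventually_sequentiallyI)
      fix k assume "nat \<lceil>2 / min s (1 - s)\<rceil> \<le> k"
      then have "2 / min s (1 - s) \<le> real k" by (simp add: nat_le_iff ceiling_le_iff)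
      then have "2 \<le> real k * min s (1 - s)" using pos by (simp add: pos_divide_le_eq)
      then show "\<psi> s * cut k s = \<psi> s" by (simp add: cut_def)
    qed
    then show ?thesis by (rule tendsto_eventually)
  qed (simp add: \<psi>_def)
  have int\<psi>: "integrable \<mu> \<psi>" using int by (simp add: \<psi>_def[abs_def])
  have int\<psi>cut: "integrable \<mu> (\<lambda>s. \<psi> s * cut k s)" for k
    using int\<psi> by (rule Bochner_Integration.integrable_bound) (use \<psi>cut \<psi> in auto)
  define C where "C = (\<integral>s. \<psi> s \<partial>\<mu>)"
  define Ck where "Ck k = (\<integral>s. \<psi> s * cut k s \<partial>\<mu>)" for k
  have Ck: "0 \<le> Ck k" for k
    unfolding Ck_def using \<psi>cut by (intro integral_nonneg_AE) auto
  have Ck_lim: "Ck \<longlonglongrightarrow> C"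
    unfolding Ck_def C_def using \<psi>cut \<psi> int\<psi> cut_lim
    by (intro integral_dominated_convergence[where w=\<psi>]) auto
  have eq: "(\<integral>\<^sup>+w. h (\<Delta> 0 w) * ennreal (iprod (\<lambda>n. 1 - \<psi> (ratio n w) * cut k (ratio n w))) \<partial>P) =
    (\<integral>\<^sup>+w. h (\<Delta> 0 w) * ennreal (exp (- (\<Delta> 0 w powr - \<sigma>) * Ck k)) \<partial>P)" for k
    unfolding Ck_def
  proof (rule laplace_ratios_compact[OF cont\<psi>cut])
    show "0 \<le> \<psi> s * cut k s \<and> \<psi> s * cut k s \<le> 1" for s
      using \<psi>cut[of s k] \<psi>[of s] by auto
    let ?e = "1 / (real k + 1)"
    show "0 < ?e" by simp
    show "\<psi> s * cut k s = 0" if "1 - ?e < s" for s using that cut0[of s k] by simp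
    show "\<psi> s * cut k s = 0" if "s < ?e" for s using that cut0[of s k] by simp
  qed (simp_all add: int\<psi>cut h)
  \<comment> \<open>Multiplication by a fixed extended real preserves these limits when that number
    is finite, and the finite integral of \<open>h\<close> makes it so almost everywhere.\<close>
  have hfin: "AE w in P. h (\<Delta> 0 w) < \<top>"
    using h nn_integral_PInf_AE[of "\<lambda>w. h (\<Delta> 0 w)" P] by (auto simp: less_top)
  have "(\<lambda>k. \<integral>\<^sup>+w. h (\<Delta> 0 w) * ennreal (iprod (\<lambda>n. 1 - \<psi> (ratio n w) * cut k (ratio n w))) \<partial>P)
     \<longlonglongrightarrow> (\<integral>\<^sup>+w. h (\<Delta> 0 w) * ennreal (iprod (\<lambda>n. 1 - \<psi> (ratio n w))) \<partial>P)"
  proof (rule nn_integral_dominated_convergence[where w="\<lambda>w. h (\<Delta> 0 w)"])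
    have "1 - \<psi> s * cut k s \<le> 1" "0 \<le> 1 - \<psi> s * cut k s" "1 - \<psi> s \<le> 1 - \<psi> s * cut k s" for k s
      using \<psi>cut[of s k] \<psi>[of s] by auto
    note unit = this
    have le1: "ennreal (iprod (\<lambda>n. 1 - \<psi> (f n) * cut k (f n))) \<le> 1" for k and f :: "nat \<Rightarrow> real"
      using unit by (auto intro!: ennreal_le_1[THEN iffD2] iprod_le_1)
    show "AE w in P. h (\<Delta> 0 w) * ennreal (iprod (\<lambda>n. 1 - \<psi> (ratio n w) * cut k (ratio n w))) \<le> h (\<Delta> 0 w)" for k
      using mult_left_mono[OF le1 zero_le] by (intro AE_I2) (simp only: mult_1_right)
    show "AE w in P. (\<lambda>k. h (\<Delta> 0 w) * ennreal (iprod (\<lambda>n. 1 - \<psi> (ratio n w) * cut k (ratio n w))))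
      \<longlonglongrightarrow> h (\<Delta> 0 w) * ennreal (iprod (\<lambda>n. 1 - \<psi> (ratio n w)))"
      using hfin
    proof eventually_elim
      case (elim w)
      show ?case
        using elim unit \<psi> cut_lim
        by (intro ennreal_tendsto_cmult tendsto_ennrealI iprod_tendsto_below tendsto_diff tendsto_const) auto
    qed
  qed (use h in auto)
  moreover have "(\<lambda>k. \<integral>\<^sup>+w. h (\<Delta> 0 w) * ennreal (exp (- (\<Delta> 0 w powr - \<sigma>) * Ck k)) \<partial>P)
     \<longlonglongrightarrow> (\<integral>\<^sup>+w. h (\<Delta> 0 w) * ennreal (exp (- (\<Delta> 0 w powr - \<sigma>) * C)) \<partial>P)"
  proof (rule nn_integral_dominated_convergence[where w="\<lambda>w. h (\<Delta> 0 w)"])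
    have le1: "ennreal (exp (- (x powr - \<sigma>) * Ck k)) \<le> 1" for k x
      using Ck by (auto intro!: ennreal_le_1[THEN iffD2])
    show "AE w in P. h (\<Delta> 0 w) * ennreal (exp (- (\<Delta> 0 w powr - \<sigma>) * Ck k)) \<le> h (\<Delta> 0 w)" for k
      using mult_left_mono[OF le1 zero_le] by (intro AE_I2) (simp only: mult_1_right)
    show "AE w in P. (\<lambda>k. h (\<Delta> 0 w) * ennreal (exp (- (\<Delta> 0 w powr - \<sigma>) * Ck k)))
      \<longlonglongrightarrow> h (\<Delta> 0 w) * ennreal (exp (- (\<Delta> 0 w powr - \<sigma>) * C))"
      using hfin by eventually_elim (intro ennreal_tendsto_cmult tendsto_ennrealI tendsto_intros Ck_lim)
  qed (use h in auto)
  ultimately have "(\<integral>\<^sup>+w. h (\<Delta> 0 w) * ennreal (iprod (\<lambda>n. 1 - \<psi> (ratio n w))) \<partial>P) =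
    (\<integral>\<^sup>+w. h (\<Delta> 0 w) * ennreal (exp (- (\<Delta> 0 w powr - \<sigma>) * C)) \<partial>P)"
    unfolding eq by (rule LIMSEQ_unique)
  then show ?thesis by (simp add: \<psi>_def C_def)
qed

end

text \<open>\<open>cond_law\<close> prescribes the measures of rectangles; they are extended one
  coordinate at a time. For fixed \<open>B\<close> both sides are measures in \<open>A\<close>,
  which yields \<open>h\<close>. For fixed \<open>h\<close> the image under \<open>Y\<close> of the
  measure with density \<open>h (X w)\<close> is the mixture of the kernel, which yields
  \<open>f\<close>.\<close>

lemma cond_law_nn_integral:
  assumes law: "cond_law M S X T Y K"
    and h[measurable]: "h \<in> borel_measurable S" and f: "f \<in> borel_measurable T"
  shows "(\<integral>\<^sup>+w. h (X w) * f (Y w) \<partial>M) = (\<integral>\<^sup>+t. h t * (\<integral>\<^sup>+y. f y \<partial>K t) \<partial>distr M S X)"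
proof -
  have X[measurable]: "X \<in> M \<rightarrow>\<^sub>M S" and Y[measurable]: "Y \<in> M \<rightarrow>\<^sub>M T"
    and K: "K \<in> S \<rightarrow>\<^sub>M prob_algebra T"
    and eq: "\<And>A B. A \<in> sets S \<Longrightarrow> B \<in> sets T \<Longrightarrow>
        emeasure M {w \<in> space M. X w \<in> A \<and> Y w \<in> B} = (\<integral>\<^sup>+t\<in>A. emeasure (K t) B \<partial>distr M S X)"
    using law by (auto simp: cond_law_def)
  have K'[measurable]: "K \<in> S \<rightarrow>\<^sub>M subprob_algebra T"
    using K by (rule measurable_prob_algebraD)
  have KT: "sets (K t) = sets T" "space (K t) = space T" if "t \<in> space S" for t
    using subprob_measurableD[OF K' that] by auto
  have base: "(\<integral>\<^sup>+w. h (X w) * indicator B (Y w) \<partial>M) = (\<integral>\<^sup>+t. h t * emeasure (K t) B \<partial>distr M S X)"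
    if [measurable]: "B \<in> sets T" for B
  proof -
    let ?M1 = "distr (density M (\<lambda>w. indicator B (Y w))) S X"
    let ?M2 = "density (distr M S X) (\<lambda>t. emeasure (K t) B)"
    have [measurable]: "(\<lambda>t. emeasure (K t) B) \<in> borel_measurable S"
      by (rule measurable_emeasure_kernel[OF K']) simp
    have "?M1 = ?M2"
    proof (rule measure_eqI)
      fix A assume "A \<in> sets ?M1"
      then have A[measurable]: "A \<in> sets S" by simp
      have "emeasure ?M1 A = (\<integral>\<^sup>+w. indicator B (Y w) * indicator (X -` A \<inter> space M) w \<partial>M)"
        by (subst emeasure_distr) (auto simp: emeasure_density)
      also have "\<dots> = (\<integral>\<^sup>+w. indicator {w \<in> space M. X w \<in> A \<and> Y w \<in> B} w \<partial>M)"
        by (intro nn_integral_cong) (auto simp: indicator_def)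
      also have "\<dots> = emeasure ?M2 A"
        by (simp add: eq emeasure_density)
      finally show "emeasure ?M1 A = emeasure ?M2 A" .
    qed simp
    moreover have "(\<integral>\<^sup>+w. h (X w) * indicator B (Y w) \<partial>M) = (\<integral>\<^sup>+t. h t \<partial>?M1)"
      by (simp add: nn_integral_distr nn_integral_density mult.commute)
    moreover have "(\<integral>\<^sup>+t. h t \<partial>?M2) = (\<integral>\<^sup>+t. h t * emeasure (K t) B \<partial>distr M S X)"
      by (simp add: nn_integral_density mult.commute)
    ultimately show ?thesis by simp
  qed
  let ?J = "distr (density M (\<lambda>w. h (X w))) T Y" and ?D = "density (distr M S X) h"
  show ?thesis
  \<comment> \<open>On an empty space \<open>bind\<close> has a default value, so that case is
    treated apart.\<close>
  proof (cases "space M = {}")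
    case True
    then show ?thesis
      using f measurable_compose[OF K' nn_integral_measurable_subprob_algebra[OF f]]
      by (simp add: nn_integral_distr nn_integral_empty)
  next
    case False
    then have ne: "space ?D \<noteq> {}" using measurable_space[OF X] by auto
    have K_D: "K \<in> ?D \<rightarrow>\<^sub>M subprob_algebra T" using K' by simp
    have "?J = ?D \<bind> K"
    proof (rule measure_eqI)
      show "sets ?J = sets (?D \<bind> K)"
        using KT ne by (subst sets_bind[where N=T]) auto
      fix B assume "B \<in> sets ?J"
      then have [measurable]: "B \<in> sets T" by simp
      have "emeasure ?J B = (\<integral>\<^sup>+w. h (X w) * indicator B (Y w) \<partial>M)"
        by (subst emeasure_distr) (auto simp: emeasure_density indicator_def intro!: nn_integral_cong)
      also have "\<dots> = emeasure (?D \<bind> K) B"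
        using measurable_emeasure_kernel[OF K', of B]
        by (simp add: base emeasure_bind[OF ne K_D] nn_integral_density)
      finally show "emeasure ?J B = emeasure (?D \<bind> K) B" .
    qed
    then have "(\<integral>\<^sup>+y. f y \<partial>?J) = (\<integral>\<^sup>+t. \<integral>\<^sup>+y. f y \<partial>K t \<partial>?D)"
      using nn_integral_bind[OF f K_D] by simp
    then show ?thesis
      using f measurable_compose[OF K' nn_integral_measurable_subprob_algebra[OF f]]
      by (simp add: nn_integral_distr nn_integral_density)
  qed
qed

section \<open>The function psi and negative binomial weights\<close>

text \<open>Integration by parts: the function \<open>?K\<close> has the integrand minus a Beta
  integrand as its derivative, and the boundary term is -1.\<close>

lemma has_integral_stable_power:
  fixes \<sigma> \<kappa> :: real
  assumes "0 < \<sigma>" "\<sigma> < 1" "0 < \<kappa>"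
  shows "((\<lambda>s. \<sigma> * s powr (- 1 - \<sigma>) * (1 - (1 - s) powr \<kappa>)) has_integral \<kappa> * Beta \<kappa> (1 - \<sigma>) - 1) {0..1}"
proof -
  let ?K = "\<lambda>s. - (s powr - \<sigma>) * (1 - (1 - s) powr \<kappa>)"
  let ?g = "\<lambda>s. \<sigma> * s powr (- 1 - \<sigma>) * (1 - (1 - s) powr \<kappa>)"
  let ?b = "\<lambda>s. \<kappa> * (s powr (1 - \<sigma> - 1) * (1 - s) powr (\<kappa> - 1))"
  have "((\<lambda>s. ?g s - ?b s) has_integral ?K 1 - ?K 0) {0..1}"
  \<comment> \<open>The derivative can be unbounded at either end, so it is required inside the
    interval only, together with continuity of \<open>?K\<close> up to the ends.\<close>
  proof (rule fundamental_theorem_of_calculus_interior)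
    show "(?K has_vector_derivative ?g s - ?b s) (at s)" if "s \<in> {0<..<1}" for s
    proof -
      have "(?K has_real_derivative ?g s - ?b s) (at s)"
        using that by (auto intro!: derivative_eq_intros simp: algebra_simps minus_diff_commute)
      then show ?thesis by (simp add: has_real_derivative_iff_has_vector_derivative)
    qed
    show "continuous_on {0..1} ?K"
      unfolding continuous_on_eq_continuous_within
    proof
      fix s :: real assume s: "s \<in> {0..1}"
      show "continuous (at s within {0..1}) ?K"
      proof (cases "s = 0")
        case False
        have "continuous_on {0<..1} ?K"
          using assms by (intro continuous_on_mult continuous_on_minus continuous_on_powr' continuous_on_diff
            continuous_on_const continuous_on_id) auto
        then have "continuous (at s within {0<..1}) ?K"
          using s False by (auto simp: continuous_on_eq_continuous_within)
        moreover have "at s within {0<..1} = at s within {0..1}"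
          using s False by (intro at_within_nhd[of s "{0<..}"]) auto
        ultimately show ?thesis by simp
      next
        case True
        \<comment> \<open>Near 0, \<open>?K h\<close> is \<open>- (h powr (1 - \<sigma>))\<close>
          times a difference quotient with limit \<kappa>. It thus tends to 0, which is the value of
          \<open>?K\<close> at 0 under the convention \<open>0 powr - \<sigma> = 0\<close>.\<close>
        have "((\<lambda>s. 1 - (1 - s) powr \<kappa>) has_real_derivative \<kappa>) (at 0)"
          by (auto intro!: derivative_eq_intros)
        then have "((\<lambda>h. (1 - (1 - h) powr \<kappa>) / h) \<longlongrightarrow> \<kappa>) (at 0)"
          by (simp add: has_field_derivative_iff)
        then have "((\<lambda>h. (1 - (1 - h) powr \<kappa>) / h) \<longlongrightarrow> \<kappa>) (at 0 within {0..1})"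
          by (rule tendsto_mono[OF at_le, rotated]) simp
        moreover have "((\<lambda>h. - (h powr (1 - \<sigma>))) \<longlongrightarrow> - (0 powr (1 - \<sigma>))) (at 0 within {0..1})"
          using assms by (intro tendsto_minus tendsto_powr') (auto simp: eventually_at_topological intro!: tendsto_eq_intros)
        ultimately have "((\<lambda>h. - (h powr (1 - \<sigma>)) * ((1 - (1 - h) powr \<kappa>) / h)) \<longlongrightarrow> - (0 powr (1 - \<sigma>)) * \<kappa>) (at 0 within {0..1})"
          by (rule tendsto_mult[rotated])
        moreover have "\<forall>\<^sub>F h in at 0 within {0..1}. - (h powr (1 - \<sigma>)) * ((1 - (1 - h) powr \<kappa>) / h) = ?K h"
          unfolding eventually_at_topological
          by (intro exI[of _ UNIV]) (auto simp: powr_diff powr_minus divide_simps)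
        ultimately have "(?K \<longlongrightarrow> - (0 powr (1 - \<sigma>)) * \<kappa>) (at 0 within {0..1})"
          by (rule Lim_transform_eventually)
        then show ?thesis
          using True by (simp add: continuous_within)
      qed
    qed
  qed simp
  moreover have "(?b has_integral \<kappa> * Beta (1 - \<sigma>) \<kappa>) {0..1}"
    using assms by (intro has_integral_mult_right has_integral_Beta_real) auto
  ultimately have "((\<lambda>s. (?g s - ?b s) + ?b s) has_integral (?K 1 - ?K 0) + \<kappa> * Beta (1 - \<sigma>) \<kappa>) {0..1}"
    by (rule has_integral_add)
  then show ?thesis
    using assms by (simp add: Beta_commute)
qed

text \<open>The functional equation in the form
  \<open>Gamma (1 - \<sigma>) = - \<sigma> * Gamma (- \<sigma>)\<close> replaces the negative
  argument by a positive one; in particular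
  \<open>\<sigma> * Beta 1 (- \<sigma>) = - 1\<close>.\<close>

lemma Beta_neg_diff:
  fixes \<sigma> \<kappa> :: real
  assumes "0 < \<sigma>" "\<sigma> < 1" "0 < \<kappa>"
  shows "\<sigma> * (Beta 1 (- \<sigma>) - Beta (\<kappa> + 1) (- \<sigma>)) = \<kappa> * Beta \<kappa> (1 - \<sigma>) - 1"
proof -
  have "- \<sigma> \<notin> \<int>\<^sub>\<le>\<^sub>0"
  proof
    assume "- \<sigma> \<in> \<int>\<^sub>\<le>\<^sub>0"
    then obtain n :: nat where "- \<sigma> = - real n" by (auto elim!: nonpos_Ints_cases')
    then have "0 < real n" "real n < 1" using assms by auto
    then show False by simp
  qed
  then have G: "Gamma (1 - \<sigma>) = - \<sigma> * Gamma (- \<sigma>)"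
    using Gamma_plus1[of "- \<sigma>"] by (simp add: add.commute)
  have pos: "0 < Gamma (1 - \<sigma>)" using assms by (intro Gamma_real_pos) simp
  have "\<sigma> * Beta 1 (- \<sigma>) = \<sigma> * Gamma (- \<sigma>) / Gamma (1 - \<sigma>)"
    by (simp add: Beta_def)
  also have "\<sigma> * Gamma (- \<sigma>) = - Gamma (1 - \<sigma>)" using G by simp
  finally have 1: "\<sigma> * Beta 1 (- \<sigma>) = - 1" using pos by simp
  have "\<kappa> \<notin> \<int>\<^sub>\<le>\<^sub>0" using assms by (auto elim!: nonpos_Ints_cases')
  then have "\<sigma> * Beta (\<kappa> + 1) (- \<sigma>) = \<kappa> * Gamma \<kappa> * (\<sigma> * Gamma (- \<sigma>)) / Gamma (\<kappa> + (1 - \<sigma>))"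
    using Gamma_plus1[of \<kappa>] by (simp add: Beta_def algebra_simps)
  also have "\<sigma> * Gamma (- \<sigma>) = - Gamma (1 - \<sigma>)" using G by simp
  also have "\<kappa> * Gamma \<kappa> * - Gamma (1 - \<sigma>) / Gamma (\<kappa> + (1 - \<sigma>)) = - (\<kappa> * Beta \<kappa> (1 - \<sigma>))"
    by (simp add: Beta_def)
  finally show ?thesis using 1 by (simp add: right_diff_distrib)
qed

lemma stable_intensity_one_minus_power:
  fixes \<sigma> \<kappa> :: real
  assumes "0 < \<sigma>" "\<sigma> < 1" "0 \<le> \<kappa>"
  shows "integrable (stable_intensity \<sigma>) (\<lambda>s. indicator {0<..<1} s * (1 - (1 - s) powr \<kappa>))"
    and "(\<integral>s. indicator {0<..<1} s * (1 - (1 - s) powr \<kappa>) \<partial>stable_intensity \<sigma>)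
      = \<sigma> * (Beta 1 (- \<sigma>) - Beta (\<kappa> + 1) (- \<sigma>))"
proof -
  let ?f = "\<lambda>s :: real. indicator {0<..<1} s * (1 - (1 - s) powr \<kappa>)"
  have nonneg: "0 \<le> ?f s" for s
    using assms by (auto simp: indicator_def powr_le1)
  let ?I = "\<sigma> * (Beta 1 (- \<sigma>) - Beta (\<kappa> + 1) (- \<sigma>))"
  have nn: "0 \<le> ?I \<and> (\<integral>\<^sup>+s. ennreal (?f s) \<partial>stable_intensity \<sigma>) = ennreal ?I"
  proof (cases "\<kappa> = 0")
    \<comment> \<open>The exponent 0, outside the range of \<open>has_integral_stable_power\<close>,
      occurs for \<psi> with starting day 0.\<close>
    case True
    have f0: "?f s = 0" for s using True by (simp add: indicator_def)
    show ?thesis unfolding f0 using True by simp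
  next
    case False
    let ?g = "\<lambda>s. \<sigma> * s powr (- 1 - \<sigma>) * (1 - (1 - s) powr \<kappa>)"
    have g: "(?g has_integral ?I) {0..1}"
      using has_integral_stable_power[of \<sigma> \<kappa>] assms False by (simp add: Beta_neg_diff)
    have g_nonneg: "0 \<le> ?g s" if "s \<in> {0..1}" for s
      using that assms by (auto intro!: mult_nonneg_nonneg simp: powr_le1)
    have "0 \<le> ?I" using g g_nonneg by (rule has_integral_nonneg)
    have "(\<integral>\<^sup>+s. ennreal (?f s) \<partial>stable_intensity \<sigma>)
        = (\<integral>\<^sup>+s. ennreal (if s > 0 then \<sigma> * s powr (- 1 - \<sigma>) else 0) * ennreal (?f s) \<partial>lborel)"
      by (rule nn_integral_stable_intensity) simp
    also have "\<dots> = (\<integral>\<^sup>+s. ennreal (?g s) * indicator {0..1} s \<partial>lborel)"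
    proof (intro nn_integral_cong_AE, use AE_lborel_singleton[of 0] AE_lborel_singleton[of 1] in eventually_elim)
      case (elim s)
      then show ?case using assms
        by (auto simp: indicator_def ennreal_mult'[symmetric])
    qed
    also have "\<dots> = ennreal ?I"
      by (rule nn_integral_has_integral_lebesgue'[OF g_nonneg g])
    finally show ?thesis using \<open>0 \<le> ?I\<close> by simp
  qed
  show "integrable (stable_intensity \<sigma>) ?f"
    using nonneg nn by (intro integrableI_nonneg) auto
  show "(\<integral>s. ?f s \<partial>stable_intensity \<sigma>) = ?I"
    using nonneg nn by (subst integral_eq_nn_integral) auto
qed

text \<open>A unit of weight \<open>s\<close> has no counts in \<open>x\<close> days with
  probability \<open>(1 - s) powr (r * x)\<close>. So \<psi> integrates, against the stable
  intensity on the unit interval, the probability of being first seen in the \<open>y\<close> days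
  after the first \<open>x\<close>. The powers are completed to one minus a power because the
  intensity has infinite mass at 0.\<close>

lemma psi_eq_integral:
  assumes "0 < \<sigma>" "\<sigma> < 1" "0 \<le> r * x" "0 \<le> r * y"
  shows "integrable (stable_intensity \<sigma>) (\<lambda>s. indicator {0<..<1} s * ((1 - s) powr (r * x) - (1 - s) powr (r * (x + y))))"
    and "psi \<sigma> r x y = (\<integral>s. indicator {0<..<1} s * ((1 - s) powr (r * x) - (1 - s) powr (r * (x + y))) \<partial>stable_intensity \<sigma>)"
proof -
  let ?E = "\<lambda>\<kappa> s. indicator {0<..<1} s * (1 - (1 - s) powr \<kappa>) :: real"
  have eq: "(\<lambda>s. indicator {0<..<1} s * ((1 - s) powr (r * x) - (1 - s) powr (r * (x + y))))
      = (\<lambda>s. ?E (r * (x + y)) s - ?E (r * x) s)"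
    by (auto simp: algebra_simps)
  have nonneg: "0 \<le> r * (x + y)" using assms by (simp add: distrib_left)
  note E = stable_intensity_one_minus_power[OF assms(1,2)]
  show "integrable (stable_intensity \<sigma>) (\<lambda>s. indicator {0<..<1} s * ((1 - s) powr (r * x) - (1 - s) powr (r * (x + y))))"
    unfolding eq by (intro Bochner_Integration.integrable_diff E assms nonneg)
  show "psi \<sigma> r x y = (\<integral>s. indicator {0<..<1} s * ((1 - s) powr (r * x) - (1 - s) powr (r * (x + y))) \<partial>stable_intensity \<sigma>)"
    unfolding eq Bochner_Integration.integral_diff[OF E(1)[OF nonneg] E(1)[OF assms(3)]]
      E(2)[OF nonneg] E(2)[OF assms(3)] psi_def by (simp add: algebra_simps)
qed

lemma psi_pos:
  assumes \<sigma>: "0 < \<sigma>" "\<sigma> < 1" and "0 < r" "0 \<le> x" "0 < y"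
  shows "0 < psi \<sigma> r x y"
proof -
  let ?f = "\<lambda>s. indicator {0<..<1} s * ((1 - s) powr (r * x) - (1 - s) powr (r * (x + y)))"
  have rxy: "0 \<le> r * x" "0 \<le> r * y" using assms by auto
  have pos: "0 < ?f s" if "s \<in> {0<..<1}" for s
    using that assms by (simp add: powr_less_mono')
  then have nonneg: "0 \<le> ?f s" for s
    by (cases "s \<in> {0<..<1}") (auto simp: less_imp_le)
  have "(\<integral>s. ?f s \<partial>stable_intensity \<sigma>) \<noteq> 0"
  proof
    assume "(\<integral>s. ?f s \<partial>stable_intensity \<sigma>) = 0"
    then have "AE s in stable_intensity \<sigma>. ?f s = 0"
      using psi_eq_integral(1)[OF \<sigma> rxy] nonneg by (subst (asm) integral_nonneg_eq_0_iff_AE) auto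
    then have "AE s in lborel. 0 < ennreal (if s > 0 then \<sigma> * s powr (- 1 - \<sigma>) else 0) \<longrightarrow> ?f s = 0"
      unfolding stable_intensity_def by (subst (asm) AE_density) auto
    then have "AE s in lborel. s \<notin> {0<..<1::real}"
    proof eventually_elim
      case (elim s)
      then show ?case using pos[of s] \<sigma> by (auto split: if_splits)
    qed
    then have "emeasure lborel {0<..<1::real} = 0"
      by (subst (asm) AE_iff_measurable[of "{0<..<1}"]) (auto simp: greaterThanLessThan_def)
    then show False by simp
  qed
  moreover have "0 \<le> (\<integral>s. ?f s \<partial>stable_intensity \<sigma>)"
    using nonneg by (intro integral_nonneg_AE) auto
  ultimately show ?thesis
    using psi_eq_integral(2)[OF \<sigma> rxy] by simp
qed

lemma psi_add: "psi \<sigma> r 0 (x + y) = psi \<sigma> r 0 x + psi \<sigma> r x y"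
  by (simp add: psi_def algebra_simps)

section \<open>Negative binomial weights\<close>

lemma gchoose_nonneg:
  assumes "0 < (a :: real)"
  shows "0 \<le> (real k + a - 1 gchoose k)"
  using assms by (auto simp: gbinomial_pochhammer' intro!: divide_nonneg_pos pochhammer_nonneg)

lemma neg_bin_nonneg:
  assumes "0 < a" "0 \<le> p" "p \<le> 1"
  shows "0 \<le> neg_bin a p k"
  using assms gchoose_nonneg[of a k] by (simp add: neg_bin_def)

lemma neg_bin_0: "neg_bin a p 0 = (1 - p) powr a"
  by (simp add: neg_bin_def)

text \<open>Newton's binomial series with exponent \<open>- a\<close> at \<open>- (p * u)\<close>;
  upper negation turns its coefficients into those of \<open>neg_bin\<close>, and the two
  alternating signs cancel.\<close>

lemma neg_bin_pgf_sums:
  assumes "0 < a" "0 \<le> p" "p < 1" "0 \<le> u" "u \<le> 1"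
  shows "(\<lambda>k. neg_bin a p k * u ^ k) sums (((1 - p) / (1 - p * u)) powr a)"
proof -
  have pu: "0 \<le> p * u" "p * u \<le> p" using assms by (auto simp: mult_left_le)
  then have lt: "p * u < 1" using assms by simp
  have "(\<lambda>k. (- a gchoose k) * (- (p * u)) ^ k) sums (1 + - (p * u)) powr - a"
    using pu lt by (intro gen_binomial_real) auto
  then have "(\<lambda>k. (1 - p) powr a * ((- a gchoose k) * (- (p * u)) ^ k)) sums ((1 - p) powr a * (1 - p * u) powr - a)"
    by (intro sums_mult) simp
  moreover have "(1 - p) powr a * ((- a gchoose k) * (- (p * u)) ^ k) = neg_bin a p k * u ^ k" for k
  proof -
    have "(- a gchoose k) * (- (p * u)) ^ k = ((-1) ^ k * (-1) ^ k) * ((real k + a - 1 gchoose k) * (p * u) ^ k)"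
      by (subst power_minus) (simp add: gbinomial_minus add.commute)
    also have "(-1 :: real) ^ k * (-1) ^ k = 1" by (subst power_mult_distrib[symmetric]) simp
    finally show ?thesis by (simp add: neg_bin_def power_mult_distrib)
  qed
  moreover have "(1 - p) powr a * (1 - p * u) powr - a = ((1 - p) / (1 - p * u)) powr a"
    using assms lt by (simp add: powr_divide powr_minus_divide)
  ultimately show ?thesis by simp
qed

lemma neg_bin_sums:
  assumes "0 < a" "0 \<le> p" "p < 1"
  shows "neg_bin a p sums 1"
  using neg_bin_pgf_sums[OF assms, of 1] assms by simp

lemma neg_bin_le_1:
  assumes "0 < a" "0 \<le> p" "p < 1" "finite I"
  shows "(\<Sum>k\<in>I. neg_bin a p k) \<le> 1"
proof -
  have "(\<Sum>k\<in>I. neg_bin a p k) \<le> suminf (neg_bin a p)"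
    using assms by (intro sum_le_suminf sums_summable[OF neg_bin_sums]) (auto intro: neg_bin_nonneg)
  then show ?thesis using sums_unique[OF neg_bin_sums[OF assms(1-3)]] by simp
qed

text \<open>Size biasing: weighting by \<open>k\<close> and shifting by one turns shape
  \<open>a\<close> into shape \<open>a + 1\<close>, up to the constant
  \<open>a * (p / (1 - p))\<close>. The mean is this constant times a total mass of 1.\<close>

lemma neg_bin_mean_sums:
  assumes a: "0 < a" and p: "0 \<le> p" "p < 1"
  shows "(\<lambda>k. real k * neg_bin a p k) sums (a * (p / (1 - p)))"
proof -
  have "real (Suc k) * neg_bin a p (Suc k) = a * (p / (1 - p)) * neg_bin (a + 1) p k" for k
  proof -
    have "real (Suc k) * (real (Suc k) + a - 1 gchoose Suc k) = (a + real k) * (a + real k - 1 gchoose k)"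
      using Suc_times_gbinomial[of k "a + real k - 1"] by (simp add: algebra_simps)
    also have "\<dots> = a * (a + real k gchoose k)"
      using gbinomial_absorb_comp[of "a + real k" k] by simp
    finally have "real (Suc k) * (real (Suc k) + a - 1 gchoose Suc k) = a * (real k + (a + 1) - 1 gchoose k)"
      by (simp add: add.commute)
    then have "real (Suc k) * neg_bin a p (Suc k) = a * (real k + (a + 1) - 1 gchoose k) * p ^ Suc k * (1 - p) powr a"
      unfolding neg_bin_def by (metis (no_types, lifting) mult.assoc)
    then show ?thesis
      using p by (simp add: neg_bin_def powr_add)
  qed
  then have "(\<lambda>k. real (Suc k) * neg_bin a p (Suc k)) sums (a * (p / (1 - p)) * 1)"
    using a p by (simp only:) (intro sums_mult neg_bin_sums, auto)
  then show ?thesis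
    by (subst (asm) sums_Suc_iff) simp
qed

text \<open>The summands are the probabilities of distinct count patterns of one unit. A finite box
  around \<open>K\<close> makes their sum factor over the days.\<close>

lemma sum_PiE_prod_neg_bin_le_1:
  assumes "0 < a" "0 \<le> p" "p < 1" "finite S" "finite K" "K \<subseteq> PiE S (\<lambda>_. UNIV)"
  shows "(\<Sum>x\<in>K. \<Prod>d\<in>S. neg_bin a p (x d)) \<le> 1"
proof -
  define X where "X = (\<Union>x\<in>K. x ` S)"
  have [simp]: "finite X" using assms by (auto simp: X_def)
  have "K \<subseteq> PiE S (\<lambda>_. X)"
    using assms by (auto simp: X_def PiE_def)
  then have "(\<Sum>x\<in>K. \<Prod>d\<in>S. neg_bin a p (x d)) \<le> (\<Sum>x\<in>PiE S (\<lambda>_. X). \<Prod>d\<in>S. neg_bin a p (x d))"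
    using assms by (intro sum_mono2) (auto intro!: finite_PiE prod_nonneg neg_bin_nonneg)
  also have "\<dots> = (\<Prod>d\<in>S. \<Sum>k\<in>X. neg_bin a p k)"
    using assms by (intro prod_sum_PiE[symmetric]) auto
  also have "\<dots> \<le> 1"
    using assms by (intro prod_le_1) (auto intro!: sum_nonneg neg_bin_nonneg neg_bin_le_1)
  finally show ?thesis .
qed

lemma borel_measurable_neg_bin[measurable]:
  assumes [measurable]: "f \<in> borel_measurable M"
  shows "(\<lambda>w. neg_bin r (f w) k) \<in> borel_measurable M"
  unfolding neg_bin_def by measurable

lemma continuous_on_neg_bin: "continuous_on {0<..<1} (\<lambda>s. neg_bin r s k)"
  unfolding neg_bin_def by (intro continuous_intros) auto

section \<open>The counts given the weights and atoms\<close>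

locale nbp_model = P: stable_points P \<Delta> \<sigma> + prob_space M
  for P :: "'b measure" and \<Delta> :: "nat \<Rightarrow> 'b \<Rightarrow> real" and \<sigma> :: real and M :: "'a measure" +
  fixes \<beta> c r :: real and G :: "real \<Rightarrow> (nat \<Rightarrow> real) measure" and T :: "'a \<Rightarrow> real"
    and \<theta> \<omega> :: "nat \<Rightarrow> 'a \<Rightarrow> real" and A :: "nat \<Rightarrow> nat \<Rightarrow> 'a \<Rightarrow> nat"
  assumes pos: "0 < \<beta>" "0 < c" "0 < r"
    and ratio_law: "ratio_law P \<Delta> G"
    and SBSP: "SBSP \<beta> \<sigma> c G M T \<theta> \<omega>"
    and NBP: "NBP_counts M r \<theta> \<omega> A"
begin

lemma measurable_atom[measurable]: "\<omega> n \<in> borel_measurable M"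
  using SBSP by (auto simp: SBSP_def indep_vars_def)

lemma measurable_weights: "(\<lambda>w n. \<theta> n w) \<in> M \<rightarrow>\<^sub>M seq_space"
  using SBSP by (auto simp: SBSP_def cond_law_def)

lemma measurable_weight[measurable]: "\<theta> n \<in> borel_measurable M"
  using measurable_compose[OF measurable_weights measurable_component_singleton[of n UNIV]] by simp

lemma measurable_T[measurable]: "T \<in> borel_measurable M"
  using SBSP by (auto simp: SBSP_def cond_law_def)

lemma measurable_count[measurable]: "A d n \<in> M \<rightarrow>\<^sub>M count_space UNIV"
  using NBP by (auto simp: NBP_counts_def)

section \<open>The weights under the tilted law of the largest point\<close>

lemma borel_measurable_tilt[measurable]: "tilt \<beta> \<sigma> c \<in> borel_measurable borel"
  unfolding tilt_def[abs_def] by measurable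

abbreviation "h s \<equiv> ennreal (tilt \<beta> \<sigma> c s)"

lemma tilt_nonneg: "0 \<le> tilt \<beta> \<sigma> c s"
  using pos by (simp add: tilt_def Gamma_real_nonneg)

text \<open>\<open>ratio_law\<close> fixes \<open>G\<close> up to null sets of the law of the
  largest point. The law of \<open>T\<close> has a density with respect to that law, so
  \<open>G\<close> can be used under both.\<close>

lemma distr_T: "distr M borel T = density (distr P borel (\<Delta> 0)) (\<lambda>s. ennreal (tilt \<beta> \<sigma> c s))"
proof -
  have "distr M borel T = distr M lborel T" by (intro distr_cong) auto
  also have "\<dots> = density lborel (\<lambda>s. ennreal (tilt \<beta> \<sigma> c s * max_density \<sigma> s))"
    using SBSP by (intro distributed_distr_eq_density) (simp add: SBSP_def)
  also have "\<dots> = density lborel (\<lambda>s. ennreal (max_density \<sigma> s) * ennreal (tilt \<beta> \<sigma> c s))"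
    using tilt_nonneg by (intro density_cong AE_I2) (auto simp: ennreal_mult'' mult.commute)
  also have "\<dots> = density (distr P borel (\<Delta> 0)) (\<lambda>s. ennreal (tilt \<beta> \<sigma> c s))"
    unfolding P.distr_max by (rule density_density_eq[symmetric]) simp_all
  finally show ?thesis .
qed

text \<open>Both sides are mixtures of the laws \<open>G t\<close>. The weights behave like the
  ratios of the Poisson points after a change of measure by the tilt, and the kernel disappears from
  the later arguments.\<close>

lemma nn_integral_weights:
  assumes [measurable]: "f \<in> borel_measurable seq_space"
  shows "(\<integral>\<^sup>+w. f (\<lambda>n. \<theta> n w) \<partial>M) =
    (\<integral>\<^sup>+w. h (\<Delta> 0 w) * f (\<lambda>n. P.ratio n w) \<partial>P)"
proof -
  have "G \<in> borel \<rightarrow>\<^sub>M prob_algebra seq_space"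
    using SBSP by (auto simp: SBSP_def cond_law_def)
  then have meas: "(\<lambda>t. \<integral>\<^sup>+y. f y \<partial>G t) \<in> borel_measurable borel"
    by (intro measurable_compose[OF measurable_prob_algebraD nn_integral_measurable_subprob_algebra]) auto
  have "(\<integral>\<^sup>+w. f (\<lambda>n. \<theta> n w) \<partial>M) = (\<integral>\<^sup>+w. 1 * f (\<lambda>n. \<theta> n w) \<partial>M)" by simp
  also have "\<dots> = (\<integral>\<^sup>+t. 1 * (\<integral>\<^sup>+y. f y \<partial>G t) \<partial>distr M borel T)"
    using SBSP by (intro cond_law_nn_integral[of M borel T seq_space "\<lambda>w n. \<theta> n w" G]) (auto simp: SBSP_def)
  also have "\<dots> = (\<integral>\<^sup>+t. ennreal (tilt \<beta> \<sigma> c t) * (\<integral>\<^sup>+y. f y \<partial>G t) \<partial>distr P borel (\<Delta> 0))"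
    unfolding distr_T using meas by (subst nn_integral_density) auto
  also have "\<dots> = (\<integral>\<^sup>+w. h (\<Delta> 0 w) * f (\<lambda>n. P.ratio n w) \<partial>P)"
    using ratio_law unfolding ratio_law_def
    by (intro cond_law_nn_integral[of P borel "\<Delta> 0" seq_space "\<lambda>w n. P.ratio n w" G, symmetric]) auto
  finally show ?thesis .
qed

text \<open>The normalisation is read off from the fact that \<open>T\<close> has the tilted density
  on a probability space; no Gamma integral is evaluated.\<close>

lemma nn_integral_tilt: "(\<integral>\<^sup>+w. h (\<Delta> 0 w) \<partial>P) = 1"
  using nn_integral_weights[of "\<lambda>_. 1"] by (simp add: emeasure_space_1)

text \<open>Rescaling the maximum reduces the integral to the normalisation of the tilted density.\<close>
lemma nn_integral_tilt_exp:
  assumes "0 \<le> x"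
  shows "(\<integral>\<^sup>+w. h (\<Delta> 0 w) * ennreal (exp (- (\<Delta> 0 w powr - \<sigma>) * x)) \<partial>P)
    = ennreal ((\<beta> / (\<beta> + x)) powr (c + 1))"
proof -
  define q where "q = \<beta> / (\<beta> + x)"
  have q: "0 < q" using pos assms by (simp add: q_def)
  \<comment> \<open>The scale is chosen so that
    \<open>(l * s) powr - \<sigma> = q * s powr - \<sigma>\<close>. As
    \<open>(\<beta> + x) * q = \<beta>\<close>, the substitution turns the exponent for
    \<open>x\<close> into the exponent for 0, and the powers of \<open>l\<close> collect to
    \<open>q powr (c + 1)\<close>.\<close>
  define l where "l = q powr (- 1 / \<sigma>)"
  have l: "0 < l" using q by (simp add: l_def)
  have l\<sigma>: "l powr - \<sigma> = q" using q P.sigma by (simp add: l_def powr_powr)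
  define f where "f x s = tilt \<beta> \<sigma> c s * max_density \<sigma> s * exp (- (s powr - \<sigma>) * x)" for x s
  have [measurable]: "f x \<in> borel_measurable borel" for x
    unfolding f_def[abs_def] by measurable
  have max_nonneg: "0 \<le> max_density \<sigma> s" for s using P.sigma by (simp add: max_density_def)
  have f: "(\<integral>\<^sup>+w. h (\<Delta> 0 w) * ennreal (exp (- (\<Delta> 0 w powr - \<sigma>) * x)) \<partial>P)
      = (\<integral>\<^sup>+s. ennreal (f x s) \<partial>lborel)" for x
  proof -
    have "(\<integral>\<^sup>+w. h (\<Delta> 0 w) * ennreal (exp (- (\<Delta> 0 w powr - \<sigma>) * x)) \<partial>P)
      = (\<integral>\<^sup>+s. ennreal (tilt \<beta> \<sigma> c s) * ennreal (exp (- (s powr - \<sigma>) * x)) \<partial>distr P borel (\<Delta> 0))"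
      by (subst nn_integral_distr) auto
    also have "\<dots> = (\<integral>\<^sup>+s. ennreal (f x s) \<partial>lborel)"
      unfolding P.distr_max using tilt_nonneg max_nonneg
      by (subst nn_integral_density) (auto simp: f_def ennreal_mult[symmetric] mult_ac intro!: nn_integral_cong)
    finally show ?thesis .
  qed
  have scale: "l * f x (l * s) = q powr (c + 1) * f 0 s" for s
  proof (cases "0 < s")
    case True
    have "(\<beta> - 1) * (l * s) powr - \<sigma> + (l * s) powr - \<sigma> + (l * s) powr - \<sigma> * x = (\<beta> + x) * q * s powr - \<sigma>"
      using True l l\<sigma> by (simp add: powr_mult algebra_simps)
    also have "(\<beta> + x) * q = \<beta>" using pos assms by (simp add: q_def)
    finally have e: "- (\<beta> - 1) * (l * s) powr - \<sigma> - (l * s) powr - \<sigma> - (l * s) powr - \<sigma> * x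
        = - (\<beta> - 1) * s powr - \<sigma> - s powr - \<sigma>" by (simp add: algebra_simps)
    have p: "l * ((l * s) powr (- c * \<sigma>) * (l * s) powr (- 1 - \<sigma>)) = q powr (c + 1) * (s powr (- c * \<sigma>) * s powr (- 1 - \<sigma>))"
    proof -
      have "l * ((l * s) powr (- c * \<sigma>) * (l * s) powr (- 1 - \<sigma>)) =
          (l powr 1 * l powr (- c * \<sigma>) * l powr (- 1 - \<sigma>)) * (s powr (- c * \<sigma>) * s powr (- 1 - \<sigma>))"
        using True l by (simp add: powr_mult)
      also have "l powr 1 * l powr (- c * \<sigma>) * l powr (- 1 - \<sigma>) = l powr (- \<sigma> * (c + 1))"
        unfolding powr_add[symmetric] by (simp add: algebra_simps)
      also have "\<dots> = q powr (c + 1)" unfolding l\<sigma>[symmetric] by (simp add: powr_powr)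
      finally show ?thesis .
    qed
    define K where "K = \<beta> powr (c + 1) / Gamma (c + 1) * \<sigma>"
    have "f y t = K * (t powr (- c * \<sigma>) * t powr (- 1 - \<sigma>)) *
        exp (- (\<beta> - 1) * t powr - \<sigma> - t powr - \<sigma> - t powr - \<sigma> * y)" if "0 < t" for y t
      using that by (simp add: f_def tilt_def max_density_def K_def exp_diff exp_minus divide_inverse)
    note f_eq = this
    have "l * f x (l * s) = K * (l * ((l * s) powr (- c * \<sigma>) * (l * s) powr (- 1 - \<sigma>))) *
        exp (- (\<beta> - 1) * (l * s) powr - \<sigma> - (l * s) powr - \<sigma> - (l * s) powr - \<sigma> * x)"
      using True l by (simp only: f_eq mult_pos_pos mult_ac)
    also have "\<dots> = q powr (c + 1) * (K * (s powr (- c * \<sigma>) * s powr (- 1 - \<sigma>)) *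
        exp (- (\<beta> - 1) * s powr - \<sigma> - s powr - \<sigma>))"
      unfolding p e by (simp only: mult_ac)
    also have "\<dots> = q powr (c + 1) * f 0 s"
      using True by (simp add: f_eq)
    finally show ?thesis .
  next
    case False
    then have "\<not> 0 < l * s" using l by (simp add: zero_less_mult_iff)
    with False show ?thesis by (simp add: f_def max_density_def)
  qed
  have "(\<integral>\<^sup>+s. ennreal (f x s) \<partial>lborel) = l * (\<integral>\<^sup>+s. ennreal (f x (0 + l * s)) \<partial>lborel)"
    using l by (subst nn_integral_real_affine[where c=l and t=0]) auto
  also have "\<dots> = (\<integral>\<^sup>+s. ennreal (l * f x (l * s)) \<partial>lborel)"
    using l by (subst nn_integral_cmult[symmetric]) (auto simp: ennreal_mult' intro!: nn_integral_cong)
  also have "\<dots> = ennreal (q powr (c + 1)) * (\<integral>\<^sup>+s. ennreal (f 0 s) \<partial>lborel)"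
    unfolding scale by (subst nn_integral_cmult[symmetric]) (auto simp: ennreal_mult' intro!: nn_integral_cong)
  also have "(\<integral>\<^sup>+s. ennreal (f 0 s) \<partial>lborel) = 1"
    using nn_integral_tilt f[of 0] by simp
  finally show ?thesis unfolding f q_def by simp
qed

lemma AE_weights: "AE w in M. \<forall>n. 0 < \<theta> n w \<and> \<theta> n w < 1"
proof -
  let ?B = "{s \<in> space seq_space. \<not> (\<forall>n. 0 < s n \<and> s n < 1)}"
  have [measurable]: "?B \<in> sets seq_space" by measurable
  have "(\<integral>\<^sup>+w. indicator ?B (\<lambda>n. \<theta> n w) \<partial>M) =
      (\<integral>\<^sup>+w. h (\<Delta> 0 w) * indicator ?B (\<lambda>n. P.ratio n w) \<partial>P)"
    by (rule nn_integral_weights) simp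
  also have "\<dots> = (\<integral>\<^sup>+w. 0 \<partial>P)"
  proof (intro nn_integral_cong_AE, use P.AE_points_pos P.AE_decreasing in eventually_elim)
    case (elim w)
    then have "(\<lambda>n. P.ratio n w) \<notin> ?B" by auto
    then show ?case by simp
  qed
  finally have "(\<integral>\<^sup>+w. indicator ?B (\<lambda>n. \<theta> n w) \<partial>M) = 0" by simp
  moreover have "(\<lambda>w. indicator ?B (\<lambda>n. \<theta> n w) :: ennreal) \<in> borel_measurable M"
    using measurable_weights by measurable
  ultimately have "AE w in M. indicator ?B (\<lambda>n. \<theta> n w) = (0 :: ennreal)"
    by (subst (asm) nn_integral_0_iff_AE) auto
  then show ?thesis
    by eventually_elim (auto simp: space_PiM split: split_indicator_asm)
qed

lemma expectation_weights:
  assumes cont: "continuous_on {0<..<1} \<phi>"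
    and \<phi>: "\<And>s. 0 < s \<Longrightarrow> s < 1 \<Longrightarrow> 0 \<le> \<phi> s \<and> \<phi> s \<le> 1"
    and int: "integrable (P.\<mu>) (\<lambda>s. indicator {0<..<1} s * \<phi> s)"
  shows "expectation (\<lambda>w. iprod (\<lambda>n. 1 - indicator {0<..<1} (\<theta> n w) * \<phi> (\<theta> n w))) =
    (\<beta> / (\<beta> + (\<integral>s. indicator {0<..<1} s * \<phi> s \<partial>P.\<mu>))) powr (c + 1)"
proof -
  let ?\<phi> = "\<lambda>s. indicator {0<..<1} s * \<phi> s"
  have unit: "0 \<le> 1 - ?\<phi> s \<and> 1 - ?\<phi> s \<le> 1" for s using \<phi> by (auto simp: indicator_def)
  note borel_measurable_on_unit_interval[OF cont, measurable]
  have f: "(\<lambda>s. ennreal (iprod (\<lambda>n. 1 - ?\<phi> (s n)))) \<in> borel_measurable seq_space"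
    by measurable
  have C: "0 \<le> (\<integral>s. ?\<phi> s \<partial>P.\<mu>)"
    using \<phi> by (intro integral_nonneg_AE) (auto simp: indicator_def)
  have "(\<integral>\<^sup>+w. ennreal (iprod (\<lambda>n. 1 - ?\<phi> (\<theta> n w))) \<partial>M) =
      (\<integral>\<^sup>+w. h (\<Delta> 0 w) * ennreal (iprod (\<lambda>n. 1 - ?\<phi> (P.ratio n w))) \<partial>P)"
    by (rule nn_integral_weights[OF f])
  also have "\<dots> = (\<integral>\<^sup>+w. h (\<Delta> 0 w) *
      ennreal (exp (- (\<Delta> 0 w powr - \<sigma>) * (\<integral>s. ?\<phi> s \<partial>P.\<mu>))) \<partial>P)"
    by (rule P.laplace_ratios[OF cont \<phi> int]) (auto simp: nn_integral_tilt)
  also have "\<dots> = ennreal ((\<beta> / (\<beta> + (\<integral>s. ?\<phi> s \<partial>P.\<mu>))) powr (c + 1))"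
    by (rule nn_integral_tilt_exp[OF C])
  finally show ?thesis
    using unit by (subst integral_eq_nn_integral) (auto intro!: iprod_nonneg)
qed

section \<open>Atoms and counts: expected products over the units\<close>

abbreviation "unif \<equiv> uniform_measure lborel {0..1 :: real}"

definition weight_algebra :: "'a measure" where
  "weight_algebra = vimage_algebra (space M) (\<lambda>w. (\<lambda>n. \<theta> n w, \<lambda>n. \<omega> n w)) (seq_space \<Otimes>\<^sub>M seq_space)"

lemma measurable_atoms: "(\<lambda>w n. \<omega> n w) \<in> M \<rightarrow>\<^sub>M seq_space"
  by (rule measurable_PiM_single') auto

lemma subalgebra_weight_algebra: "subalgebra M weight_algebra"
proof -
  have "(\<lambda>w. (\<lambda>n. \<theta> n w, \<lambda>n. \<omega> n w)) \<in> M \<rightarrow>\<^sub>M seq_space \<Otimes>\<^sub>M seq_space"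
    using measurable_weights measurable_atoms by simp
  then show ?thesis
    by (auto simp: subalgebra_def weight_algebra_def sets_vimage_algebra2 space_pair_measure space_PiM
        intro: measurable_sets)
qed

lemma measurable_atom_weight_algebra: "\<omega> n \<in> borel_measurable weight_algebra"
proof -
  have "(\<lambda>w. (\<lambda>n. \<theta> n w, \<lambda>n. \<omega> n w)) \<in> weight_algebra \<rightarrow>\<^sub>M seq_space \<Otimes>\<^sub>M seq_space"
    unfolding weight_algebra_def by (rule measurable_vimage_algebra1) (auto simp: space_pair_measure space_PiM)
  from measurable_compose[OF this, of "\<lambda>z. snd z n" borel] show ?thesis by simp
qed

lemma indep_atoms_weights:
  fixes f g :: "(nat \<Rightarrow> real) \<Rightarrow> real"
  assumes [measurable]: "f \<in> borel_measurable seq_space" "g \<in> borel_measurable seq_space"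
  shows "indep_var borel (\<lambda>w. f (\<lambda>n. \<omega> n w)) borel (\<lambda>w. g (\<lambda>n. \<theta> n w))"
proof -
  let ?X = "\<lambda>w n. \<omega> n w" and ?Y = "\<lambda>w. (T w, \<lambda>n. \<theta> n w)"
  have sub: "sigma_sets (space M) {(\<lambda>w. h (X w)) -` B \<inter> space M |B. B \<in> sets borel} \<subseteq> sets (vimage_algebra (space M) X N)"
    if "h \<in> borel_measurable N" "X \<in> space M \<rightarrow> space N" for h :: "'n \<Rightarrow> real" and N X
  proof -
    have "(\<lambda>w. h (X w)) \<in> borel_measurable (vimage_algebra (space M) X N)"
      using measurable_vimage_algebra1[OF that(2)] that(1) by (rule measurable_compose)
    from measurable_sets[OF this] show ?thesis
      using sets.sigma_sets_subset[of "{(\<lambda>w. h (X w)) -` B \<inter> space M |B. B \<in> sets borel}" "vimage_algebra (space M) X N"]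
      by auto
  qed
  have "indep_set (sets (vimage_algebra (space M) ?X seq_space)) (sets (vimage_algebra (space M) ?Y (borel \<Otimes>\<^sub>M seq_space)))"
    using SBSP by (simp add: SBSP_def)
  then have "indep_set (sigma_sets (space M) {(\<lambda>w. f (?X w)) -` B \<inter> space M |B. B \<in> sets borel})
      (sigma_sets (space M) {(\<lambda>w. (g \<circ> snd) (?Y w)) -` B \<inter> space M |B. B \<in> sets borel})"
    unfolding indep_set_def
    by (rule indep_sets_mono_sets)
      (use sub[of f seq_space ?X] sub[of "g \<circ> snd" "borel \<Otimes>\<^sub>M seq_space" ?Y] in
        \<open>auto split: bool.split simp: space_PiM space_pair_measure\<close>)
  then show ?thesis
    unfolding indep_var_eq using measurable_compose[OF measurable_atoms assms(1)]
      measurable_compose[OF measurable_weights assms(2)] by (simp add: comp_def)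
qed

text \<open>The factors are kept as finite combinations of a function of the atom times the
  indicator of a count pattern, a form that covers every mark used later. By multilinearity it
  suffices to choose one summand per unit. Conditioning on weights and atoms replaces the indicators
  by \<open>neg_bin\<close> products, and the atoms are then integrated out by independence.\<close>

lemma expectation_prod_counts:
  fixes a :: "'i \<Rightarrow> real \<Rightarrow> real" and S :: "'i \<Rightarrow> nat set" and x :: "'i \<Rightarrow> nat \<Rightarrow> nat"
  assumes I: "finite I" and a[measurable]: "\<And>i. i \<in> I \<Longrightarrow> a i \<in> borel_measurable borel"
    and bound: "\<And>i y. i \<in> I \<Longrightarrow> \<bar>a i y\<bar> \<le> 1" and S: "\<And>i. i \<in> I \<Longrightarrow> finite (S i)"
  shows "expectation (\<lambda>w. \<Prod>n<m. \<Sum>i\<in>I. a i (\<omega> n w) * of_bool (\<forall>d\<in>S i. A d n w = x i d)) =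
    expectation (\<lambda>w. \<Prod>n<m. \<Sum>i\<in>I. (\<integral>y. a i y \<partial>unif) *
      (\<Prod>d\<in>S i. neg_bin r (\<theta> n w) (x i d)))"
    (is "?lhs = ?rhs")
proof -
  interpret W: finite_measure_subalgebra M weight_algebra
    by standard (rule subalgebra_weight_algebra)
  define Q where "Q k w = (\<Prod>n<m. \<Prod>d\<in>S (k n). neg_bin r (\<theta> n w) (x (k n) d))" for k :: "nat \<Rightarrow> 'i" and w
  define H where "H k w = (\<Prod>n<m. a (k n) (\<omega> n w))" for k :: "nat \<Rightarrow> 'i" and w
  \<comment> \<open>A choice of one summand for each of the first \<open>m\<close> units.\<close>
  define \<K> where "\<K> = PiE {..<m} (\<lambda>_. I)"
  have fin\<K>: "finite \<K>" unfolding \<K>_def using I by (intro finite_PiE) auto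
  have kI: "k n \<in> I" if "k \<in> \<K>" "n < m" for k n using that by (auto simp: \<K>_def)
  have [measurable]: "Q k \<in> borel_measurable M" for k
    unfolding Q_def[abs_def] by measurable
  have H_meas[measurable]: "H k \<in> borel_measurable M" if "k \<in> \<K>" for k
    unfolding H_def[abs_def] using kI[OF that]
    by (intro borel_measurable_prod measurable_compose[OF measurable_atom a]) auto
  have H_bound: "\<bar>H k w\<bar> \<le> 1" if "k \<in> \<K>" for k w
    unfolding H_def abs_prod using kI[OF that] bound by (intro prod_le_1) auto
  have Q_bound: "AE w in M. \<bar>Q k w\<bar> \<le> 1" for k
    using AE_weights
  proof eventually_elim
    case (elim w)
    have "0 \<le> neg_bin r (\<theta> n w) j" "neg_bin r (\<theta> n w) j \<le> 1" for n j
      using elim[rule_format, of n] pos neg_bin_nonneg[of r "\<theta> n w" j] neg_bin_le_1[of r "\<theta> n w" "{j}"] by auto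
    then show ?case
      unfolding Q_def abs_prod by (intro prod_le_1) (auto intro!: prod_le_1 prod_nonneg)
  qed
  have Q_int: "integrable M (Q k)" for k
    using Q_bound by (intro integrable_const_bound[where B=1]) auto
  have H_int: "integrable M (H k)" if "k \<in> \<K>" for k
    using H_bound[OF that] that by (intro integrable_const_bound[where B=1]) auto
  have H_exp: "expectation (H k) = (\<Prod>n<m. \<integral>y. a (k n) y \<partial>unif)" if k: "k \<in> \<K>" for k
  proof -
    have "indep_vars (\<lambda>_. borel) \<omega> UNIV" using SBSP by (simp add: SBSP_def)
    then have "indep_vars (\<lambda>_. borel) \<omega> {..<m}" by (rule indep_vars_subset) simp
    from indep_vars_compose2[OF this, of "\<lambda>n. a (k n)" "\<lambda>_. borel"]
    have indep: "indep_vars (\<lambda>_. borel) (\<lambda>n w. a (k n) (\<omega> n w)) {..<m}"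
      using kI[OF k] by simp
    have "integrable M (\<lambda>w. a (k n) (\<omega> n w))" if "n < m" for n
      using bound kI[OF k that] by (intro integrable_const_bound[where B=1]) auto
    then have "expectation (H k) = (\<Prod>n<m. expectation (\<lambda>w. a (k n) (\<omega> n w)))"
      unfolding H_def using indep by (intro indep_vars_lebesgue_integral) auto
    also have "\<dots> = (\<Prod>n<m. \<integral>y. a (k n) y \<partial>unif)"
    proof (intro prod.cong refl)
      fix n assume "n \<in> {..<m}"
      then have [measurable]: "a (k n) \<in> borel_measurable borel" using kI[OF k] by simp
      have "unif = distr M borel (\<omega> n)"
        using SBSP by (simp add: SBSP_def)
      then show "expectation (\<lambda>w. a (k n) (\<omega> n w)) = (\<integral>y. a (k n) y \<partial>unif)"
        by (simp add: integral_distr)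
    qed
    finally show ?thesis .
  qed
  have counts: "expectation (\<lambda>w. H k w * of_bool (\<forall>n<m. \<forall>d\<in>S (k n). A d n w = x (k n) d)) =
      (\<Prod>n<m. \<integral>y. a (k n) y \<partial>unif) * expectation (Q k)" if k: "k \<in> \<K>" for k
  proof -
    \<comment> \<open>All constraints imposed by the choice \<open>k\<close>, with the coordinates
      swapped to the order day, unit that \<open>NBP_counts\<close> uses.\<close>
    define F where "F = (\<lambda>(n, d). (d, n)) ` Sigma {..<m} (\<lambda>n. S (k n))"
    have finF: "finite F" unfolding F_def using S kI[OF k] by (intro finite_imageI finite_SigmaI) auto
    define E where "E = {w \<in> space M. \<forall>(d, n)\<in>F. A d n w = (\<lambda>d n. x (k n) d) d n}"
    have [measurable]: "E \<in> sets M" unfolding E_def using finF by measurable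
    have cond: "AE w in M. real_cond_exp M weight_algebra (indicator E) w =
        (\<Prod>(d, n)\<in>F. neg_bin r (\<theta> n w) ((\<lambda>d n. x (k n) d) d n))"
      unfolding weight_algebra_def E_def
      by (rule NBP[unfolded NBP_counts_def, THEN conjunct2, THEN spec, THEN spec, THEN mp, OF finF])
    have prodF: "(\<Prod>(d, n)\<in>F. neg_bin r (\<theta> n w) ((\<lambda>d n. x (k n) d) d n)) = Q k w" for w
    proof -
      have "(\<Prod>(d, n)\<in>F. neg_bin r (\<theta> n w) ((\<lambda>d n. x (k n) d) d n)) =
          (\<Prod>(n, d)\<in>Sigma {..<m} (\<lambda>n. S (k n)). neg_bin r (\<theta> n w) (x (k n) d))"
        unfolding F_def by (subst prod.reindex) (auto simp: inj_on_def intro!: prod.cong)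
      also have "\<dots> = Q k w"
        unfolding Q_def using S kI[OF k] by (subst prod.Sigma) auto
      finally show ?thesis .
    qed
    have "expectation (\<lambda>w. H k w * of_bool (\<forall>n<m. \<forall>d\<in>S (k n). A d n w = x (k n) d)) =
        expectation (\<lambda>w. H k w * indicator E w)"
      by (intro Bochner_Integration.integral_cong) (auto simp: E_def F_def indicator_def)
    \<comment> \<open>\<open>H k\<close> depends on the atoms only and is thus measurable for
      \<open>weight_algebra\<close>, so the indicator may be replaced by its conditional
      probability.\<close>
    also have "\<dots> = expectation (\<lambda>w. H k w * real_cond_exp M weight_algebra (indicator E) w)"
    proof (rule W.real_cond_exp_intg(2)[symmetric])
      show "integrable M (\<lambda>w. H k w * indicator E w)"
        using H_bound[OF k] k by (intro integrable_const_bound[where B=1]) (auto simp: indicator_def)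
      show "H k \<in> borel_measurable weight_algebra"
        unfolding H_def[abs_def] using kI[OF k]
        by (intro borel_measurable_prod measurable_compose[OF measurable_atom_weight_algebra a]) auto
    qed simp
    also have "\<dots> = expectation (\<lambda>w. H k w * Q k w)"
      using cond k by (intro integral_cong_AE) (auto elim!: eventually_mono simp: prodF)
    also have "\<dots> = expectation (H k) * expectation (Q k)"
    proof (rule indep_var_lebesgue_integral[OF _ H_int[OF k] Q_int])
      have "(\<lambda>y. \<Prod>n<m. a (k n) (y n)) \<in> borel_measurable seq_space"
      proof (intro borel_measurable_prod)
        fix n assume "n \<in> {..<m}"
        then have [measurable]: "a (k n) \<in> borel_measurable borel" using kI[OF k] by simp
        show "(\<lambda>y. a (k n) (y n)) \<in> borel_measurable seq_space" by measurable
      qed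
      moreover have "(\<lambda>s. \<Prod>n<m. \<Prod>d\<in>S (k n). neg_bin r (s n) (x (k n) d)) \<in> borel_measurable seq_space"
        by measurable
      ultimately show "indep_var borel (H k) borel (Q k)"
        unfolding H_def[abs_def] Q_def[abs_def] by (rule indep_atoms_weights)
    qed
    finally show ?thesis unfolding H_exp[OF k] .
  qed
  have expand: "(\<Prod>n<m. \<Sum>i\<in>I. u i n * v i n) = (\<Sum>k\<in>\<K>. (\<Prod>n<m. u (k n) n) * (\<Prod>n<m. v (k n) n))"
    for u v :: "'i \<Rightarrow> nat \<Rightarrow> real"
    unfolding \<K>_def using I by (subst prod_sum_PiE) (simp_all add: prod.distrib)
  have of_bool_prod: "(\<Prod>n<m. of_bool (R n)) = (of_bool (\<forall>n<m. R n) :: real)" for R :: "nat \<Rightarrow> bool"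
    by (induction m) (auto simp: less_Suc_eq)
  have "?lhs = expectation (\<lambda>w. \<Sum>k\<in>\<K>. H k w * of_bool (\<forall>n<m. \<forall>d\<in>S (k n). A d n w = x (k n) d))"
    unfolding expand of_bool_prod H_def ..
  also have "\<dots> = (\<Sum>k\<in>\<K>. expectation (\<lambda>w. H k w * of_bool (\<forall>n<m. \<forall>d\<in>S (k n). A d n w = x (k n) d)))"
  proof (rule Bochner_Integration.integral_sum)
    fix k assume k: "k \<in> \<K>"
    have [measurable]: "{w \<in> space M. \<forall>n<m. \<forall>d\<in>S (k n). A d n w = x (k n) d} \<in> sets M"
    proof -
      have "{w \<in> space M. \<forall>d\<in>S (k n). A d n w = x (k n) d} \<in> sets M" if "n < m" for n
        using S[OF kI[OF k that]] by measurable
      then have "{w \<in> space M. \<forall>n\<in>{..<m}. \<forall>d\<in>S (k n). A d n w = x (k n) d} \<in> sets M"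
        using S kI[OF k] by (intro sets.sets_Collect_finite_All) auto
      then show ?thesis by (simp only: Ball_def lessThan_iff)
    qed
    have "(\<lambda>w. of_bool (\<forall>n<m. \<forall>d\<in>S (k n). A d n w = x (k n) d) :: real) \<in> borel_measurable M"
      by measurable
    then show "integrable M (\<lambda>w. H k w * of_bool (\<forall>n<m. \<forall>d\<in>S (k n). A d n w = x (k n) d))"
      using H_bound[OF k] k by (intro integrable_const_bound[where B=1]) auto
  qed
  also have "\<dots> = (\<Sum>k\<in>\<K>. expectation (\<lambda>w. (\<Prod>n<m. \<integral>y. a (k n) y \<partial>unif) * Q k w))"
    by (intro sum.cong refl) (simp add: counts)
  also have "\<dots> = expectation (\<lambda>w. \<Sum>k\<in>\<K>. (\<Prod>n<m. \<integral>y. a (k n) y \<partial>unif) * Q k w)"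
    by (rule Bochner_Integration.integral_sum[symmetric]) (intro integrable_mult_right Q_int)
  also have "\<dots> = ?rhs"
    unfolding expand Q_def ..
  finally show ?thesis .
qed

text \<open>After the counts and atoms have been averaged out, a unit of weight \<open>s\<close>
  contributes the factor \<open>1 - \<phi> s\<close>. Finite products are compared first, and both
  sides pass to the limit under the bound 1, which reduces the claim to
  \<open>expectation_weights\<close>.\<close>

lemma expectation_iprod_counts:
  fixes a :: "'i \<Rightarrow> real \<Rightarrow> real" and S :: "'i \<Rightarrow> nat set" and x :: "'i \<Rightarrow> nat \<Rightarrow> nat"
  assumes I: "finite I" and a: "\<And>i. i \<in> I \<Longrightarrow> a i \<in> borel_measurable borel"
    and bound: "\<And>i y. i \<in> I \<Longrightarrow> \<bar>a i y\<bar> \<le> 1" and S: "\<And>i. i \<in> I \<Longrightarrow> finite (S i)"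
    and g: "\<And>n w. g n w = (\<Sum>i\<in>I. a i (\<omega> n w) * of_bool (\<forall>d\<in>S i. A d n w = x i d))"
    and g_unit: "\<And>n w. 0 \<le> g n w \<and> g n w \<le> 1"
    and \<phi>: "\<And>s. \<phi> s = 1 - (\<Sum>i\<in>I. (\<integral>y. a i y \<partial>unif) * (\<Prod>d\<in>S i. neg_bin r s (x i d)))"
    and \<phi>_unit: "\<And>s. 0 < s \<Longrightarrow> s < 1 \<Longrightarrow> 0 \<le> \<phi> s \<and> \<phi> s \<le> 1"
    and int: "integrable (P.\<mu>) (\<lambda>s. indicator {0<..<1} s * \<phi> s)"
  shows "expectation (\<lambda>w. iprod (\<lambda>n. g n w)) =
    (\<beta> / (\<beta> + (\<integral>s. indicator {0<..<1} s * \<phi> s \<partial>P.\<mu>))) powr (c + 1)"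
proof -
  have cont: "continuous_on {0<..<1} \<phi>"
    unfolding \<phi> by (intro continuous_intros continuous_on_neg_bin)
  have [measurable]: "\<phi> \<in> borel_measurable borel"
    unfolding \<phi>[abs_def] by measurable
  have g_meas[measurable]: "g n \<in> borel_measurable M" for n
  proof -
    have "(\<lambda>w. of_bool (\<forall>d\<in>S i. A d n w = x i d) :: real) \<in> borel_measurable M" if "i \<in> I" for i
    proof -
      have [measurable]: "{w \<in> space M. \<forall>d\<in>S i. A d n w = x i d} \<in> sets M"
        using S[OF that] by measurable
      show ?thesis by measurable
    qed
    then show ?thesis
      unfolding g[abs_def]
      by (intro borel_measurable_sum borel_measurable_times measurable_compose[OF measurable_atom a])
  qed
  \<comment> \<open>The bounds on \<phi> hold on the open unit interval only. The indicator extends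
    them to every outcome and changes nothing almost surely, by \<open>AE_weights\<close>.\<close>
  define f where "f n w = 1 - indicator {0<..<1} (\<theta> n w) * \<phi> (\<theta> n w)" for n w
  have [measurable]: "f n \<in> borel_measurable M" for n
    unfolding f_def[abs_def] by measurable
  have f_unit: "0 \<le> f n w \<and> f n w \<le> 1" for n w
    using \<phi>_unit by (auto simp: f_def indicator_def)
  have eq: "expectation (\<lambda>w. \<Prod>n<m. g n w) = expectation (\<lambda>w. \<Prod>n<m. f n w)" for m
  proof -
    have "expectation (\<lambda>w. \<Prod>n<m. g n w) = expectation (\<lambda>w. \<Prod>n<m. 1 - \<phi> (\<theta> n w))"
      unfolding g \<phi> by (subst expectation_prod_counts[OF I a bound S]) simp_all
    also have "\<dots> = expectation (\<lambda>w. \<Prod>n<m. f n w)"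
      using AE_weights by (intro integral_cong_AE) (auto elim!: eventually_mono simp: f_def)
    finally show ?thesis .
  qed
  have lim: "(\<lambda>m. expectation (\<lambda>w. \<Prod>n<m. h n w)) \<longlonglongrightarrow> expectation (\<lambda>w. iprod (\<lambda>n. h n w))"
    if [measurable]: "\<And>n. h n \<in> borel_measurable M" and h: "\<And>n w. 0 \<le> h n w \<and> h n w \<le> 1"
    for h :: "nat \<Rightarrow> 'a \<Rightarrow> real"
  proof (rule integral_dominated_convergence[where w="\<lambda>_. 1"])
    show "AE w in M. (\<lambda>m. \<Prod>n<m. h n w) \<longlonglongrightarrow> iprod (\<lambda>n. h n w)"
      using h by (intro AE_I2 iprod_LIMSEQ)
    show "AE w in M. norm (\<Prod>n<m. h n w) \<le> 1" for m
      using prod_unit_interval[of "{..<m}" "\<lambda>n. h n _"] h by (intro AE_I2) simp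
  qed auto
  have "expectation (\<lambda>w. iprod (\<lambda>n. g n w)) = expectation (\<lambda>w. iprod (\<lambda>n. f n w))"
    using lim[of g, OF g_meas g_unit] lim[of f] f_unit unfolding eq by (auto intro: LIMSEQ_unique)
  also have "\<dots> = (\<beta> / (\<beta> + (\<integral>s. indicator {0<..<1} s * \<phi> s \<partial>P.\<mu>))) powr (c + 1)"
    unfolding f_def by (rule expectation_weights[OF cont \<phi>_unit int])
  finally show ?thesis .
qed

end

section \<open>Marks of the units and their expected product\<close>

context nbp_model
begin

definition seen :: "nat \<Rightarrow> nat \<Rightarrow> 'a \<Rightarrow> bool" where
  "seen D n w \<longleftrightarrow> (\<exists>d<D. A d n w \<noteq> 0)"

text \<open>The pairs \<open>(K, B)\<close> encode the sets \<open>{(b, x). b \<in> K \<and> x \<in> B b}\<close> of marked points.\<close>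
definition hit :: "nat \<Rightarrow> (nat \<Rightarrow> nat) set \<Rightarrow> ((nat \<Rightarrow> nat) \<Rightarrow> real set) \<Rightarrow> nat \<Rightarrow> 'a \<Rightarrow> bool" where
  "hit D K B n w \<longleftrightarrow> (\<exists>b\<in>K. (\<forall>d<D. A d n w = b d) \<and> \<omega> n w \<in> B b)"

text \<open>\<open>PiE\<close> makes each count vector a unique function. The zero vector is left
  out because units with it leave no trace in the data.\<close>

definition patterns :: "nat \<Rightarrow> (nat \<Rightarrow> nat) set" where
  "patterns D = {b \<in> PiE {..<D} (\<lambda>_. UNIV). \<exists>d<D. b d \<noteq> 0}"

text \<open>\<open>q = 1\<close> gives the factor for counting new units, \<open>u = 1\<close> the
  one for weighting observed units. Both come from one function so that a region contributes the
  same constant to either expectation.\<close>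

definition mark :: "nat \<Rightarrow> nat \<Rightarrow> (nat \<Rightarrow> nat) set \<Rightarrow> ((nat \<Rightarrow> nat) \<Rightarrow> real set) \<Rightarrow> real \<Rightarrow> real \<Rightarrow> nat \<Rightarrow> 'a \<Rightarrow> real" where
  "mark D0 D1 K B u q n w =
    (if seen D0 n w then if hit D0 K B n w then 0 else q
     else if seen (D0 + D1) n w then u else 1)"

lemma hit_imp_seen:
  assumes "K \<subseteq> patterns D" "hit D K B n w"
  shows "seen D n w"
proof -
  obtain b where b: "b \<in> K" "\<forall>d<D. A d n w = b d" using assms(2) unfolding hit_def by blast
  then obtain d where "d < D" "b d \<noteq> 0" using assms(1) by (auto simp: patterns_def)
  with b(2) show ?thesis unfolding seen_def by auto
qed

text \<open>\<kappa> integrates the probability that a unit falls into the region against the stable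
  intensity. It is obtained before \<open>u\<close> and \<open>q\<close> are chosen, since two
  different choices are to be compared with the same \<kappa>.\<close>

lemma expectation_mark:
  assumes K: "finite K" "K \<subseteq> patterns D0" and B: "\<And>b. b \<in> K \<Longrightarrow> B b \<in> sets borel"
  obtains \<kappa> where "0 \<le> \<kappa>" "K = {} \<Longrightarrow> \<kappa> = 0"
    "\<And>u q. 0 \<le> u \<Longrightarrow> u \<le> 1 \<Longrightarrow> 0 \<le> q \<Longrightarrow> q \<le> 1 \<Longrightarrow>
      expectation (\<lambda>w. iprod (\<lambda>n. mark D0 D1 K B u q n w)) =
      (\<beta> / (\<beta> + ((1 - u) * psi \<sigma> r (real D0) (real D1) + (1 - q) * psi \<sigma> r 0 (real D0) + q * \<kappa>))) powr (c + 1)"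
proof -
  interpret U: prob_space unif by (rule prob_space_uniform_measure) auto
  \<comment> \<open>The probability that a unit of weight \<open>s\<close> with a uniform atom is
    hit.\<close>
  define V where "V s = (\<Sum>b\<in>K. measure unif (B b) * (\<Prod>d<D0. neg_bin r s (b d)))" for s
  define f0 where "f0 s = indicator {0<..<1} s * ((1 - s) powr (r * 0) - (1 - s) powr (r * (0 + real D0)))" for s :: real
  define f1 where "f1 s = indicator {0<..<1} s * ((1 - s) powr (r * real D0) - (1 - s) powr (r * (real D0 + real D1)))" for s :: real
  have int0: "integrable (P.\<mu>) f0" "(\<integral>s. f0 s \<partial>P.\<mu>) = psi \<sigma> r 0 (real D0)"
    unfolding f0_def using psi_eq_integral[OF P.sigma, of r 0 "real D0"] pos by auto
  have int1: "integrable (P.\<mu>) f1" "(\<integral>s. f1 s \<partial>P.\<mu>) = psi \<sigma> r (real D0) (real D1)"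
    unfolding f1_def using psi_eq_integral[OF P.sigma, of r "real D0" "real D1"] pos by auto
  have zeros: "(\<Prod>d<D. neg_bin r s 0) = (1 - s) powr (r * real D)" if "s < 1" for s D
    using that by (simp add: neg_bin_0 powr_powr[symmetric] powr_realpow)
  have V: "0 \<le> V s" "V s \<le> 1 - (1 - s) powr (r * real D0)" if s: "0 < s" "s < 1" for s
  proof -
    have nb: "0 \<le> (\<Prod>d<D0. neg_bin r s (b d))" for b
      using s pos by (intro prod_nonneg) (auto intro: neg_bin_nonneg)
    show "0 \<le> V s" unfolding V_def using nb by (intro sum_nonneg mult_nonneg_nonneg) auto
    \<comment> \<open>Adjoining the zero pattern to \<open>K\<close> improves the bound 1 to the
      probability of being seen, which is the integrand of
      \<open>psi \<sigma> r 0 (real D0)\<close>. This makes \<open>V\<close> integrable near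
      0.\<close>
    let ?z = "\<lambda>d\<in>{..<D0}. 0 :: nat"
    have z: "?z \<notin> K" using K by (auto simp: patterns_def)
    have "(\<Sum>b\<in>insert ?z K. \<Prod>d<D0. neg_bin r s (b d)) \<le> 1"
      using K s pos by (intro sum_PiE_prod_neg_bin_le_1) (auto simp: patterns_def)
    then have "(\<Prod>d<D0. neg_bin r s 0) + (\<Sum>b\<in>K. \<Prod>d<D0. neg_bin r s (b d)) \<le> 1"
      using K z by simp
    moreover have "V s \<le> (\<Sum>b\<in>K. \<Prod>d<D0. neg_bin r s (b d))"
      unfolding V_def using nb by (intro sum_mono) (simp add: mult_left_le_one_le)
    ultimately show "V s \<le> 1 - (1 - s) powr (r * real D0)"
      using zeros[OF s(2)] by simp
  qed
  have [measurable]: "V \<in> borel_measurable borel" unfolding V_def[abs_def] by measurable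
  have intV: "integrable (P.\<mu>) (\<lambda>s. indicator {0<..<1} s * V s)"
  proof (rule Bochner_Integration.integrable_bound[OF int0(1)])
    have "norm (indicator {0<..<1} s * V s) \<le> norm (f0 s)" for s
      using V[of s] by (auto simp: indicator_def f0_def)
    then show "AE s in P.\<mu>. norm (indicator {0<..<1} s * V s) \<le> norm (f0 s)" by simp
  qed measurable
  define \<kappa> where "\<kappa> = (\<integral>s. indicator {0<..<1} s * V s \<partial>P.\<mu>)"
  have "0 \<le> \<kappa>" unfolding \<kappa>_def using V by (intro integral_nonneg_AE) (auto simp: indicator_def)
  moreover have "\<kappa> = 0" if "K = {}"
    using that by (simp add: \<kappa>_def V_def)
  moreover have "expectation (\<lambda>w. iprod (\<lambda>n. mark D0 D1 K B u q n w)) =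
      (\<beta> / (\<beta> + ((1 - u) * psi \<sigma> r (real D0) (real D1) + (1 - q) * psi \<sigma> r 0 (real D0) + q * \<kappa>))) powr (c + 1)"
    if u: "0 \<le> u" "u \<le> 1" and q: "0 \<le> q" "q \<le> 1" for u q
  proof -
    \<comment> \<open>The mark is written as \<open>q\<close>, plus \<open>u - q\<close> if unseen
      in \<open>D0\<close> days, plus \<open>1 - u\<close> if unseen in \<open>D0 + D1\<close> days,
      minus \<open>q\<close> for the one pattern of \<open>K\<close> by which the unit is hit, if
      any.\<close>
    let ?I = "K <+> {0, 1, 2 :: nat}"
    define a :: "(nat \<Rightarrow> nat) + nat \<Rightarrow> real \<Rightarrow> real" where
      "a = case_sum (\<lambda>b y. - q * indicator (B b) y) (\<lambda>j y. if j = 0 then 1 - u else if j = 1 then u - q else q)"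
    define S :: "(nat \<Rightarrow> nat) + nat \<Rightarrow> nat set" where
      "S = case_sum (\<lambda>_. {..<D0}) (\<lambda>j. if j = 0 then {..<D0 + D1} else if j = 1 then {..<D0} else {})"
    define x :: "(nat \<Rightarrow> nat) + nat \<Rightarrow> nat \<Rightarrow> nat" where
      "x = case_sum (\<lambda>b. b) (\<lambda>_ _. 0)"
    have sum_I: "(\<Sum>i\<in>?I. h i) = (\<Sum>b\<in>K. h (Inl b)) + (h (Inr 0) + h (Inr 1) + h (Inr 2))" for h :: "_ \<Rightarrow> real"
      using K(1) by (simp add: sum.Plus)
    define \<phi> where "\<phi> s = 1 - (\<Sum>i\<in>?I. (\<integral>y. a i y \<partial>unif) * (\<Prod>d\<in>S i. neg_bin r s (x i d)))" for s
    have int_a: "(\<integral>y. a (Inl b) y \<partial>unif) = - q * measure unif (B b)" if "b \<in> K" for b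
      using B[OF that] by (simp add: a_def)
    have \<phi>: "\<phi> s = (1 - u) * ((1 - s) powr (r * real D0) - (1 - s) powr (r * (real D0 + real D1)))
        + (1 - q) * (1 - (1 - s) powr (r * real D0)) + q * V s" if s: "0 < s" "s < 1" for s
    proof -
      have "(\<Sum>b\<in>K. (\<integral>y. a (Inl b) y \<partial>unif) * (\<Prod>d<D0. neg_bin r s (b d))) = - q * V s"
        unfolding V_def sum_distrib_left by (intro sum.cong refl) (simp add: int_a)
      moreover have "(\<Prod>d<D0 + D1. neg_bin r s 0) = (1 - s) powr (r * (real D0 + real D1))"
        using zeros[OF s(2), of "D0 + D1"] by simp
      ultimately show ?thesis
        unfolding \<phi>_def sum_I using zeros[OF s(2), of D0]
        by (simp add: S_def x_def, simp add: a_def U.prob_space[simplified] algebra_simps)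
    qed
    have ind\<phi>: "indicator {0<..<1} s * \<phi> s = (1 - u) * f1 s + (1 - q) * f0 s + q * (indicator {0<..<1} s * V s)" for s
      by (auto simp: indicator_def f0_def f1_def \<phi>)
    have "expectation (\<lambda>w. iprod (\<lambda>n. mark D0 D1 K B u q n w)) =
      (\<beta> / (\<beta> + (\<integral>s. indicator {0<..<1} s * \<phi> s \<partial>P.\<mu>))) powr (c + 1)"
    proof (rule expectation_iprod_counts[where I="?I" and a=a and S=S and x=x])
      show "finite ?I" using K by simp
      show "a i \<in> borel_measurable borel" if "i \<in> ?I" for i
        using that B by (auto simp: a_def)
      show "\<bar>a i y\<bar> \<le> 1" if "i \<in> ?I" for i y
        using that u q by (auto simp: a_def indicator_def)
      show "finite (S i)" if "i \<in> ?I" for i using that by (auto simp: S_def)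
      show "\<phi> s = 1 - (\<Sum>i\<in>?I. (\<integral>y. a i y \<partial>unif) * (\<Prod>d\<in>S i. neg_bin r s (x i d)))" for s
        by (rule \<phi>_def)
      show "0 \<le> mark D0 D1 K B u q n w \<and> mark D0 D1 K B u q n w \<le> 1" for n w
        using u q by (simp add: mark_def)
      show "0 \<le> \<phi> s \<and> \<phi> s \<le> 1" if s: "0 < s" "s < 1" for s
      proof -
        define y0 y1 where "y0 = (1 - s) powr (r * real D0)" and "y1 = (1 - s) powr (r * (real D0 + real D1))"
        have y: "0 \<le> y1" "y1 \<le> y0" "y0 \<le> 1"
          unfolding y0_def y1_def using s pos by (auto simp: powr_le1 intro!: powr_mono')
        have e: "\<phi> s = (1 - u) * (y0 - y1) + (1 - q) * (1 - y0) + q * V s"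
          using \<phi>[OF s] by (simp add: y0_def y1_def)
        have v: "0 \<le> V s" "V s \<le> 1 - y0" using V[OF s] by (auto simp: y0_def)
        have "(1 - u) * (y0 - y1) \<le> 1 * (y0 - y1)" using u y by (intro mult_right_mono) auto
        moreover have "q * V s \<le> q * (1 - y0)" using q v by (intro mult_left_mono) auto
        ultimately have "\<phi> s \<le> 1" using y unfolding e by (simp add: algebra_simps)
        moreover have "0 \<le> \<phi> s"
          unfolding e using u q y v by (intro add_nonneg_nonneg mult_nonneg_nonneg) auto
        ultimately show ?thesis by simp
      qed
      show "integrable (P.\<mu>) (\<lambda>s. indicator {0<..<1} s * \<phi> s)"
        unfolding ind\<phi> using int0 int1 intV by simp
      fix n w
      \<comment> \<open>The actual pattern of unit \<open>n\<close>. By extensionality no other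
        member of \<open>K\<close> can match it, so the sum over \<open>K\<close> has at most one
        nonzero term.\<close>
      define b0 where "b0 = restrict (\<lambda>d. A d n w) {..<D0}"
      have b0: "(\<forall>d<D0. A d n w = b d) \<longleftrightarrow> b = b0" if "b \<in> K" for b
      proof -
        have "b \<in> extensional {..<D0}" using that K by (auto simp: patterns_def PiE_def)
        then show ?thesis by (auto simp: b0_def extensional_def fun_eq_iff)
      qed
      have "(\<Sum>b\<in>K. a (Inl b) (\<omega> n w) * of_bool (\<forall>d\<in>S (Inl b). A d n w = x (Inl b) d))
          = (\<Sum>b\<in>K. if b = b0 then - q * indicator (B b) (\<omega> n w) else 0)"
      proof (intro sum.cong refl)
        fix b assume "b \<in> K"
        then show "a (Inl b) (\<omega> n w) * of_bool (\<forall>d\<in>S (Inl b). A d n w = x (Inl b) d)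
            = (if b = b0 then - q * indicator (B b) (\<omega> n w) else 0)"
          using b0[OF \<open>b \<in> K\<close>] by (auto simp: a_def S_def x_def)
      qed
      also have "\<dots> = - q * of_bool (hit D0 K B n w)"
      proof -
        have "hit D0 K B n w \<longleftrightarrow> b0 \<in> K \<and> \<omega> n w \<in> B b0"
          unfolding hit_def using b0 by blast
        then show ?thesis using K(1) by (simp add: indicator_def)
      qed
      finally have sum_hit: "(\<Sum>b\<in>K. a (Inl b) (\<omega> n w) * of_bool (\<forall>d\<in>S (Inl b). A d n w = x (Inl b) d))
          = - q * of_bool (hit D0 K B n w)" .
      note 1 = hit_imp_seen[OF K(2)]
      have 2: "seen D0 n w \<Longrightarrow> seen (D0 + D1) n w"
        unfolding seen_def by (meson trans_less_add1)
      have 3: "of_bool (\<forall>d\<in>S (Inr 0). A d n w = x (Inr 0) d) = (of_bool (\<not> seen (D0 + D1) n w) :: real)"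
        "of_bool (\<forall>d\<in>S (Inr 1). A d n w = x (Inr 1) d) = (of_bool (\<not> seen D0 n w) :: real)"
        "of_bool (\<forall>d\<in>S (Inr 2). A d n w = x (Inr 2) d) = (1 :: real)"
        by (auto simp: S_def x_def seen_def)
      have 4: "a (Inr 0) y = 1 - u" "a (Inr 1) y = u - q" "a (Inr 2) y = q" for y
        by (simp_all add: a_def)
      show "mark D0 D1 K B u q n w = (\<Sum>i\<in>?I. a i (\<omega> n w) * of_bool (\<forall>d\<in>S i. A d n w = x i d))"
        unfolding sum_I sum_hit 3 4 using 1 2 by (auto simp: mark_def)
    qed
    also have "(\<integral>s. indicator {0<..<1} s * \<phi> s \<partial>P.\<mu>) =
        (1 - u) * psi \<sigma> r (real D0) (real D1) + (1 - q) * psi \<sigma> r 0 (real D0) + q * \<kappa>"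
      unfolding ind\<phi> using int0 int1 intV by (simp add: \<kappa>_def)
    finally show ?thesis .
  qed
  ultimately show thesis by (rule that)
qed

end

section \<open>Void events and the data\<close>

text \<open>The number of the dyadic interval of length \<open>2 ^ m\<close> inverse that contains
  \<open>x\<close>, encoded in the naturals so that sums over cells are ordinary series.\<close>

definition cell :: "nat \<Rightarrow> real \<Rightarrow> nat" where
  "cell m x = int_encode \<lfloor>x * 2 ^ m\<rfloor>"

lemma measurable_cell[measurable]: "cell m \<in> borel \<rightarrow>\<^sub>M count_space UNIV"
  unfolding cell_def[abs_def] by measurable

lemma borel_cell[measurable]: "{x. cell m x = k} \<in> sets borel"
  by measurable

lemma inj_on_cell:
  assumes "finite S"
  shows "\<exists>m. inj_on (cell m) S"
proof -
  have ev: "\<forall>\<^sub>F m in sequentially. x \<noteq> y \<longrightarrow> cell m x \<noteq> cell m y" for x y :: real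
  proof (cases "x = y")
    case False
    then obtain M where "1 / \<bar>x - y\<bar> < 2 ^ M"
      using real_arch_pow[of 2 "1 / \<bar>x - y\<bar>"] by auto
    then have M: "1 < \<bar>x - y\<bar> * 2 ^ M" using False by (simp add: field_simps)
    show ?thesis
    proof (intro eventually_sequentiallyI impI)
      fix m assume "M \<le> m"
      then have "\<bar>x - y\<bar> * 2 ^ M \<le> \<bar>x - y\<bar> * 2 ^ m" by (intro mult_left_mono power_increasing) auto
      with M have "1 < \<bar>x * 2 ^ m - y * 2 ^ m\<bar>"
        by (simp add: left_diff_distrib[symmetric] abs_mult)
      then show "cell m x \<noteq> cell m y" unfolding cell_def by (auto simp: int_encode_eq) linarith
    qed
  qed simp
  have "\<forall>\<^sub>F m in sequentially. \<forall>x\<in>S. \<forall>y\<in>S. x \<noteq> y \<longrightarrow> cell m x \<noteq> cell m y"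
    by (intro eventually_ball_finite ballI assms ev)
  then show ?thesis unfolding eventually_sequentially inj_on_def by blast
qed

text \<open>Counts are reduced to occurrences: a set occupies at most as many cells as it has
  points, and fine enough cells separate any finite subset. Infinite sets are covered through their
  finite subsets.\<close>

lemma card_eq_SUP_cells:
  "emeasure (count_space UNIV) S = (SUP m. \<Sum>k. of_bool (\<exists>x\<in>S. cell m x = k) :: ennreal)"
proof -
  have count: "(\<Sum>k. of_bool (\<exists>x\<in>S. cell m x = k) :: ennreal) = emeasure (count_space UNIV) (cell m ` S)" for m
  proof -
    have "(\<Sum>k. of_bool (\<exists>x\<in>S. cell m x = k) :: ennreal) = (\<Sum>k. indicator (cell m ` S) k)"
      by (intro suminf_cong) (auto simp: indicator_def)
    then show ?thesis by (simp add: suminf_indicator_card emeasure_count_space)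
  qed
  have lower: "of_nat (card F) \<le> (SUP m. emeasure (count_space UNIV) (cell m ` S))" if F: "finite F" "F \<subseteq> S" for F
  proof -
    obtain m where "inj_on (cell m) F" using inj_on_cell[OF F(1)] by blast
    then have "of_nat (card F) = emeasure (count_space UNIV) (cell m ` F)"
      using F by (simp add: card_image)
    also have "\<dots> \<le> emeasure (count_space UNIV) (cell m ` S)"
      using F by (intro emeasure_mono) auto
    finally show ?thesis by (rule order_trans) (rule SUP_upper, simp)
  qed
  show ?thesis
    unfolding count
  proof (rule antisym)
    show "emeasure (count_space UNIV) S \<le> (SUP m. emeasure (count_space UNIV) (cell m ` S))"
    proof (cases "finite S")
      case True
      then show ?thesis using lower[of S] by simp
    next
      case False
      have "of_nat k \<le> (SUP m. emeasure (count_space UNIV) (cell m ` S))" for k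
        using infinite_arbitrarily_large[OF False, of k] lower by auto
      then have "(SUP k. of_nat k) \<le> (SUP m. emeasure (count_space UNIV) (cell m ` S))"
        by (rule SUP_least)
      then show ?thesis
        unfolding ennreal_SUP_of_nat_eq_top by (rule order_trans[OF top_greatest])
    qed
    show "(SUP m. emeasure (count_space UNIV) (cell m ` S)) \<le> emeasure (count_space UNIV) S"
    proof (rule SUP_least)
      fix m
      show "emeasure (count_space UNIV) (cell m ` S) \<le> emeasure (count_space UNIV) S"
        by (cases "finite S") (auto simp: emeasure_count_space card_image_le)
    qed
  qed
qed

lemma suminf_swap_ennreal:
  fixes f :: "nat \<Rightarrow> nat \<Rightarrow> ennreal"
  shows "(\<Sum>i. \<Sum>j. f i j) = (\<Sum>j. \<Sum>i. f i j)"
proof -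
  have "(\<Sum>i. \<Sum>j. f i j) = (\<integral>\<^sup>+i. (\<Sum>j. f i j) \<partial>count_space UNIV)"
    by (rule nn_integral_count_space_nat[symmetric])
  also have "\<dots> = (\<Sum>j. \<integral>\<^sup>+i. f i j \<partial>count_space UNIV)"
    by (rule nn_integral_suminf) simp
  finally show ?thesis by (simp only: nn_integral_count_space_nat)
qed

lemma suminf_ennreal_pos_iff:
  fixes f :: "nat \<Rightarrow> ennreal"
  shows "0 < (\<Sum>n. f n) \<longleftrightarrow> (\<exists>n. 0 < f n)"
proof -
  have "(\<Sum>n. f n) = 0 \<longleftrightarrow> (\<forall>n. f n = 0)"
    unfolding nn_integral_count_space_nat[symmetric]
    by (subst nn_integral_0_iff_AE) (auto simp: AE_count_space)
  then show ?thesis by (auto simp: zero_less_iff_neq_zero)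
qed

lemma emeasure_atomic_pos_iff:
  assumes "B \<in> sets borel"
  shows "0 < emeasure (atomic_measure a x) B \<longleftrightarrow> (\<exists>n. 0 < a n \<and> x n \<in> B)"
  unfolding emeasure_atomic_measure[OF assms] suminf_ennreal_pos_iff
  by (auto simp: indicator_def split: if_splits)

text \<open>A multiplicity is the number of levels \<open>j\<close> below it. Each level is a plain
  set of atoms, whose cardinality \<open>card_eq_SUP_cells\<close> expresses through occurrences;
  injectivity keeps distinct units distinct as points.\<close>

lemma emeasure_atomic_layers:
  assumes "B \<in> sets borel" "inj x"
  shows "emeasure (atomic_measure a x) B = (\<Sum>j. emeasure (count_space UNIV) (x ` {n. j < a n \<and> x n \<in> B}))"
proof -
  have layer: "(of_nat k :: ennreal) * of_bool R = (\<Sum>j. of_bool (j < k \<and> R))" for k R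
  proof -
    have "(\<Sum>j. of_bool (j < k \<and> R) :: ennreal) = (\<Sum>j<k. of_bool (j < k \<and> R))"
      by (intro suminf_finite) auto
    then show ?thesis by simp
  qed
  have "emeasure (atomic_measure a x) B = (\<Sum>n. of_nat (a n) * of_bool (x n \<in> B))"
    using assms(1) by (simp add: emeasure_atomic_measure indicator_def)
  also have "\<dots> = (\<Sum>j. \<Sum>n. of_bool (j < a n \<and> x n \<in> B))"
    unfolding layer by (rule suminf_swap_ennreal)
  also have "\<dots> = (\<Sum>j. \<Sum>n. indicator {n. j < a n \<and> x n \<in> B} n)"
    by (intro suminf_cong) (simp add: indicator_def)
  also have "\<dots> = (\<Sum>j. emeasure (count_space UNIV) (x ` {n. j < a n \<and> x n \<in> B}))"
  proof (intro suminf_cong)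
    fix j
    have inj: "inj_on x {n. j < a n \<and> x n \<in> B}" using assms(2) by (rule inj_on_subset) simp
    then show "(\<Sum>n. indicator {n. j < a n \<and> x n \<in> B} n :: ennreal) =
        emeasure (count_space UNIV) (x ` {n. j < a n \<and> x n \<in> B})"
      by (simp add: suminf_indicator_card emeasure_count_space card_image finite_image_iff)
  qed
  finally show ?thesis .
qed

context nbp_model
begin

text \<open>The uniform law has no atoms, so the diagonal is null for the product law of two
  independent positions.\<close>

lemma AE_inj_atoms: "AE w in M. inj (\<lambda>n. \<omega> n w)"
proof -
  have "AE w in M. \<omega> i w \<noteq> \<omega> j w" if "i \<noteq> j" for i j
  proof -
    have "indep_vars (\<lambda>_. borel) \<omega> UNIV" using SBSP by (simp add: SBSP_def)
    from indep_var_compose[OF indep_var_restrict[OF this, of "{i}" "{j}"], of "\<lambda>f. f i" borel "\<lambda>f. f j" borel]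
    have "indep_var borel (\<omega> i) borel (\<omega> j)"
      using that by (simp add: comp_def)
    then have eq: "distr M borel (\<omega> i) \<Otimes>\<^sub>M distr M borel (\<omega> j) = distr M (borel \<Otimes>\<^sub>M borel) (\<lambda>w. (\<omega> i w, \<omega> j w))"
      by (simp add: indep_var_distribution_eq)
    interpret J: prob_space "distr M borel (\<omega> j)" by (rule prob_space_distr) simp
    have "{z :: real \<times> real. fst z = snd z} \<in> sets borel"
      by (intro borel_closed closed_Collect_eq continuous_intros)
    then have diag[measurable]: "{z :: real \<times> real. fst z = snd z} \<in> sets (borel \<Otimes>\<^sub>M borel)"
      by (simp only: borel_prod)
    have "emeasure (distr M borel (\<omega> i) \<Otimes>\<^sub>M distr M borel (\<omega> j)) {z. fst z = snd z} =
        (\<integral>\<^sup>+y. emeasure (distr M borel (\<omega> j)) (Pair y -` {z. fst z = snd z}) \<partial>distr M borel (\<omega> i))"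
      by (rule J.emeasure_pair_measure_alt) simp
    also have "\<dots> = 0"
    proof (intro nn_integral_zero' AE_I2)
      fix y :: real
      have "Pair y -` {z. fst z = snd z} = {y}" by auto
      moreover have "distr M borel (\<omega> j) = unif" using SBSP by (simp add: SBSP_def)
      moreover have "emeasure lborel ({0..1} \<inter> {y}) = 0"
        by (rule emeasure_eq_0[where N="{y}"]) auto
      ultimately show "emeasure (distr M borel (\<omega> j)) (Pair y -` {z. fst z = snd z}) = 0"
        by (simp add: emeasure_uniform_measure)
    qed
    finally have "emeasure M ((\<lambda>w. (\<omega> i w, \<omega> j w)) -` {z. fst z = snd z} \<inter> space M) = 0"
      unfolding eq by (subst (asm) emeasure_distr) auto
    moreover have "(\<lambda>w. (\<omega> i w, \<omega> j w)) -` {z. fst z = snd z} \<inter> space M = {w \<in> space M. \<not> \<omega> i w \<noteq> \<omega> j w}"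
      by auto
    ultimately show ?thesis by (subst AE_iff_measurable[OF _ refl]) auto
  qed
  then have "AE w in M. \<forall>i j. i \<noteq> j \<longrightarrow> \<omega> i w \<noteq> \<omega> j w"
    by (auto simp: AE_all_countable)
  then show ?thesis by eventually_elim (auto simp: inj_def)
qed

text \<open>This counts labels, while \<open>observed_units\<close> collects positions. The label
  version fits products over \<open>n\<close>; the two agree almost surely, when the atoms are
  distinct.\<close>

definition observed_count :: "nat \<Rightarrow> 'a \<Rightarrow> ennreal" where
  "observed_count D w = (\<Sum>n. of_bool (seen D n w))"

lemma measurable_seen[measurable]: "Measurable.pred M (seen D n)"
proof -
  show ?thesis unfolding seen_def[abs_def] by measurable
qed

lemma measurable_hit[measurable]:
  assumes "finite K" "\<And>b. b \<in> K \<Longrightarrow> B b \<in> sets borel"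
  shows "Measurable.pred M (hit D K B n)"
proof -
  have "Measurable.pred M (\<lambda>w. (\<forall>d<D. A d n w = b d) \<and> \<omega> n w \<in> B b)" if "b \<in> K" for b
  proof -
    note assms(2)[OF that, measurable]
    show ?thesis by measurable
  qed
  then show ?thesis
    unfolding hit_def[abs_def] using assms(1) by (intro pred_intros_finite(4))
qed

lemma measurable_observed_count[measurable]: "observed_count D \<in> borel_measurable M"
proof -
  show ?thesis unfolding observed_count_def[abs_def] by measurable
qed

lemma new_units_eq: "new_units A D0 D1 w = (\<Sum>n. of_bool (\<not> seen D0 n w \<and> seen (D0 + D1) n w))"
proof -
  have 1: "seen (D0 + D1) n w \<longleftrightarrow> seen D0 n w \<or> (\<exists>d<D1. A (D0 + d) n w \<noteq> 0)" for n
  proof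
    assume "seen (D0 + D1) n w"
    then obtain d where d: "d < D0 + D1" "A d n w \<noteq> 0" by (auto simp: seen_def)
    show "seen D0 n w \<or> (\<exists>d<D1. A (D0 + d) n w \<noteq> 0)"
    proof (cases "d < D0")
      case False
      then have "d - D0 < D1" "A (D0 + (d - D0)) n w \<noteq> 0" using d by auto
      then show ?thesis by blast
    qed (use d in \<open>auto simp: seen_def\<close>)
  next
    assume "seen D0 n w \<or> (\<exists>d<D1. A (D0 + d) n w \<noteq> 0)"
    then show "seen (D0 + D1) n w" unfolding seen_def by (meson add_less_cancel_left trans_less_add1)
  qed
  have 2: "((\<Sum>d<D0. A d n w) = 0) \<longleftrightarrow> \<not> seen D0 n w" for n by (auto simp: seen_def)
  have 3: "((\<Sum>d<D1. A (D0 + d) n w) > 0) \<longleftrightarrow> (\<exists>d<D1. A (D0 + d) n w \<noteq> 0)" for n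
    by (subst neq0_conv[symmetric]) auto
  show ?thesis
    unfolding new_units_def 1 2 3 by (intro suminf_cong) auto
qed

lemma measurable_new_units[measurable]: "new_units A D0 D1 \<in> borel_measurable M"
proof -
  show ?thesis unfolding new_units_eq[abs_def] by measurable
qed

lemma ennreal_power_suminf:
  assumes "0 \<le> z" "z < 1"
  shows "ennreal_power z (\<Sum>n. of_bool (Q n)) = iprod (\<lambda>n. if Q n then z else 1)"
proof -
  have "(\<Sum>n. of_bool (Q n) :: ennreal) = (\<Sum>n. indicator {n. Q n} n)"
    by (intro suminf_cong) (simp add: indicator_def)
  then show ?thesis
    using assms by (simp add: suminf_indicator_card iprod_power)
qed

lemma iprod_mark_future:
  assumes "0 \<le> u" "u < 1" "K \<subseteq> patterns D0"
  shows "iprod (\<lambda>n. mark D0 D1 K B u 1 n w) =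
    of_bool (\<forall>n. \<not> hit D0 K B n w) * ennreal_power u (new_units A D0 D1 w)"
proof -
  have "iprod (\<lambda>n. mark D0 D1 K B u 1 n w) =
      iprod (\<lambda>n. of_bool (\<not> hit D0 K B n w) * (if \<not> seen D0 n w \<and> seen (D0 + D1) n w then u else 1))"
    using hit_imp_seen[OF assms(3)] by (intro arg_cong[where f=iprod] ext) (auto simp: mark_def)
  also have "\<dots> = of_bool (\<forall>n. \<not> hit D0 K B n w) * ennreal_power u (new_units A D0 D1 w)"
    using assms by (subst iprod_mult) (auto simp: iprod_of_bool new_units_eq ennreal_power_suminf)
  finally show ?thesis .
qed

lemma iprod_mark_past:
  assumes "0 \<le> q" "q < 1" "K \<subseteq> patterns D0"
  shows "iprod (\<lambda>n. mark D0 D1 K B 1 q n w) =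
    of_bool (\<forall>n. \<not> hit D0 K B n w) * ennreal_power q (observed_count D0 w)"
proof -
  have "iprod (\<lambda>n. mark D0 D1 K B 1 q n w) =
      iprod (\<lambda>n. of_bool (\<not> hit D0 K B n w) * (if seen D0 n w then q else 1))"
    using hit_imp_seen[OF assms(3)] by (intro arg_cong[where f=iprod] ext) (auto simp: mark_def)
  also have "\<dots> = of_bool (\<forall>n. \<not> hit D0 K B n w) * ennreal_power q (observed_count D0 w)"
    using assms by (subst iprod_mult) (auto simp: iprod_of_bool observed_count_def ennreal_power_suminf)
  finally show ?thesis .
qed

text \<open>For the empty region and \<open>u = 1\<close>, \<open>expectation_mark\<close> gives the
  expectation of \<open>q\<close> to the number of observed units. It tends to 1 as \<open>q\<close>
  tends to 1, while these powers never exceed the indicator of a finite number.\<close>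

lemma AE_observed_count_finite: "AE w in M. observed_count D w \<noteq> \<top>"
proof -
  let ?fin = "{w \<in> space M. observed_count D w \<noteq> \<top>}"
  let ?\<psi> = "psi \<sigma> r 0 (real D)"
  let ?e = "\<lambda>k. inverse (real (Suc k))"
  obtain \<kappa> where "{} = ({} :: (nat \<Rightarrow> nat) set) \<Longrightarrow> \<kappa> = 0" and
    \<kappa>: "\<And>u q. 0 \<le> u \<Longrightarrow> u \<le> 1 \<Longrightarrow> 0 \<le> q \<Longrightarrow> q \<le> 1 \<Longrightarrow>
      expectation (\<lambda>w. iprod (\<lambda>n. mark D 0 {} (\<lambda>_. {}) u q n w)) =
      (\<beta> / (\<beta> + ((1 - u) * psi \<sigma> r (real D) (real 0) + (1 - q) * ?\<psi> + q * \<kappa>))) powr (c + 1)"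
    by (rule expectation_mark[where K="{}" and ?D0.0=D and ?D1.0=0 and B="\<lambda>_. {}"]) auto
  then have \<kappa>0: "\<kappa> = 0" by simp
  have lower: "(\<beta> / (\<beta> + ?e k * ?\<psi>)) powr (c + 1) \<le> prob ?fin" for k
  proof -
    have q: "0 \<le> 1 - ?e k" "1 - ?e k < 1" "1 - ?e k \<le> 1" by (auto simp: divide_simps)
    have "(\<beta> / (\<beta> + ?e k * ?\<psi>)) powr (c + 1) = expectation (\<lambda>w. ennreal_power (1 - ?e k) (observed_count D w))"
      using \<kappa>[of 1 "1 - ?e k"] q unfolding iprod_mark_past[OF q(1,2) empty_subsetI] by (simp add: \<kappa>0 hit_def)
    also have "\<dots> \<le> expectation (indicator ?fin)"
      using q by (intro integral_mono) (auto intro!: integrable_const_bound[where B=1]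
          simp: ennreal_power_def indicator_def power_le_one)
    finally show ?thesis by simp
  qed
  have "(\<lambda>k. (\<beta> / (\<beta> + ?e k * ?\<psi>)) powr (c + 1)) \<longlonglongrightarrow> (\<beta> / (\<beta> + 0 * ?\<psi>)) powr (c + 1)"
    using pos by (intro tendsto_intros LIMSEQ_inverse_real_of_nat) auto
  then have "(\<beta> / (\<beta> + 0 * ?\<psi>)) powr (c + 1) \<le> prob ?fin"
    using lower by (intro LIMSEQ_le_const2) auto
  then have "prob ?fin = 1" using pos by (simp add: antisym)
  then show ?thesis by (subst (asm) prob_Collect_eq_1) auto
qed

section \<open>The sigma-algebra generated by the void events\<close>

abbreviation "data_upto D \<equiv> data_algebra M (Z_process \<omega> A) D"

definition void :: "nat \<Rightarrow> (nat \<Rightarrow> nat) set \<Rightarrow> ((nat \<Rightarrow> nat) \<Rightarrow> real set) \<Rightarrow> 'a set" where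
  "void D K B = {w \<in> space M. \<forall>n. \<not> hit D K B n w}"

text \<open>Null sets are included because the atoms are only almost surely distinct.\<close>
definition void_sets :: "nat \<Rightarrow> 'a set set" where
  "void_sets D = {E \<in> sets M. \<exists>K B. finite K \<and> K \<subseteq> patterns D \<and> (\<forall>b\<in>K. B b \<in> sets borel) \<and>
     (AE w in M. w \<in> E \<longleftrightarrow> w \<in> void D K B)}"

lemma void_in_sets:
  assumes "finite K" "\<forall>b\<in>K. B b \<in> sets borel"
  shows "void D K B \<in> sets M"
proof -
  have [measurable]: "Measurable.pred M (hit D K B n)" for n
    using assms by (intro measurable_hit) auto
  show ?thesis unfolding void_def by measurable
qed

lemma void_in_void_sets:
  assumes "finite K" "K \<subseteq> patterns D" "\<forall>b\<in>K. B b \<in> sets borel"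
  shows "void D K B \<in> void_sets D"
  unfolding void_sets_def using assms void_in_sets[OF assms(1,3)] by auto

lemma void_setsE:
  assumes "E \<in> void_sets D"
  obtains K B where "E \<in> sets M" "finite K" "K \<subseteq> patterns D" "\<forall>b\<in>K. B b \<in> sets borel"
    "AE w in M. w \<in> E \<longleftrightarrow> w \<in> void D K B"
  using assms unfolding void_sets_def by (elim CollectE conjE exE) (rule that)

lemma Int_stable_void_sets: "Int_stable (void_sets D)"
proof (rule Int_stableI)
  fix E1 E2 assume "E1 \<in> void_sets D" "E2 \<in> void_sets D"
  then obtain K1 B1 K2 B2 where 1: "E1 \<in> sets M" "finite K1" "K1 \<subseteq> patterns D"
      "\<forall>b\<in>K1. B1 b \<in> sets borel" "AE w in M. w \<in> E1 \<longleftrightarrow> w \<in> void D K1 B1"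
    and 2: "E2 \<in> sets M" "finite K2" "K2 \<subseteq> patterns D"
      "\<forall>b\<in>K2. B2 b \<in> sets borel" "AE w in M. w \<in> E2 \<longleftrightarrow> w \<in> void D K2 B2"
    by (elim void_setsE)
  \<comment> \<open>\<open>B1\<close> and \<open>B2\<close> are arbitrary outside \<open>K1\<close>
    and \<open>K2\<close>. The case distinctions prevent the combined region from containing more
    than the union of the two.\<close>
  define B where "B b = (if b \<in> K1 then B1 b else {}) \<union> (if b \<in> K2 then B2 b else {})" for b
  have hit: "hit D (K1 \<union> K2) B n w \<longleftrightarrow> hit D K1 B1 n w \<or> hit D K2 B2 n w" for n w
    unfolding hit_def B_def by auto
  have "AE w in M. w \<in> E1 \<inter> E2 \<longleftrightarrow> w \<in> void D (K1 \<union> K2) B"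
    using 1(5) 2(5) by eventually_elim (auto simp: void_def hit)
  moreover have "\<forall>b\<in>K1 \<union> K2. B b \<in> sets borel" using 1 2 by (auto simp: B_def)
  ultimately show "E1 \<inter> E2 \<in> void_sets D"
    unfolding void_sets_def using 1(1-4) 2(1-4) by (intro CollectI conjI exI[of _ "K1 \<union> K2"] exI[of _ B]) auto
qed

abbreviation void_algebra :: "nat \<Rightarrow> 'a measure" where
  "void_algebra D \<equiv> sigma (space M) (void_sets D)"

lemma void_sets_subset: "void_sets D \<subseteq> Pow (space M)"
  using sets.sets_into_space by (auto simp: void_sets_def)

lemma sets_void_algebra: "sets (void_algebra D) = sigma_sets (space M) (void_sets D)"
  by (rule sets_measure_of[OF void_sets_subset])

lemma space_void_algebra[simp]: "space (void_algebra D) = space M"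
  by (rule space_measure_of[OF void_sets_subset])

text \<open>The complement of a null set agrees almost surely with the void event of the empty
  region, which is the whole space.\<close>

lemma null_sets_void_algebra:
  assumes "N \<in> null_sets M"
  shows "N \<in> sets (void_algebra D)"
proof -
  have N: "AE w in M. w \<notin> N" using assms by (rule AE_not_in)
  have "AE w in M. w \<in> space M - N \<longleftrightarrow> w \<in> void D {} (\<lambda>_. {})"
    using N AE_space by eventually_elim (auto simp: void_def hit_def)
  then have "space M - N \<in> void_sets D"
    unfolding void_sets_def using assms by (intro CollectI conjI exI[of _ "{}"] exI[of _ "\<lambda>_. {}"]) auto
  then have "space M - N \<in> sets (void_algebra D)" unfolding sets_void_algebra by (rule sigma_sets.Basic)
  then have "space M - (space M - N) \<in> sets (void_algebra D)"
    using sets.compl_sets[of "space M - N" "void_algebra D"] by simp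
  moreover have "space M - (space M - N) = N" using assms sets.sets_into_space by blast
  ultimately show ?thesis by simp
qed

lemma measurable_void_algebra_AE:
  fixes f g :: "'a \<Rightarrow> ennreal"
  assumes g: "g \<in> borel_measurable (void_algebra D)" and f[measurable]: "f \<in> borel_measurable M"
    and gM: "g \<in> borel_measurable M" and eq: "AE w in M. f w = g w"
  shows "f \<in> borel_measurable (void_algebra D)"
proof (rule measurableI)
  note gM[measurable]
  fix S :: "ennreal set" assume S[measurable]: "S \<in> sets borel"
  let ?f = "f -` S \<inter> space M" and ?g = "g -` S \<inter> space M"
  have [measurable]: "?f \<in> sets M" "?g \<in> sets M" by measurable
  have "AE w in M. w \<notin> ?f - ?g" "AE w in M. w \<notin> ?g - ?f"
    using eq by (eventually_elim, simp)+
  then have null: "?f - ?g \<in> null_sets M" "?g - ?f \<in> null_sets M"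
    by (subst AE_iff_null_sets; simp)+
  have "?g \<in> sets (void_algebra D)" using measurable_sets[OF g S] by simp
  then have "?g - (?g - ?f) \<union> (?f - ?g) \<in> sets (void_algebra D)"
    by (rule sets.Un[OF sets.Diff[OF _ null_sets_void_algebra[OF null(2)]] null_sets_void_algebra[OF null(1)]])
  moreover have "?g - (?g - ?f) \<union> (?f - ?g) = ?f" by auto
  ultimately show "f -` S \<inter> space (void_algebra D) \<in> sets (void_algebra D)"
    by simp
qed simp

text \<open>The pattern sets of void events are finite, whereas this event leaves the counts
  unbounded. So the counts are truncated at \<open>X\<close>, and the complements of the resulting
  void events are united over \<open>X\<close>.\<close>

lemma occurrence_in_void_algebra:
  assumes d: "d < D" and B: "B \<in> sets borel"
  shows "{w \<in> space M. \<exists>n. j < A d n w \<and> \<omega> n w \<in> B} \<in> sets (void_algebra D)"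
proof -
  define K where "K X = {b \<in> PiE {..<D} (\<lambda>_. {..X}). j < b d}" for X :: nat
  have fin: "finite (K X)" for X
    unfolding K_def by (rule finite_subset[OF _ finite_PiE[of "{..<D}" "\<lambda>_. {..X}"]]) auto
  have sub: "K X \<subseteq> patterns D" for X
  proof
    fix b assume b: "b \<in> K X"
    then have "b \<in> PiE {..<D} (\<lambda>_. UNIV)" by (auto simp: K_def PiE_def)
    moreover have "b d \<noteq> 0" using b by (simp add: K_def)
    ultimately show "b \<in> patterns D" using d unfolding patterns_def by blast
  qed
  have void: "void D (K X) (\<lambda>_. B) \<in> sets (void_algebra D)" for X
    unfolding sets_void_algebra using fin sub B by (intro sigma_sets.Basic void_in_void_sets) auto
  have hit: "(\<exists>X. hit D (K X) (\<lambda>_. B) n w) \<longleftrightarrow> j < A d n w \<and> \<omega> n w \<in> B" for n w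
  proof
    assume "\<exists>X. hit D (K X) (\<lambda>_. B) n w"
    then show "j < A d n w \<and> \<omega> n w \<in> B" using d by (auto simp: hit_def K_def)
  next
    assume *: "j < A d n w \<and> \<omega> n w \<in> B"
    \<comment> \<open>The total count of the unit bounds its count on every day.\<close>
    define X where "X = (\<Sum>e<D. A e n w)"
    have "A e n w \<le> X" if "e < D" for e
      unfolding X_def using that by (intro member_le_sum) auto
    then have "restrict (\<lambda>e. A e n w) {..<D} \<in> K X" using * d by (auto simp: K_def)
    then have "hit D (K X) (\<lambda>_. B) n w"
      unfolding hit_def using * by (intro bexI[of _ "restrict (\<lambda>e. A e n w) {..<D}"]) auto
    then show "\<exists>X. hit D (K X) (\<lambda>_. B) n w" ..
  qed
  have "{w \<in> space M. \<exists>n. j < A d n w \<and> \<omega> n w \<in> B} = (\<Union>X. space M - void D (K X) (\<lambda>_. B))"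
    unfolding hit[symmetric] void_def by auto
  also have "\<dots> \<in> sets (void_algebra D)"
    using void sets.compl_sets[OF void] by (intro sets.countable_UN) auto
  finally show ?thesis .
qed

text \<open>Layers and dyadic cells express the random measure of \<open>B\<close> through
  occurrence events alone. This is valid where the atoms are distinct, and the exceptional null set
  belongs to the algebra.\<close>

lemma measurable_Z_void_algebra:
  assumes d: "d < D" and B[measurable]: "B \<in> sets borel"
  shows "(\<lambda>w. emeasure (Z_process \<omega> A d w) B) \<in> borel_measurable (void_algebra D)"
proof -
  have Bm: "B \<inter> {x. cell m x = k} \<in> sets borel" for m k by measurable
  let ?E = "\<lambda>j m k w. \<exists>n. j < A d n w \<and> \<omega> n w \<in> B \<inter> {x. cell m x = k}"
  define g where "g w = (\<Sum>j. SUP m. \<Sum>k. indicator {w \<in> space M. ?E j m k w} w :: ennreal)" for w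
  have 1: "{w \<in> space M. ?E j m k w} \<in> sets (void_algebra D)" for j m k
    by (rule occurrence_in_void_algebra[OF d Bm])
  have g1: "g \<in> borel_measurable (void_algebra D)"
    unfolding g_def[abs_def] using 1 by measurable
  have 2: "{w \<in> space M. ?E j m k w} \<in> sets M" for j m k by measurable
  have g2: "g \<in> borel_measurable M"
    unfolding g_def[abs_def] using 2 by measurable
  have f: "(\<lambda>w. emeasure (Z_process \<omega> A d w) B) \<in> borel_measurable M"
    unfolding Z_process_def emeasure_atomic_measure[OF B] by measurable
  have "AE w in M. emeasure (Z_process \<omega> A d w) B = g w"
    using AE_inj_atoms AE_space
  proof eventually_elim
    case (elim w)
    have "(\<exists>x\<in>(\<lambda>n. \<omega> n w) ` {n. j < A d n w \<and> \<omega> n w \<in> B}. cell m x = k) \<longleftrightarrow> ?E j m k w" for j m k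
      by auto
    then have "(of_bool (\<exists>x\<in>(\<lambda>n. \<omega> n w) ` {n. j < A d n w \<and> \<omega> n w \<in> B}. cell m x = k) :: ennreal) =
        indicator {w \<in> space M. ?E j m k w} w" for j m k
      using elim(2) by (simp add: indicator_def)
    then show ?case
      unfolding Z_process_def emeasure_atomic_layers[OF B elim(1)] card_eq_SUP_cells g_def by simp
  qed
  then show ?thesis using measurable_void_algebra_AE[OF g1 f g2] by blast
qed

text \<open>Only the inclusion of the data in \<open>void_algebra D\<close> is shown, which also
  contains all null sets. Identities on the larger algebra restrict to the data; measurability of
  the predictive law with respect to the data is a separate matter, settled by
  \<open>measurable_card_observed\<close>.\<close>

lemma subalgebra_data_algebra: "subalgebra M (data_upto D)"
  and sets_data_algebra_subset: "sets (data_upto D) \<subseteq> sets (void_algebra D)"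
  and space_data_algebra: "space (data_upto D) = space M"
  and measurable_Z_data_algebra: "d < D \<Longrightarrow> B \<in> sets borel \<Longrightarrow>
    (\<lambda>w. emeasure (Z_process \<omega> A d w) B) \<in> borel_measurable (data_upto D)"
proof -
  let ?G = "{(\<lambda>w. emeasure (Z_process \<omega> A d w) B) -` S \<inter> space M | d B S.
        d < D \<and> B \<in> sets borel \<and> S \<in> sets borel}"
  have sub: "?G \<subseteq> Pow (space M)" by auto
  have sets: "sets (data_upto D) = sigma_sets (space M) ?G"
    unfolding data_algebra_def by (rule sets_measure_of[OF sub])
  show space: "space (data_upto D) = space M"
    unfolding data_algebra_def by (rule space_measure_of[OF sub])
  have "?G \<subseteq> sets (void_algebra D)"
    using measurable_sets[OF measurable_Z_void_algebra] by auto
  then show sub1: "sets (data_upto D) \<subseteq> sets (void_algebra D)"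
    unfolding sets using sets.sigma_sets_subset[of ?G "void_algebra D"] by simp
  have "void_sets D \<subseteq> sets M" by (auto simp: void_sets_def)
  then have "sets (void_algebra D) \<subseteq> sets M"
    unfolding sets_void_algebra by (rule sets.sigma_sets_subset)
  with sub1 space show "subalgebra M (data_upto D)"
    by (auto simp: subalgebra_def)
  show "(\<lambda>w. emeasure (Z_process \<omega> A d w) B) \<in> borel_measurable (data_upto D)"
    if "d < D" "B \<in> sets borel"
  proof (rule measurableI)
    fix S :: "ennreal set" assume "S \<in> sets borel"
    then show "(\<lambda>w. emeasure (Z_process \<omega> A d w) B) -` S \<inter> space (data_upto D)
        \<in> sets (data_upto D)"
      unfolding sets space using that by (intro sigma_sets.Basic) blast
  qed simp
qed

text \<open>\<open>observed_units\<close> tests uncountably many singletons; the cells replace them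
  by countably many events. The identity used holds for every outcome, as it must, since null sets
  are not added to the data algebra.\<close>

lemma measurable_card_observed:
  "(\<lambda>w. emeasure (count_space UNIV) (observed_units (Z_process \<omega> A) D w))
    \<in> borel_measurable (data_upto D)"
proof -
  let ?F = "data_upto D"
  have obs: "(\<exists>x\<in>observed_units (Z_process \<omega> A) D w. cell m x = k) \<longleftrightarrow>
      (\<exists>d<D. 0 < emeasure (Z_process \<omega> A d w) {x. cell m x = k})" for w m k
  proof -
    have "x \<in> observed_units (Z_process \<omega> A) D w \<longleftrightarrow> (\<exists>d<D. \<exists>n. 0 < A d n w \<and> \<omega> n w = x)" for x
      unfolding observed_units_def Z_process_def by (simp add: emeasure_atomic_pos_iff)
    moreover have "0 < emeasure (Z_process \<omega> A d w) {x. cell m x = k} \<longleftrightarrow> (\<exists>n. 0 < A d n w \<and> cell m (\<omega> n w) = k)" for d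
      unfolding Z_process_def by (simp add: emeasure_atomic_pos_iff)
    ultimately show ?thesis unfolding Bex_def by metis
  qed
  note [measurable] = measurable_Z_data_algebra
  have "Measurable.pred ?F (\<lambda>w. \<exists>d<D. 0 < emeasure (Z_process \<omega> A d w) {x. cell m x = k})" for m k
  proof -
    have "Measurable.pred ?F (\<lambda>w. 0 < emeasure (Z_process \<omega> A d w) {x. cell m x = k})" if "d < D" for d
      using measurable_Z_data_algebra[OF that borel_cell] by measurable
    then have "Measurable.pred ?F (\<lambda>w. \<exists>d\<in>{..<D}. 0 < emeasure (Z_process \<omega> A d w) {x. cell m x = k})"
      by (intro pred_intros_finite(4)) auto
    then show ?thesis by (simp add: Bex_def)
  qed
  then have [measurable]: "(\<lambda>w. of_bool (\<exists>d<D. 0 < emeasure (Z_process \<omega> A d w) {x. cell m x = k}) :: ennreal) \<in> borel_measurable ?F" for m k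
    by measurable
  show ?thesis unfolding card_eq_SUP_cells obs by measurable
qed

lemma AE_card_observed:
  "AE w in M. emeasure (count_space UNIV) (observed_units (Z_process \<omega> A) D w) = observed_count D w"
  using AE_inj_atoms
proof eventually_elim
  case (elim w)
  have "observed_units (Z_process \<omega> A) D w = (\<lambda>n. \<omega> n w) ` {n. seen D n w}"
    unfolding observed_units_def Z_process_def seen_def by (auto simp: emeasure_atomic_pos_iff)
  moreover have "observed_count D w = (\<Sum>n. indicator {n. seen D n w} n)"
    unfolding observed_count_def by (intro suminf_cong) (simp add: indicator_def)
  moreover have "inj_on (\<lambda>n. \<omega> n w) {n. seen D n w}" using elim by (rule inj_on_subset) simp
  ultimately show ?case
    by (simp add: suminf_indicator_card emeasure_count_space card_image finite_image_iff)
qed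

end

section \<open>The predictive law\<close>

text \<open>Values are known for \<open>u\<close> in the half-open unit interval only. After
  division by \<open>u ^ m\<close>, with \<open>m\<close> the first index of disagreement, the limit
  as \<open>u\<close> decreases to 0 isolates the coefficient of index \<open>m\<close>.\<close>

lemma power_series_unique:
  fixes a b :: "nat \<Rightarrow> real"
  assumes bound: "\<And>k. \<bar>a k\<bar> \<le> 1" "\<And>k. \<bar>b k\<bar> \<le> 1"
    and eq: "\<And>u. 0 \<le> u \<Longrightarrow> u < 1 \<Longrightarrow> (\<Sum>k. a k * u ^ k) = (\<Sum>k. b k * u ^ k)"
  shows "a = b"
proof (rule ccontr)
  assume "a \<noteq> b"
  define d where "d k = a k - b k" for k
  define m where "m = (LEAST k. d k \<noteq> 0)"
  have "\<exists>k. d k \<noteq> 0" using \<open>a \<noteq> b\<close> by (auto simp: d_def fun_eq_iff)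
  then have m: "d m \<noteq> 0" unfolding m_def by (rule LeastI_ex)
  have less_m: "d k = 0" if "k < m" for k using that not_less_Least unfolding m_def by blast
  have summable: "summable (\<lambda>k. f k * u ^ k)" if "\<And>k. \<bar>f k\<bar> \<le> C" "\<bar>u\<bar> < 1" for f :: "nat \<Rightarrow> real" and u C :: real
  proof (rule summable_comparison_test')
    show "summable (\<lambda>k. C * \<bar>u\<bar> ^ k)" using that by (intro summable_mult summable_geometric) simp
    show "norm (f k * u ^ k) \<le> C * \<bar>u\<bar> ^ k" if "0 \<le> k" for k
      using \<open>\<And>k. \<bar>f k\<bar> \<le> C\<close> by (simp add: abs_mult power_abs mult_right_mono)
  qed
  have d2: "\<bar>d k\<bar> \<le> 2" for k using bound[of k] unfolding d_def by linarith
  define f where "f u = (\<Sum>k. d (k + m) * u ^ k)" for u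
  have "(f \<longlongrightarrow> d (0 + m)) (at 0)"
    unfolding f_def using d2
    by (intro powser_limit_0[of 1 "\<lambda>k. d (k + m)"]) (auto intro!: summable_sums summable[where C=2])
  then have lim: "(f \<longlongrightarrow> d m) (at_right 0)"
    by (simp add: filterlim_at_split)
  have "f u = 0" if u: "0 < u" "u < 1" for u
  proof -
    have sa: "summable (\<lambda>k. a k * u ^ k)" "summable (\<lambda>k. b k * u ^ k)"
      using u bound by (auto intro!: summable[where C=1])
    have "(\<lambda>k. d k * u ^ k) sums 0"
      using sums_diff[OF summable_sums[OF sa(1)] summable_sums[OF sa(2)]] eq[of u] u
      by (simp add: d_def left_diff_distrib)
    then have "(\<lambda>k. d (k + m) * u ^ (k + m)) sums 0"
      using less_m by (subst sums_iff_shift) simp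
    then have "(\<lambda>k. (d (k + m) * u ^ (k + m)) / u ^ m) sums (0 / u ^ m)"
      by (rule sums_divide)
    then have "(\<lambda>k. d (k + m) * u ^ k) sums 0"
      using u by (simp add: power_add)
    then show ?thesis unfolding f_def by (simp add: sums_iff)
  qed
  then have "\<forall>\<^sub>F u in at_right 0. f u = 0"
    unfolding eventually_at_right_field by (intro exI[of _ 1]) auto
  then have "(f \<longlongrightarrow> 0) (at_right 0)" by (rule tendsto_eventually)
  with lim have "d m = 0" by (intro tendsto_unique[of "at_right (0 :: real)"]) auto
  with m show False by simp
qed

lemma enn2real_count: "enn2real (emeasure (count_space UNIV) S) = real (card S)"
  by (cases "finite S") (auto simp: emeasure_count_space ennreal_of_nat_eq_real_of_nat)

lemma borel_measurable_neg_bin_shape: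
  assumes [measurable]: "f \<in> borel_measurable M"
  shows "(\<lambda>w. neg_bin (f w) p k) \<in> borel_measurable M"
  \<comment> \<open>Written as a finite product, the generalised binomial coefficient is visibly
    measurable in its upper argument.\<close>
  unfolding neg_bin_def gbinomial_prod_rev by measurable

context nbp_model
begin

definition predictive :: "nat \<Rightarrow> nat \<Rightarrow> real" where
  "predictive D0 D1 = psi \<sigma> r (real D0) (real D1) / (\<beta> + psi \<sigma> r 0 (real (D0 + D1)))"

text \<open>The generating function of the negative binomial law of shape 1; its power
  \<open>a\<close> is that of shape \<open>a\<close>, by \<open>neg_bin_pgf_sums\<close>.\<close>

definition thinning :: "nat \<Rightarrow> nat \<Rightarrow> real \<Rightarrow> real" where
  "thinning D0 D1 u = (1 - predictive D0 D1) / (1 - predictive D0 D1 * u)"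

context
  fixes D0 D1 :: nat
  assumes D: "1 \<le> D0" "1 \<le> D1"
begin

abbreviation "p \<equiv> predictive D0 D1"
abbreviation "q \<equiv> thinning D0 D1"
abbreviation "U \<equiv> new_units A D0 D1"
abbreviation "Z \<equiv> Z_process \<omega> A"
abbreviation "N \<equiv> \<lambda>w. card (observed_units Z D0 w)"
abbreviation "data \<equiv> data_algebra M Z D0"
abbreviation "mass w k \<equiv> neg_bin (real (N w) + c + 1) p k"
abbreviation "mean w \<equiv> ennreal ((real (N w) + c + 1) * (p / (1 - p)))"
abbreviation "past u w \<equiv> q u powr (c + 1) * ennreal_power (q u) (observed_count D0 w)"

lemma psi_D:
  "0 < psi \<sigma> r (real D0) (real D1)" "0 < psi \<sigma> r 0 (real D0)"
  "psi \<sigma> r 0 (real (D0 + D1)) = psi \<sigma> r 0 (real D0) + psi \<sigma> r (real D0) (real D1)"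
proof -
  show "0 < psi \<sigma> r (real D0) (real D1)" using D by (intro psi_pos P.sigma pos) auto
  show "0 < psi \<sigma> r 0 (real D0)" using D by (intro psi_pos P.sigma pos) auto
  show "psi \<sigma> r 0 (real (D0 + D1)) = psi \<sigma> r 0 (real D0) + psi \<sigma> r (real D0) (real D1)"
    unfolding of_nat_add by (rule psi_add)
qed

lemma predictive_unit: "0 < p" "p < 1"
  using psi_D pos by (auto simp: predictive_def divide_simps)

lemma thinning_unit:
  assumes "0 \<le> u" "u < 1"
  shows "0 < q u" "q u < 1"
proof -
  have "p * u < p * 1" using assms predictive_unit by (intro mult_strict_left_mono) auto
  then have "p * u < p" "p * u < 1" using predictive_unit by linarith+
  then have "0 < 1 - p" "0 < 1 - p * u" "1 - p < 1 - p * u" using predictive_unit by linarith+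
  then show "0 < q u" "q u < 1"
    unfolding thinning_def by (simp_all only: divide_pos_pos divide_less_eq_1_pos)
qed

text \<open>
  The value of \<open>q u\<close> is the one for which the denominators that \<open>expectation_mark\<close> gives for the
  two sides are proportional.
\<close>
lemma expectation_void_new_units:
  assumes u: "0 \<le> u" "u < 1"
    and K: "finite K" "K \<subseteq> patterns D0" "\<And>b. b \<in> K \<Longrightarrow> B b \<in> sets borel"
  shows "expectation (\<lambda>w. of_bool (\<forall>n. \<not> hit D0 K B n w) * ennreal_power u (U w)) =
    q u powr (c + 1) * expectation (\<lambda>w. of_bool (\<forall>n. \<not> hit D0 K B n w) * ennreal_power (q u) (observed_count D0 w))"
proof -
  let ?\<psi>1 = "psi \<sigma> r (real D0) (real D1)" and ?\<psi>0 = "psi \<sigma> r 0 (real D0)"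
  obtain \<kappa> where \<kappa>: "0 \<le> \<kappa>"
    "\<And>u q. 0 \<le> u \<Longrightarrow> u \<le> 1 \<Longrightarrow> 0 \<le> q \<Longrightarrow> q \<le> 1 \<Longrightarrow>
      expectation (\<lambda>w. iprod (\<lambda>n. mark D0 D1 K B u q n w)) =
      (\<beta> / (\<beta> + ((1 - u) * ?\<psi>1 + (1 - q) * ?\<psi>0 + q * \<kappa>))) powr (c + 1)"
    by (rule expectation_mark[where ?D0.0=D0 and ?D1.0=D1 and B=B, OF K]) (assumption, rule that)
  note q = thinning_unit[OF u]
  let ?L = "\<beta> + ((1 - u) * ?\<psi>1 + \<kappa>)" and ?R = "\<beta> + ((1 - q u) * ?\<psi>0 + q u * \<kappa>)"
  have L: "0 < ?L" using pos psi_D \<kappa>(1) u by (intro add_pos_nonneg add_nonneg_nonneg mult_nonneg_nonneg) auto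
  have R: "0 < ?R" using pos psi_D \<kappa>(1) q by (intro add_pos_nonneg add_nonneg_nonneg mult_nonneg_nonneg) auto
  have den: "0 < \<beta> + ?\<psi>0 + (1 - u) * ?\<psi>1" "0 < \<beta> + ?\<psi>0 + ?\<psi>1"
    using pos psi_D u by (auto intro!: add_pos_nonneg mult_nonneg_nonneg)
  have 1: "1 - p = (\<beta> + ?\<psi>0) / (\<beta> + ?\<psi>0 + ?\<psi>1)"
    and 2: "1 - p * u = (\<beta> + ?\<psi>0 + (1 - u) * ?\<psi>1) / (\<beta> + ?\<psi>0 + ?\<psi>1)"
    unfolding predictive_def psi_D(3) using den by (auto simp: field_simps)
  \<comment> \<open>This is the equation \<open>?R = q u * ?L\<close> after
    \<open>q u * \<kappa>\<close> has cancelled. Hence \<open>q u\<close> does not depend on the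
    region.\<close>
  have "q u * (\<beta> + ?\<psi>0 + (1 - u) * ?\<psi>1) = \<beta> + ?\<psi>0"
    unfolding thinning_def 1 2 using den by simp
  then have RL: "?R = q u * ?L" by (simp add: algebra_simps)
  have "\<beta> / ?L = q u * (\<beta> / ?R)" unfolding RL using q by simp
  then have "(\<beta> / ?L) powr (c + 1) = q u powr (c + 1) * (\<beta> / ?R) powr (c + 1)"
    using q R pos by (simp only: powr_mult less_imp_le divide_nonneg_pos)
  then show ?thesis
    using \<kappa>(2)[of u 1] \<kappa>(2)[of 1 "q u"] u q
    unfolding iprod_mark_future[OF u K(2)] iprod_mark_past[OF less_imp_le[OF q(1)] q(2) K(2)]
    by simp
qed

text \<open>As functions of \<open>E\<close>, both sides are finite measures, with densities bounded
  by 1. They agree on the void sets, and induction over the generated sigma-algebra extends this to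
  \<open>E\<close>.\<close>

lemma expectation_data_new_units:
  assumes u: "0 \<le> u" "u < 1" and E: "E \<in> sets (void_algebra D0)"
  shows "expectation (\<lambda>w. indicator E w * ennreal_power u (U w)) =
    expectation (\<lambda>w. indicator E w * (past u w))"
proof -
  note q = thinning_unit[OF u]
  let ?f = "\<lambda>w. ennreal_power u (U w)"
  let ?g = "\<lambda>w. past u w"
  have f: "0 \<le> ?f w" "?f w \<le> 1" for w using u by (auto intro: ennreal_power_unit)
  have g: "0 \<le> ?g w" "?g w \<le> 1" for w
    using q pos by (auto intro!: mult_nonneg_nonneg mult_le_one powr_le1 ennreal_power_unit)
  let ?F = "density M (\<lambda>w. ennreal (?f w))" and ?G = "density M (\<lambda>w. ennreal (?g w))"
  have fin: "emeasure ?F E' \<noteq> \<infinity>" "emeasure ?G E' \<noteq> \<infinity>" if "E' \<in> sets M" for E'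
    using that f g by (simp_all add: emeasure_density_unit)
  have vM: "sigma_sets (space M) (void_sets D0) \<subseteq> sets M"
    by (rule sets.sigma_sets_subset) (auto simp: void_sets_def)
  have basic: "emeasure ?F E' = emeasure ?G E'" if "E' \<in> void_sets D0" for E'
  proof -
    obtain K B where K: "E' \<in> sets M" "finite K" "K \<subseteq> patterns D0" "\<forall>b\<in>K. B b \<in> sets borel"
      "AE w in M. w \<in> E' \<longleftrightarrow> w \<in> void D0 K B"
      using \<open>E' \<in> void_sets D0\<close> by (rule void_setsE)
    note K(1)[measurable]
    have [measurable]: "Measurable.pred M (hit D0 K B n)" for n
      using K by (intro measurable_hit) auto
    have cong: "expectation (\<lambda>w. indicator E' w * h w) = expectation (\<lambda>w. of_bool (\<forall>n. \<not> hit D0 K B n w) * h w)"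
      if [measurable]: "h \<in> borel_measurable M" for h :: "'a \<Rightarrow> real"
    proof (rule integral_cong_AE)
      show "AE w in M. indicator E' w * h w = of_bool (\<forall>n. \<not> hit D0 K B n w) * h w"
        using K(5) AE_space by eventually_elim (auto simp: void_def indicator_def)
    qed measurable
    have "expectation (\<lambda>w. indicator E' w * ?f w) = expectation (\<lambda>w. indicator E' w * ?g w)"
      using K expectation_void_new_units[OF u K(2,3), of B]
      by (simp add: cong mult.left_commute)
    then show ?thesis using K f g by (simp add: emeasure_density_unit)
  qed
  have "E \<in> sets M \<and> emeasure ?F E = emeasure ?G E"
    using Int_stable_void_sets void_sets_subset E[unfolded sets_void_algebra]
  proof (induction rule: sigma_sets_induct_disjoint)
    case (basic E')
    then show ?case using \<open>\<And>E'. E' \<in> void_sets D0 \<Longrightarrow> emeasure ?F E' = emeasure ?G E'\<close> by (auto simp: void_sets_def)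
  next
    case empty
    show ?case by simp
  next
    case (compl E')
    \<comment> \<open>Complements require equal total masses, which is the agreement on the void
      event of the empty region.\<close>
    have "space M \<in> void_sets D0"
      using void_in_void_sets[of "{}" D0 "\<lambda>_. {}"] by (simp add: void_def hit_def)
    then have "emeasure ?F (space M) = emeasure ?G (space M)" by (rule basic)
    moreover have "space M - E' \<in> sets M" using compl by auto
    ultimately show ?case using compl fin[of E'] emeasure_compl[of E' ?F] emeasure_compl[of E' ?G] by simp
  next
    case (union E')
    then have "range E' \<subseteq> sets M" by auto
    then show ?case
      using union suminf_emeasure[of E' ?F] suminf_emeasure[of E' ?G] by auto
  qed
  then have E: "E \<in> sets M" "emeasure ?F E = emeasure ?G E" by auto
  have nonneg: "0 \<le> expectation (\<lambda>w. indicator E w * h w)" if "\<And>w. 0 \<le> h w" for h :: "'a \<Rightarrow> real"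
    using that by (intro integral_nonneg_AE AE_I2) (auto simp: indicator_def)
  have "emeasure ?F E = ennreal (expectation (\<lambda>w. indicator E w * ?f w))"
    using E(1) f by (intro emeasure_density_unit) measurable
  moreover have "emeasure ?G E = ennreal (expectation (\<lambda>w. indicator E w * ?g w))"
    using E(1) g by (intro emeasure_density_unit) measurable
  ultimately have "ennreal (expectation (\<lambda>w. indicator E w * ?f w)) = ennreal (expectation (\<lambda>w. indicator E w * ?g w))"
    using E(2) by simp
  then show ?thesis
    by (rule iffD1[OF ennreal_inj[OF nonneg[of ?f, OF f(1)] nonneg[of ?g, OF g(1)]]])
qed

lemma AE_observed_units:
  "AE w in M. finite (observed_units Z D0 w) \<and> observed_count D0 w = of_nat (N w)"
  using AE_card_observed AE_observed_count_finite[of D0]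
  by eventually_elim (auto simp: emeasure_count_space split: if_splits)

lemma measurable_card_units: "(\<lambda>w. real (N w)) \<in> borel_measurable data"
  unfolding enn2real_count[symmetric] using measurable_card_observed by measurable

lemma measurable_neg_bin_data: "(\<lambda>w. mass w k) \<in> borel_measurable data"
  by (intro borel_measurable_neg_bin_shape borel_measurable_add measurable_card_units) simp_all

lemma measurable_neg_bin_M[measurable]: "(\<lambda>w. mass w k) \<in> borel_measurable M"
  by (rule measurable_from_subalg[OF subalgebra_data_algebra measurable_neg_bin_data])

lemma shape_pos: "0 < real n + c + 1"
  using pos by linarith

lemma neg_bin_unit: "0 \<le> neg_bin (real n + c + 1) p k" "neg_bin (real n + c + 1) p k \<le> 1"
  using neg_bin_nonneg[OF shape_pos, of p n k] neg_bin_le_1[OF shape_pos, of p "{k}" n] predictive_unit by auto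

lemma new_units_cases: "U w = \<top> \<or> (\<exists>j. U w = of_nat j)"
proof -
  have "U w = (\<Sum>n. indicator {n. \<not> seen D0 n w \<and> seen (D0 + D1) n w} n)"
    unfolding new_units_eq by (intro suminf_cong) (simp add: indicator_def)
  then show ?thesis unfolding suminf_indicator_card by auto
qed

lemma sets_data_M: "E \<in> sets data \<Longrightarrow> E \<in> sets M"
  using subalgebra_data_algebra by (auto simp: subalgebra_def)

text \<open>Both sides are the coefficients of power series in \<open>u\<close> that agree below 1.
  The event \<open>E\<close> is fixed before \<open>u\<close> varies, so no exceptional null set
  depending on \<open>u\<close> arises.\<close>

lemma expectation_data_eq:
  assumes E: "E \<in> sets data"
  shows "expectation (\<lambda>w. indicator E w * of_bool (U w = of_nat k)) =
    expectation (\<lambda>w. indicator E w * mass w k)"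
proof -
  note sets_data_M[OF E, measurable]
  let ?a = "\<lambda>k. expectation (\<lambda>w. indicator E w * of_bool (U w = of_nat k) :: real)"
  let ?b = "\<lambda>k. expectation (\<lambda>w. indicator E w * mass w k)"
  have bound: "\<bar>expectation f\<bar> \<le> 1" if [measurable]: "f \<in> borel_measurable M" and f: "\<And>w. 0 \<le> f w" "\<And>w. f w \<le> 1" for f :: "'a \<Rightarrow> real"
  proof -
    have "expectation f \<le> expectation (\<lambda>_. 1)"
      using f by (intro integral_mono integrable_const_bound[where B=1]) auto
    moreover have "0 \<le> expectation f" using f by (intro integral_nonneg_AE) auto
    ultimately show ?thesis by (simp add: prob_space)
  qed
  have "?a = ?b"
  proof (rule power_series_unique)
    show "\<bar>?a k\<bar> \<le> 1" for k by (rule bound) (auto simp: indicator_def)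
    show "\<bar>?b k\<bar> \<le> 1" for k by (rule bound) (auto simp: indicator_def neg_bin_unit)
    fix u :: real assume u: "0 \<le> u" "u < 1"
    note q = thinning_unit[OF u]
    have "(\<lambda>k. expectation (\<lambda>w. indicator E w * of_bool (U w = of_nat k) * u ^ k :: real)) sums
        expectation (\<lambda>w. indicator E w * ennreal_power u (U w))"
    proof (rule expectation_sums)
      have "(\<lambda>k. indicator E w * of_bool (U w = of_nat k) * u ^ k) sums (indicator E w * ennreal_power u (U w))" for w
        unfolding mult.assoc by (intro sums_mult ennreal_power_sums new_units_cases)
      then show "AE w in M. (\<forall>k. 0 \<le> indicator E w * of_bool (U w = of_nat k) * u ^ k) \<and>
          (\<lambda>k. indicator E w * of_bool (U w = of_nat k) * u ^ k) sums (indicator E w * ennreal_power u (U w)) \<and>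
          indicator E w * ennreal_power u (U w) \<le> 1"
        using u ennreal_power_unit[of u] by (intro AE_I2) (auto simp: indicator_def)
    qed measurable
    then have 1: "(\<lambda>k. ?a k * u ^ k) sums expectation (\<lambda>w. indicator E w * ennreal_power u (U w))" by simp
    have "(\<lambda>k. expectation (\<lambda>w. indicator E w * mass w k * u ^ k)) sums
        expectation (\<lambda>w. indicator E w * (past u w))"
    proof (rule expectation_sums)
      show "AE w in M. (\<forall>k. 0 \<le> indicator E w * mass w k * u ^ k) \<and>
          (\<lambda>k. indicator E w * mass w k * u ^ k) sums
            (indicator E w * past u w) \<and>
          indicator E w * past u w \<le> 1"
        using AE_observed_units
      proof eventually_elim
        case (elim w)
        \<comment> \<open>The shape parameter takes form here: \<open>c + 1\<close> comes from the
          tilt, and every observed unit adds one factor \<open>q u\<close>.\<close>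
        have "past u w = q u powr (c + 1) * q u powr real (N w)"
          using elim q by (simp add: powr_realpow)
        also have "\<dots> = q u powr (real (N w) + c + 1)"
          unfolding powr_add[symmetric] by (simp add: algebra_simps)
        finally have eq: "past u w = q u powr (real (N w) + c + 1)" .
        have "(\<lambda>k. mass w k * u ^ k) sums (q u powr (real (N w) + c + 1))"
          unfolding thinning_def using u predictive_unit by (intro neg_bin_pgf_sums shape_pos) auto
        then have "(\<lambda>k. indicator E w * mass w k * u ^ k) sums
            (indicator E w * (q u powr (real (N w) + c + 1)))"
          unfolding mult.assoc by (rule sums_mult)
        moreover have "q u powr (real (N w) + c + 1) \<le> 1" using q shape_pos[of "N w"] by (intro powr_le1) auto
        ultimately show ?case
          unfolding eq using u neg_bin_unit by (auto simp: indicator_def)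
      qed
    qed measurable
    then have 2: "(\<lambda>k. ?b k * u ^ k) sums
        expectation (\<lambda>w. indicator E w * (past u w))" by simp
    have "E \<in> sets (void_algebra D0)" using E sets_data_algebra_subset by blast
    then show "(\<Sum>k. ?a k * u ^ k) = (\<Sum>k. ?b k * u ^ k)"
      using 1 2 expectation_data_new_units[OF u] by (simp add: sums_iff)
  qed
  then show ?thesis by (simp add: fun_eq_iff)
qed

text \<open>Generating functions at \<open>u < 1\<close> do not see an infinite count. But the
  probabilities of the finite values, taken over the whole space, are expected negative binomial
  masses, and these sum to 1.\<close>

lemma AE_new_units_finite: "AE w in M. U w \<noteq> \<top>"
proof -
  have sp: "space M \<in> sets data" using sets.top[of data] by (simp only: space_data_algebra)
  have "(\<lambda>k. expectation (\<lambda>w. of_bool (U w = of_nat k) :: real)) sums expectation (\<lambda>w. of_bool (U w \<noteq> \<top>))"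
  proof (rule expectation_sums)
    \<comment> \<open>The convention at \<top> makes the power of 1 the indicator of a finite
      count.\<close>
    have "ennreal_power 1 (U w) = of_bool (U w \<noteq> \<top>)" for w
      by (simp add: ennreal_power_def)
    then have "(\<lambda>k. of_bool (U w = of_nat k) :: real) sums of_bool (U w \<noteq> \<top>)" for w
      using ennreal_power_sums[OF new_units_cases[of w], of 1] by (simp only: power_one mult_1_right)
    then show "AE w in M. (\<forall>k. 0 \<le> (of_bool (U w = of_nat k) :: real)) \<and>
        (\<lambda>k. of_bool (U w = of_nat k) :: real) sums of_bool (U w \<noteq> \<top>) \<and> of_bool (U w \<noteq> \<top>) \<le> (1 :: real)"
      by simp
  qed measurable
  moreover have "(\<lambda>k. expectation (\<lambda>w. mass w k)) sums expectation (\<lambda>w. 1)"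
    using neg_bin_unit neg_bin_sums[OF shape_pos, of p] predictive_unit by (intro expectation_sums) auto
  moreover have "expectation (\<lambda>w. of_bool (U w = of_nat k) :: real) = expectation (\<lambda>w. mass w k)" for k
  proof -
    have "expectation (\<lambda>w. indicator (space M) w * f w) = expectation f" for f :: "'a \<Rightarrow> real"
      by (intro Bochner_Integration.integral_cong) auto
    with expectation_data_eq[OF sp, of k] show ?thesis by simp
  qed
  ultimately have "expectation (\<lambda>w. of_bool (U w \<noteq> \<top>) :: real) = 1"
    by (simp add: sums_iff prob_space)
  moreover have "expectation (\<lambda>w. of_bool (U w \<noteq> \<top>) :: real) = prob {w \<in> space M. U w \<noteq> \<top>}"
    by (rule expectation_of_bool) measurable
  ultimately have "prob {w \<in> space M. U w \<noteq> \<top>} = 1" by simp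
  then show ?thesis by (subst (asm) prob_Collect_eq_1) auto
qed

lemma real_cond_exp_new_units:
  "AE w in M. real_cond_exp M data (indicator {w \<in> space M. U w = of_nat k}) w = mass w k"
proof -
  interpret F: finite_measure_subalgebra M data
    by standard (rule subalgebra_data_algebra)
  show ?thesis
  proof (rule F.real_cond_exp_charact)
    fix E assume E: "E \<in> sets data"
    have "set_lebesgue_integral M E (indicator {w \<in> space M. U w = of_nat k}) =
        expectation (\<lambda>w. indicator E w * of_bool (U w = of_nat k) :: real)"
      unfolding set_lebesgue_integral_def
      by (intro Bochner_Integration.integral_cong) (auto simp: indicator_def)
    also have "\<dots> = set_lebesgue_integral M E (\<lambda>w. mass w k)"
      unfolding set_lebesgue_integral_def by (simp add: expectation_data_eq[OF E])
    finally show "set_lebesgue_integral M E (indicator {w \<in> space M. U w = of_nat k}) =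
        set_lebesgue_integral M E (\<lambda>w. mass w k)" .
  next
    show "integrable M (\<lambda>w. mass w k)"
      by (intro integrable_const_bound[where B=1]) (auto simp: neg_bin_unit)
    show "integrable M (indicator {w \<in> space M. U w = of_nat k} :: 'a \<Rightarrow> real)"
      by (intro integrable_const_bound[where B=1]) (auto simp: indicator_def)
  qed (rule measurable_neg_bin_data)
qed

lemma nn_cond_exp_new_units:
  "AE w in M. nn_cond_exp M data U w = mean w"
proof -
  interpret F: finite_measure_subalgebra M data
    by standard (rule subalgebra_data_algebra)
  have "AE w in M. mean w = nn_cond_exp M data U w"
  proof (rule F.nn_cond_exp_charact)
    fix E assume E: "E \<in> sets data"
    note sets_data_M[OF E, measurable]
    have nn: "(\<integral>\<^sup>+w. ennreal (real k * (indicator E w * f w)) \<partial>M) = ennreal (real k * expectation (\<lambda>w. indicator E w * f w))"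
      if [measurable]: "f \<in> borel_measurable M" and f: "\<And>w. 0 \<le> f w" "\<And>w. f w \<le> 1" for f :: "'a \<Rightarrow> real" and k :: nat
    proof -
      have "integrable M (\<lambda>w. indicator E w * f w)"
        using f by (intro integrable_const_bound[where B=1]) (auto simp: indicator_def)
      then show ?thesis using f by (subst nn_integral_eq_integral) auto
    qed
    \<comment> \<open>The expansion of \<open>U\<close> over its finite values gives 0 where
      \<open>U\<close> is infinite, so the equality relies on \<open>AE_new_units_finite\<close>.
      Afterwards each value is exchanged by \<open>expectation_data_eq\<close>.\<close>
    have "(\<integral>\<^sup>+w\<in>E. U w \<partial>M) = (\<integral>\<^sup>+w. (\<Sum>k. ennreal (real k * (indicator E w * of_bool (U w = of_nat k)))) \<partial>M)"
    proof (intro nn_integral_cong_AE, use AE_new_units_finite in eventually_elim)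
      case (elim w)
      then obtain j where j: "U w = of_nat j" using new_units_cases by blast
      have "(\<Sum>k. ennreal (real k * (indicator E w * of_bool (U w = of_nat k)))) =
          (\<Sum>k\<in>{j}. ennreal (real k * (indicator E w * of_bool (U w = of_nat k))))"
        by (intro suminf_finite) (auto simp: j)
      then show ?case by (simp add: j indicator_def ennreal_of_nat_eq_real_of_nat)
    qed
    also have "\<dots> = (\<Sum>k. ennreal (real k * expectation (\<lambda>w. indicator E w * of_bool (U w = of_nat k))))"
      by (subst nn_integral_suminf) (simp_all add: nn)
    also have "\<dots> = (\<Sum>k. ennreal (real k * expectation (\<lambda>w. indicator E w * mass w k)))"
      by (simp only: expectation_data_eq[OF E])
    also have "\<dots> = (\<integral>\<^sup>+w. (\<Sum>k. ennreal (real k * (indicator E w * mass w k))) \<partial>M)"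
      by (subst nn_integral_suminf) (simp_all add: nn neg_bin_unit)
    also have "\<dots> = (\<integral>\<^sup>+w\<in>E. mean w \<partial>M)"
    proof (intro nn_integral_cong)
      fix w
      have "(\<lambda>k. real k * mass w k) sums ((real (N w) + c + 1) * (p / (1 - p)))"
        using predictive_unit by (intro neg_bin_mean_sums shape_pos) auto
      then have "(\<Sum>k. ennreal (real k * mass w k)) = mean w"
        by (intro suminf_ennreal_eq) (auto simp: neg_bin_unit)
      then show "(\<Sum>k. ennreal (real k * (indicator E w * mass w k))) =
          mean w * indicator E w"
        by (simp add: indicator_def)
    qed
    finally show "(\<integral>\<^sup>+w\<in>E. U w \<partial>M) = (\<integral>\<^sup>+w\<in>E. mean w \<partial>M)" .
  next
    show "(\<lambda>w. mean w) \<in> borel_measurable data"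
      using measurable_card_units by measurable
  qed measurable
  then show ?thesis by eventually_elim simp
qed

end

end

theorem proposition5:
  fixes \<sigma> \<beta> c r p :: real
    and P :: "'b measure" and \<Delta> :: "nat \<Rightarrow> 'b \<Rightarrow> real"
    and G :: "real \<Rightarrow> (nat \<Rightarrow> real) measure"
    and M :: "'a measure" and T :: "'a \<Rightarrow> real" and \<theta> \<omega> :: "nat \<Rightarrow> 'a \<Rightarrow> real"
    and A :: "nat \<Rightarrow> nat \<Rightarrow> 'a \<Rightarrow> nat"
    and Z :: "nat \<Rightarrow> 'a \<Rightarrow> real measure"
    and D0 D1 :: nat
    and N :: "'a \<Rightarrow> nat" and U :: "'a \<Rightarrow> ennreal"
  assumes "0 < \<sigma>" "\<sigma> < 1" "\<beta> > 0" "c > 0" "r > 0" "D0 \<ge> 1" "D1 \<ge> 1"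
    and "prob_space P" "ordered_poisson_points (stable_intensity \<sigma>) P \<Delta>" "ratio_law P \<Delta> G"
    and "prob_space M" "SBSP \<beta> \<sigma> c G M T \<theta> \<omega>" "NBP_counts M r \<theta> \<omega> A"
  defines "Z \<equiv> Z_process \<omega> A"
    and "N \<equiv> \<lambda>w. card (observed_units Z D0 w)"
    and "U \<equiv> new_units A D0 D1"
    and "p \<equiv> psi \<sigma> r (real D0) (real D1) / (\<beta> + psi \<sigma> r 0 (real (D0 + D1)))"
  shows "0 < p \<and> p < 1 \<and>
    (AE w in M. finite (observed_units Z D0 w) \<and> 0 < N w \<longrightarrow>
       (\<forall>k. real_cond_exp M (data_algebra M Z D0) (indicator {w \<in> space M. U w = of_nat k}) w =
            neg_bin (real (N w) + c + 1) p k) \<and>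
       nn_cond_exp M (data_algebra M Z D0) U w =
         ennreal ((real (N w) + c + 1) * (p / (1 - p))))"
proof -
  interpret P: stable_points P \<Delta> \<sigma>
    using assms(1,2,8,9) by (simp add: stable_points_def stable_points_axioms_def)
  interpret X: nbp_model P \<Delta> \<sigma> M \<beta> c r G T \<theta> \<omega> A
    using assms(3,4,5,10,11,12,13) P.stable_points_axioms
    by (simp add: nbp_model_def nbp_model_axioms_def)
  have p: "p = X.predictive D0 D1"
    by (simp add: p_def X.predictive_def)
  have "AE w in M. \<forall>k. real_cond_exp M (data_algebra M Z D0) (indicator {w \<in> space M. U w = of_nat k}) w =
      neg_bin (real (N w) + c + 1) p k"
    unfolding AE_all_countable p Z_def N_def U_def
    using X.real_cond_exp_new_units[OF assms(6,7)] by blast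
  moreover have "AE w in M. nn_cond_exp M (data_algebra M Z D0) U w = ennreal ((real (N w) + c + 1) * (p / (1 - p)))"
    unfolding p Z_def N_def U_def by (rule X.nn_cond_exp_new_units[OF assms(6,7)])
  ultimately have "AE w in M. finite (observed_units Z D0 w) \<and> 0 < N w \<longrightarrow>
       (\<forall>k. real_cond_exp M (data_algebra M Z D0) (indicator {w \<in> space M. U w = of_nat k}) w =
            neg_bin (real (N w) + c + 1) p k) \<and>
       nn_cond_exp M (data_algebra M Z D0) U w =
         ennreal ((real (N w) + c + 1) * (p / (1 - p)))"
    by eventually_elim simp
  with X.predictive_unit[OF assms(6,7)] show ?thesis
    unfolding p by simp
qed

end
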